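(* Let $N\ge 1$, let $f\in C(\mathbb R^N)$ be real-valued, and let $\Omega=\{(x,x_{N+1})\in\mathbb R^{N+1}: x_{N+1}>f(x)\}$. Let $\phi\in C^2(\mathbb R)$ satisfy $\phi(0)=0$ and $0<\delta_1\le\phi'(s)\le\delta_2$ for all $s\in\mathbb R$, where $\delta_1,\delta_2$ are positive constants. Let $U=U(X,t)$ be the unique bounded solution of either the initial-boundary value problem $$\partial_tU=\Delta\phi(U)\ \text{in }\Omega\times(0,+\infty),\quad U=1\ \text{on }\partial\Omega\times(0,+\infty),\quad U=0\ \text{on }\Omega\times\{0\},$$ or the Cauchy problem $$\partial_tU=\Delta\phi(U)\ \text{in }\mathbb R^{N+1}\times(0,+\infty),\quad U=\chi_{\mathbb R^{N+1}\setminus\Omega}\ \text{on }\mathbb R^{N+1}\times\{0\}.$$ Assume that there exists a basis $\{y^1,\dots,y^N\}$ of $\mathbb R^N$ such that for every $j=1,\dots,N$ the function $x\mapsto f(x+y^j)-f(x)$ has either a maximum or a minimum in $\mathbb R^N$. Suppose that $U$ has a stationary level surface $\Gamma$ in $\Omega$. Then $f$ is affine and $\partial\Omega$ must be a hyperplane.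
   Context: Here $\Delta=\sum_{j=1}^{N+1}\partial^2/\partial x_j^2$ and $\chi_A$ is the characteristic function of $A$. Solution classes. For the initial-boundary value problem, $U\in C^{2,1}(\Omega\times(0,+\infty))\cap L^\infty(\Omega\times(0,+\infty))\cap C(\overline\Omega\times(0,+\infty))$ and the initial condition means $U(\cdot,t)\to0$ in $L^1_{loc}(\Omega)$ as $t\to0^+$. For the Cauchy problem, $U\in C^{2,1}(\mathbb R^{N+1}\times(0,+\infty))\cap L^\infty(\mathbb R^{N+1}\times(0,+\infty))$ and the initial condition means $U(\cdot,t)\to\chi_{\mathbb R^{N+1}\setminus\Omega}$ in $L^1_{loc}(\mathbb R^{N+1})$ as $t\to0^+$. In each case the solution is unique. A hypersurface $\Gamma$ in $\Omega$ is said to be a stationary level surface of $U$ if at each time $t$ the solution $U$ remains constant on $\Gamma$ (a constant depending on $t$). *)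

theory Defs
  imports "HOL-Analysis.Analysis"
begin

text \<open>
  The space \<open>\<real>\<^sup>N\<^sup>+\<^sup>1\<close> is the type \<open>(real^'n) \<times> real\<close> with \<open>N = CARD('n)\<close>; its norm, inner product and
  Lebesgue measure are the Euclidean ones, and its \<open>Basis\<close> consists of the N+1 coordinate vectors.
  A space-time function is curried, \<open>U X t\<close>. Such functions are total, but every condition below
  only concerns the values on the domain of the respective problem.
\<close>

definition above_graph :: "(real^'n \<Rightarrow> real) \<Rightarrow> ((real^'n) \<times> real) set" where
  "above_graph f = {(x, s). s > f x}"

definition partial_deriv :: "'a::euclidean_space \<Rightarrow> ('a \<Rightarrow> real) \<Rightarrow> 'a \<Rightarrow> real" where
  "partial_deriv e g X = deriv (\<lambda>h. g (X + h *\<^sub>R e)) 0"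

definition laplacian :: "('a::euclidean_space \<Rightarrow> real) \<Rightarrow> 'a \<Rightarrow> real" where
  "laplacian g X = (\<Sum>e\<in>Basis. partial_deriv e (partial_deriv e g) X)"

text \<open>
  The class \<open>C\<^sup>2\<^sup>,\<^sup>1(D \<times> (0,\<infinity>))\<close> for open \<open>D\<close>: two derivatives in space, one in time, all jointly
  continuous. The functions \<open>Ut\<close>, \<open>Ux\<close>, \<open>Uxx\<close> are the corresponding derivatives.
\<close>

definition C21_on :: "'a::euclidean_space set \<Rightarrow> ('a \<Rightarrow> real \<Rightarrow> real) \<Rightarrow> bool" where
  "C21_on D U \<longleftrightarrow>
     (\<exists>Ut Ux Uxx.
        continuous_on (D \<times> {0<..}) (\<lambda>(X, t). U X t) \<and>
        continuous_on (D \<times> {0<..}) (\<lambda>(X, t). Ut X t) \<and>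
        (\<forall>X\<in>D. \<forall>t>0. (U X has_real_derivative Ut X t) (at t)) \<and>
        (\<forall>i\<in>Basis.
           continuous_on (D \<times> {0<..}) (\<lambda>(X, t). Ux i X t) \<and>
           (\<forall>X\<in>D. \<forall>t>0. ((\<lambda>h. U (X + h *\<^sub>R i) t) has_real_derivative Ux i X t) (at 0))) \<and>
        (\<forall>i\<in>Basis. \<forall>j\<in>Basis.
           continuous_on (D \<times> {0<..}) (\<lambda>(X, t). Uxx i j X t) \<and>
           (\<forall>X\<in>D. \<forall>t>0. ((\<lambda>h. Ux i (X + h *\<^sub>R j) t) has_real_derivative Uxx i j X t) (at 0))))"

text \<open>
  Convergence \<open>U(\<cdot>,t) \<rightarrow> u\<^sub>0\<close> in \<open>L\<^sup>1\<^sub>l\<^sub>o\<^sub>c(D)\<close> as \<open>t \<rightarrow> 0+\<close>. Integrability is demanded explicitly because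
  the integral of a non-integrable function is 0 by convention.
\<close>

definition initial_L1loc ::
    "'a::euclidean_space set \<Rightarrow> ('a \<Rightarrow> real \<Rightarrow> real) \<Rightarrow> ('a \<Rightarrow> real) \<Rightarrow> bool" where
  "initial_L1loc D U u0 \<longleftrightarrow>
     (\<forall>K. compact K \<and> K \<subseteq> D \<longrightarrow>
        (\<forall>t>0. set_integrable lborel K (\<lambda>X. U X t - u0 X)) \<and>
        ((\<lambda>t. LINT X:K|lborel. \<bar>U X t - u0 X\<bar>) \<longlongrightarrow> 0) (at_right 0))"

text \<open>
  Bounded classical solutions of \<open>\<partial>\<^sub>t U = \<Delta>\<phi>(U)\<close> in \<open>D \<times> (0,\<infinity>)\<close>. Since \<open>U\<close> is continuous and \<open>D\<close> open,
  membership in \<open>L\<^sup>\<infinity>\<close> is boundedness.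
\<close>

definition bounded_diffusion_solution ::
    "(real \<Rightarrow> real) \<Rightarrow> 'a::euclidean_space set \<Rightarrow> ('a \<Rightarrow> real \<Rightarrow> real) \<Rightarrow> bool" where
  "bounded_diffusion_solution \<phi> D U \<longleftrightarrow>
     C21_on D U \<and>
     bounded ((\<lambda>(X, t). U X t) ` (D \<times> {0<..})) \<and>
     (\<forall>X\<in>D. \<forall>t>0. deriv (U X) t = laplacian (\<lambda>Y. \<phi> (U Y t)) X)"

definition initial_boundary_solution ::
    "(real \<Rightarrow> real) \<Rightarrow> 'a::euclidean_space set \<Rightarrow> ('a \<Rightarrow> real \<Rightarrow> real) \<Rightarrow> bool" where
  "initial_boundary_solution \<phi> \<Omega> U \<longleftrightarrow>
     bounded_diffusion_solution \<phi> \<Omega> U \<and>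
     continuous_on (closure \<Omega> \<times> {0<..}) (\<lambda>(X, t). U X t) \<and>
     (\<forall>X\<in>frontier \<Omega>. \<forall>t>0. U X t = 1) \<and>
     initial_L1loc \<Omega> U (\<lambda>X. 0)"

definition cauchy_solution ::
    "(real \<Rightarrow> real) \<Rightarrow> 'a::euclidean_space set \<Rightarrow> ('a \<Rightarrow> real \<Rightarrow> real) \<Rightarrow> bool" where
  "cauchy_solution \<phi> \<Omega> U \<longleftrightarrow>
     bounded_diffusion_solution \<phi> UNIV U \<and>
     initial_L1loc UNIV U (indicator (- \<Omega>))"

text \<open>
  A hypersurface in an open set \<open>\<Omega>\<close> is nonempty, without boundary in \<open>\<Omega>\<close> (relatively closed, so a
  small patch of a surface does not count) and locally an embedded topological manifold of
  codimension one. No smoothness and no connectedness is required.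
\<close>

definition hypersurface_in :: "((real^'n) \<times> real) set \<Rightarrow> ((real^'n) \<times> real) set \<Rightarrow> bool" where
  "hypersurface_in \<Omega> \<Gamma> \<longleftrightarrow>
     \<Gamma> \<noteq> {} \<and>
     closedin (top_of_set \<Omega>) \<Gamma> \<and>
     (\<forall>P\<in>\<Gamma>. \<exists>V (W :: (real^'n) set).
        P \<in> V \<and> openin (top_of_set \<Gamma>) V \<and> open W \<and> V homeomorphic W)"

definition stationary_level_surface ::
    "((real^'n) \<times> real) set \<Rightarrow> ((real^'n) \<times> real \<Rightarrow> real \<Rightarrow> real) \<Rightarrow>
     ((real^'n) \<times> real) set \<Rightarrow> bool" where
  "stationary_level_surface \<Omega> U \<Gamma> \<longleftrightarrow>
     hypersurface_in \<Omega> \<Gamma> \<and> (\<forall>t>0. (\<lambda>X. U X t) constant_on \<Gamma>)"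

end

theory Submission
  imports Defs
begin

text \<open>
  Short-time asymptotics show that \<open>U\<close> at a point \<open>P\<close> of \<open>\<Omega>\<close> decays like \<open>exp (- d(P)\<^sup>2 / (4 \<phi>'(0) t))\<close>,
  where \<open>d\<close> is the distance to the complement; hence \<open>d\<close> is a constant \<open>R\<close> on \<open>\<Gamma>\<close>, and by invariance of
  domain \<open>\<Gamma>\<close> is the whole level set \<open>{d = R}\<close>, the graph of a continuous function. Since \<open>U\<close> has a
  negative vertical derivative, each point of \<open>\<Gamma>\<close> has exactly one nearest boundary point, which is
  given by the gradient of \<open>U\<close> and depends continuously on the point; as it is at distance \<open>R\<close>, Brouwer's
  theorem shows that every boundary point arises in this way.

  Now slide: if \<open>f (x + y) - f x\<close> has its maximum \<open>h\<close> at \<open>x0\<close>, then \<open>\<Omega> + (y, h) \<subseteq> \<Omega>\<close>, so \<open>U\<close> shifted by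
  \<open>(y, h)\<close> is at most \<open>U\<close>. The boundary point over \<open>x0\<close> is touched from a point \<open>P\<close> of \<open>\<Gamma>\<close>, and both
  \<open>P\<close> and \<open>P + (y, h)\<close> lie on \<open>\<Gamma>\<close>; the strong maximum principle gives equality everywhere, so the
  increment is constant. Applied to a basis, this makes every increment of \<open>f\<close> periodic, so that it
  attains a maximum and is constant in turn.
\<close>

subsection \<open>Functions extended by zero and integration by parts\<close>

text \<open>The graph may be rough and grow arbitrarily, and the initial data jump and are attained
  only in L1loc, so no classical argument compares solutions up to time 0 or at infinity. Comparison
  is therefore proved in L1, for the pair w = u1 - u2 and z = \<phi>(u1) - \<phi>(u2) with w_t at
  most the Laplacian of z: the sign of z is tested against translates of one bump, and only suprema
  over all translates enter. Classical minimum principles are used only in compact tubes at positive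
  times. The short-time asymptotics enter solely as an order: a smaller distance forces a larger U
  for all small t. This follows from Gaussian barriers with diffusivities on either side of
  \<phi>'(0); the lower barrier is itself kept small, and the upper one meets only small values of
  U. Since U has just two space derivatives, its equation cannot be differentiated; the sign of the
  vertical derivative comes from small shifts, through a lower bound proportional to the size of the
  shift. Both problems are treated at once by means of a set D, equal to \<Omega> or to the whole
  space.\<close>

lemma continuous_on_extend_zero:
  fixes F :: "'a::metric_space \<Rightarrow> real"
  assumes "open E" "continuous_on (E \<inter> S) F"
    and zero: "\<And>p. p \<in> S - E \<Longrightarrow> \<exists>e>0. \<forall>q\<in>ball p e \<inter> E \<inter> S. F q = 0"
  shows "continuous_on S (\<lambda>p. if p \<in> E then F p else 0)"
  unfolding continuous_on_def
proof
  fix p assume p: "p \<in> S"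
  show "((\<lambda>p. if p \<in> E then F p else 0) \<longlongrightarrow> (if p \<in> E then F p else 0)) (at p within S)"
  proof (cases "p \<in> E")
    case True
    have "(F \<longlongrightarrow> F p) (at p within (E \<inter> S))"
      using assms(2) p True by (auto simp: continuous_on_def)
    also have "at p within (E \<inter> S) = at p within S"
      by (rule at_within_nhd[OF True \<open>open E\<close>]) auto
    finally have "(F \<longlongrightarrow> F p) (at p within S)" .
    moreover have "\<forall>\<^sub>F q in at p within S. F q = (if q \<in> E then F q else 0)"
      using \<open>open E\<close> True unfolding eventually_at_topological by auto
    ultimately show ?thesis using True by (simp add: tendsto_cong)
  next
    case False
    then obtain e where "e > 0" "\<forall>q\<in>ball p e \<inter> E \<inter> S. F q = 0" using zero p by blast
    then have "\<forall>\<^sub>F q in at p within S. (if q \<in> E then F q else 0) = 0"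
      unfolding eventually_at by (auto simp: dist_commute intro!: exI[of _ e])
    then show ?thesis using False by (simp add: tendsto_eventually)
  qed
qed

text \<open>Together with the preceding continuity lemma, this moves integrals from D, whose
  boundary may be irregular, to the whole space: the functions involved vanish near the complement
  of D.\<close>

lemma has_derivative_line_extend_zero:
  fixes F :: "'a::real_normed_vector \<Rightarrow> real"
  assumes "open D"
    and zero: "\<And>X. X \<notin> D \<Longrightarrow> \<exists>e>0. \<forall>Y\<in>ball X e \<inter> D. F Y = 0"
    and d: "X \<in> D \<Longrightarrow> ((\<lambda>h. F (X + h *\<^sub>R i)) has_real_derivative d) (at 0)"
  shows "((\<lambda>h. if X + h *\<^sub>R i \<in> D then F (X + h *\<^sub>R i) else 0)
           has_real_derivative (if X \<in> D then d else 0)) (at 0)"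
proof (cases "X \<in> D")
  case True
  have lim: "((\<lambda>h. X + h *\<^sub>R i) \<longlongrightarrow> X) (nhds 0)"
    by (rule tendsto_eq_intros refl filterlim_ident | simp)+
  have "\<forall>\<^sub>F h in nhds 0. X + h *\<^sub>R i \<in> D"
    using topological_tendstoD[OF lim \<open>open D\<close> True] .
  then have "\<forall>\<^sub>F h in nhds 0. (if X + h *\<^sub>R i \<in> D then F (X + h *\<^sub>R i) else 0) = F (X + h *\<^sub>R i)"
    by eventually_elim auto
  then show ?thesis
    using d True by (subst DERIV_cong_ev[OF refl _ refl]) auto
next
  case False
  then obtain e where e: "e > 0" "\<forall>Y\<in>ball X e \<inter> D. F Y = 0" using zero by blast
  have lim: "((\<lambda>h. X + h *\<^sub>R i) \<longlongrightarrow> X) (nhds 0)"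
    by (rule tendsto_eq_intros refl filterlim_ident | simp)+
  have "\<forall>\<^sub>F h in nhds 0. X + h *\<^sub>R i \<in> ball X e"
    using topological_tendstoD[OF lim open_ball] e by auto
  then have "\<forall>\<^sub>F h in nhds 0. (if X + h *\<^sub>R i \<in> D then F (X + h *\<^sub>R i) else 0) = 0"
    by eventually_elim (use e in auto)
  then show ?thesis
    using False by (subst DERIV_cong_ev[OF refl _ refl]) auto
qed

lemma line_derivative_shift:
  fixes G :: "'a::real_normed_vector \<Rightarrow> real"
  assumes "((\<lambda>h. G ((X + x *\<^sub>R i) + h *\<^sub>R i)) has_real_derivative d) (at 0)"
  shows "((\<lambda>h. G (X + h *\<^sub>R i)) has_real_derivative d) (at x)"
proof -
  have "((\<lambda>h. G (X + (x + h) *\<^sub>R i)) has_real_derivative d) (at 0)"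
    using assms by (simp add: algebra_simps)
  then show ?thesis
    using DERIV_at_within_shift[of "\<lambda>h. G (X + h *\<^sub>R i)" d x 0 UNIV] by (simp add: add.commute)
qed

lemma compact_support_integral:
  fixes G :: "'a::euclidean_space \<Rightarrow> real"
  assumes c: "continuous_on UNIV G" and z: "\<And>X. X \<notin> K \<Longrightarrow> G X = 0" and "K \<subseteq> cbox a b"
  shows "G integrable_on UNIV" "integral UNIV G = integral (cbox a b) G" "integrable lborel G"
    "integral\<^sup>L lborel G = integral UNIV G"
proof -
  have eq: "(\<lambda>X. if X \<in> cbox a b then G X else 0) = G" using z \<open>K \<subseteq> _\<close> by (auto simp: fun_eq_iff)
  have i: "G integrable_on cbox a b" using c integrable_continuous continuous_on_subset by blast
  show "G integrable_on UNIV" using integrable_restrict_UNIV[of "cbox a b" G] i eq by simp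
  show "integral UNIV G = integral (cbox a b) G" using integral_restrict_UNIV[of "cbox a b" G] eq by simp
  have "integrable lborel (\<lambda>x. indicator (cbox a b) x *\<^sub>R G x)"
    using borel_integrable_compact[OF compact_cbox continuous_on_subset[OF c]]
    by simp
  moreover have "(\<lambda>x. indicator (cbox a b) x *\<^sub>R G x) = G" using assms by (auto simp: indicator_def fun_eq_iff)
  ultimately show "integrable lborel G" by simp
  then show "integral\<^sup>L lborel G = integral UNIV G"
    by (metis has_integral_integral_lborel integral_unique)
qed

text \<open>Translation invariance replaces the divergence theorem: the integral of
  \<open>G (X + h *\<^sub>R i)\<close> does not depend on h, and differentiation under the integral
  at h = 0 gives the integral of g.\<close>

lemma integral_partial_derivative_compact_support:
  fixes G g :: "'a::euclidean_space \<Rightarrow> real"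
  assumes G: "continuous_on UNIV G" and g: "continuous_on UNIV g"
    and d: "\<And>X. ((\<lambda>h. G (X + h *\<^sub>R i)) has_real_derivative g X) (at 0)"
    and z: "\<And>X. X \<notin> cball a r \<Longrightarrow> G X = 0"
  shows "integral UNIV g = 0"
proof -
  \<comment> \<open>The extra \<open>norm i\<close> keeps the supports of all translates with |h| <=
    1 inside one box.\<close>
  obtain c where c: "cball a (r + norm i) \<subseteq> cbox (-c) c"
    using bounded_subset_cbox_symmetric[OF bounded_cball] by blast
  have sub: "cball a r \<subseteq> cbox (-c) c"
    using c subset_cball[of r "r + norm i" a] by (simp del: subset_cball)
  define \<Phi> where "\<Phi> h = integral (cbox (-c) c) (\<lambda>X. G (X + h *\<^sub>R i))" for h
  have d': "((\<lambda>h. G (X + h *\<^sub>R i)) has_real_derivative g (X + x *\<^sub>R i)) (at x within U)" for X x U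
    by (rule has_field_derivative_at_within, rule line_derivative_shift[where G = G]) (rule d)
  have contG: "continuous_on S (\<lambda>X. G (X + h *\<^sub>R i))" for S h
    by (rule continuous_on_compose2[OF G]) (auto intro!: continuous_intros)
  have "(\<Phi> has_field_derivative integral (cbox (-c) c) (\<lambda>X. g (X + 0 *\<^sub>R i))) (at 0 within {-1..1})"
    unfolding \<Phi>_def
  proof (rule leibniz_rule_field_derivative)
    show "continuous_on ({- 1..1} \<times> cbox (- c) c) (\<lambda>(x, t). g (t + x *\<^sub>R i))"
      unfolding split_beta
      by (rule continuous_on_compose2[OF g]) (auto intro!: continuous_intros)
  qed (auto intro!: d' integrable_continuous contG)
  moreover have "\<Phi> h = integral UNIV G" if h: "h \<in> {-1..1}" for h
  proof -
    have supp: "G (X + h *\<^sub>R i) = 0" if "X \<notin> cball a (r + norm i)" for X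
    proof (rule z)
      have "norm (X - a) \<le> norm (X + h *\<^sub>R i - a) + norm (h *\<^sub>R i)"
        using norm_triangle_ineq4[of "X + h *\<^sub>R i - a" "h *\<^sub>R i"] by simp
      moreover have "norm (h *\<^sub>R i) \<le> norm i" using h by (auto simp: mult_left_le_one_le abs_le_iff)
      ultimately show "X + h *\<^sub>R i \<notin> cball a r"
        using that by (auto simp: dist_norm norm_minus_commute)
    qed
    have "\<Phi> h = integral UNIV (\<lambda>X. G (X + h *\<^sub>R i))"
      unfolding \<Phi>_def using compact_support_integral(2)[OF contG supp c] by simp
    also have "\<dots> = integral\<^sup>L lborel (\<lambda>X. G (X + h *\<^sub>R i))"
      using compact_support_integral(4)[OF contG supp c] by simp
    also have "\<dots> = integral\<^sup>L (distr lborel borel ((+) (h *\<^sub>R i))) G"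
      using borel_measurable_continuous_onI[OF G]
      by (subst integral_distr) (auto simp: add.commute)
    also have "\<dots> = integral\<^sup>L lborel G" by (simp add: lborel_distr_plus)
    also have "\<dots> = integral UNIV G" using compact_support_integral(4)[OF G z sub] by simp
    finally show ?thesis .
  qed
  then have ev: "\<forall>\<^sub>F h in nhds 0. \<Phi> h = integral UNIV G"
    using eventually_nhds_in_open[of "{-1<..<1}" "0::real"] by (auto elim!: eventually_mono)
  have "(\<Phi> has_field_derivative 0) (at 0)"
    by (subst DERIV_cong_ev[OF refl ev refl]) auto
  ultimately have "integral (cbox (-c) c) g = 0"
    using at_within_Icc_at[of "-1" "0::real" 1] DERIV_unique[of \<Phi> "integral (cbox (-c) c) g" 0 0] by simp
  moreover have "integral UNIV g = integral (cbox (-c) c) g"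
  proof (rule compact_support_integral(2)[OF g _ sub])
    fix X assume X: "X \<notin> cball a r"
    have lim: "((\<lambda>h. X + h *\<^sub>R i) \<longlongrightarrow> X) (nhds 0)"
      by (rule tendsto_eq_intros refl filterlim_ident | simp)+
    have "\<forall>\<^sub>F h in nhds 0. X + h *\<^sub>R i \<in> - cball a r"
      using X by (intro topological_tendstoD[OF lim]) (auto intro: open_Compl)
    then have "\<forall>\<^sub>F h in nhds 0. G (X + h *\<^sub>R i) = 0" by eventually_elim (use z in auto)
    then have "((\<lambda>h. G (X + h *\<^sub>R i)) has_real_derivative 0) (at 0)"
      by (subst DERIV_cong_ev[OF refl _ refl]) auto
    then show "g X = 0" using d DERIV_unique by blast
  qed
  ultimately show ?thesis by simp
qed

text \<open>A working form of \<open>C21_on\<close>: the derivatives are arguments, so that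
  differences and translates name theirs explicitly, and the second derivatives are the pure ones,
  which form the Laplacian.\<close>

definition c21 :: "'a::euclidean_space set \<Rightarrow> ('a \<Rightarrow> real \<Rightarrow> real) \<Rightarrow> ('a \<Rightarrow> real \<Rightarrow> real) \<Rightarrow>
    ('a \<Rightarrow> 'a \<Rightarrow> real \<Rightarrow> real) \<Rightarrow> ('a \<Rightarrow> 'a \<Rightarrow> real \<Rightarrow> real) \<Rightarrow> bool" where
  "c21 D z zt zx zxx \<longleftrightarrow>
     continuous_on (D \<times> {0<..}) (\<lambda>(X, t). z X t) \<and>
     continuous_on (D \<times> {0<..}) (\<lambda>(X, t). zt X t) \<and>
     (\<forall>X\<in>D. \<forall>t>0. (z X has_real_derivative zt X t) (at t)) \<and>
     (\<forall>i\<in>Basis. continuous_on (D \<times> {0<..}) (\<lambda>(X, t). zx i X t) \<and>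
        continuous_on (D \<times> {0<..}) (\<lambda>(X, t). zxx i X t) \<and>
        (\<forall>X\<in>D. \<forall>t>0. ((\<lambda>h. z (X + h *\<^sub>R i) t) has_real_derivative zx i X t) (at 0) \<and>
           ((\<lambda>h. zx i (X + h *\<^sub>R i) t) has_real_derivative zxx i X t) (at 0)))"

lemma c21_const: "c21 E (\<lambda>X t. k) (\<lambda>X t. 0) (\<lambda>i X t. 0) (\<lambda>i X t. 0)"
  by (auto simp: c21_def)

lemma c21_mono: "c21 E z zt zx zxx \<Longrightarrow> F \<subseteq> E \<Longrightarrow> c21 F z zt zx zxx"
  unfolding c21_def by (meson Sigma_mono continuous_on_subset order_refl subsetD)

lemma c21_translate:
  assumes z: "c21 D z zt zx zxx" and E: "\<And>X. X \<in> E \<Longrightarrow> X + \<xi> \<in> D"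
  shows "c21 E (\<lambda>X. z (X + \<xi>)) (\<lambda>X. zt (X + \<xi>)) (\<lambda>i X. zx i (X + \<xi>)) (\<lambda>i X. zxx i (X + \<xi>))"
proof -
  have c: "continuous_on (E \<times> {0<..}) (\<lambda>(X, t). F (X + \<xi>) t)"
    if "continuous_on (D \<times> {0<..}) (\<lambda>(X, t). F X t)" for F :: "'a \<Rightarrow> real \<Rightarrow> real"
  proof -
    have "continuous_on (E \<times> {0<..}) (\<lambda>q. (\<lambda>(X, t). F X t) (fst q + \<xi>, snd q))"
      by (rule continuous_on_compose2[OF that]) (use E in \<open>auto intro!: continuous_intros\<close>)
    then show ?thesis by (simp add: split_beta)
  qed
  have s: "X + h *\<^sub>R i + \<xi> = (X + \<xi>) + h *\<^sub>R i" for X i h by (simp add: algebra_simps)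
  show ?thesis
    using z E unfolding c21_def s by (auto intro!: c)
qed

lemma c21_diff:
  assumes "c21 D z zt zx zxx" "c21 D y yt yx yxx"
  shows "c21 D (\<lambda>X t. z X t - y X t) (\<lambda>X t. zt X t - yt X t) (\<lambda>i X t. zx i X t - yx i X t) (\<lambda>i X t. zxx i X t - yxx i X t)"
  using assms unfolding c21_def split_beta by (auto intro!: continuous_intros DERIV_diff)

section \<open>A compactly supported test function and a smoothed sign function\<close>

lemma max0_power_has_derivative:
  "((\<lambda>y::real. (max 0 y) ^ Suc (Suc n)) has_real_derivative of_nat (Suc (Suc n)) * (max 0 y) ^ Suc n) (at y)"
proof -
  consider "y > 0" | "y < 0" | "y = 0" by linarith
  then show ?thesis
  proof cases
    case 1
    have ev: "\<forall>\<^sub>F x in nhds y. (max 0 x) ^ Suc (Suc n) = x ^ Suc (Suc n)"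
      using eventually_nhds_in_open[of "{0<..}" y] 1 by (auto elim: eventually_mono)
    show ?thesis using 1 DERIV_pow[of "Suc (Suc n)" y UNIV] by (subst DERIV_cong_ev[OF refl ev refl]) simp
  next
    case 2
    have ev: "\<forall>\<^sub>F x in nhds y. (max 0 x) ^ Suc (Suc n) = 0"
      using eventually_nhds_in_open[of "{..<0}" y] 2 by (auto elim: eventually_mono)
    show ?thesis using 2 by (subst DERIV_cong_ev[OF refl ev refl]) auto
  next
    case 3
    have "isCont (\<lambda>x::real. (max 0 x) ^ Suc n) y" by (intro continuous_intros)
    moreover have "(max 0 x) ^ Suc (Suc n) - (max 0 y) ^ Suc (Suc n) = (max 0 x) ^ Suc n * (x - y)" for x :: real
      using 3 by (cases "x \<ge> 0") auto
    ultimately show ?thesis unfolding CARAT_DERIV using 3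
      by (intro exI[of _ "\<lambda>x. (max 0 x) ^ Suc n"]) auto
  qed
qed

text \<open>The third power is the smallest integer power that makes the cut-off twice continuously
  differentiable; \<open>bump_d\<close> and \<open>bump_dd\<close> below are its first and second
  derivatives along a basis vector.\<close>

definition bump :: "'a::euclidean_space \<Rightarrow> real" where
  "bump X = (max 0 (1 - X \<bullet> X)) ^ 3"

definition bump_d :: "'a::euclidean_space \<Rightarrow> 'a \<Rightarrow> real" where
  "bump_d i X = - 6 * (X \<bullet> i) * (max 0 (1 - X \<bullet> X)) ^ 2"

definition bump_dd :: "'a::euclidean_space \<Rightarrow> 'a \<Rightarrow> real" where
  "bump_dd i X = - 6 * (max 0 (1 - X \<bullet> X)) ^ 2 + 24 * (X \<bullet> i)\<^sup>2 * max 0 (1 - X \<bullet> X)"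

lemma bump_nonneg: "bump X \<ge> 0"
  by (simp add: bump_def)

lemma bump_le_1: "bump X \<le> 1"
  unfolding bump_def by (intro power_le_one) auto

lemma bump_zero:
  assumes "norm X \<ge> 1"
  shows "bump X = 0" "bump_d i X = 0" "bump_dd i X = 0"
proof -
  have "1 - X \<bullet> X \<le> 0" using assms power_mono[of 1 "norm X" 2] by (simp add: power2_norm_eq_inner)
  then show "bump X = 0" "bump_d i X = 0" "bump_dd i X = 0"
    by (auto simp: bump_def bump_d_def bump_dd_def max_def)
qed

lemma bump_derivatives:
  assumes i: "i \<in> Basis"
  shows "((\<lambda>h. bump (X + h *\<^sub>R i)) has_real_derivative bump_d i X) (at 0)"
    "((\<lambda>h. bump_d i (X + h *\<^sub>R i)) has_real_derivative bump_dd i X) (at 0)"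
proof -
  let ?u = "\<lambda>h. 1 - (X + h *\<^sub>R i) \<bullet> (X + h *\<^sub>R i)"
  have u: "?u = (\<lambda>h. 1 - (X \<bullet> X + 2 * h * (X \<bullet> i) + h * h))"
    using i by (auto simp: fun_eq_iff inner_add_left inner_add_right inner_commute)
  have du: "(?u has_real_derivative - 2 * (X \<bullet> i)) (at 0)"
    unfolding u by (auto intro!: derivative_eq_intros)
  note p = DERIV_chain'[OF du max0_power_has_derivative]
  show "((\<lambda>h. bump (X + h *\<^sub>R i)) has_real_derivative bump_d i X) (at 0)"
    using p[of 1] by (simp add: bump_def bump_d_def eval_nat_numeral mult_ac)
  have q: "((\<lambda>h. - 6 * ((X + h *\<^sub>R i) \<bullet> i)) has_real_derivative - 6) (at 0)"
    using i by (auto simp: inner_add_left intro!: derivative_eq_intros)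
  show "((\<lambda>h. bump_d i (X + h *\<^sub>R i)) has_real_derivative bump_dd i X) (at 0)"
    using DERIV_mult[OF q p[of 0]] by (simp add: bump_d_def bump_dd_def eval_nat_numeral algebra_simps)
qed

lemma bump_continuous [continuous_intros]:
  fixes f :: "'b::topological_space \<Rightarrow> 'a::euclidean_space"
  assumes "continuous_on S f"
  shows "continuous_on S (\<lambda>x. bump (f x))" "continuous_on S (\<lambda>x. bump_d i (f x))"
    "continuous_on S (\<lambda>x. bump_dd i (f x))"
  unfolding bump_def bump_d_def bump_dd_def using assms by (auto intro!: continuous_intros)

text \<open>At the unit sphere the bump vanishes to third order and its Laplacian only to first, so
  no multiple of the bump itself can dominate. Balls of radius 1/2 covering the unit ball repair
  this: at each of its points some translate is at least (3/4)^3 = 27/64.\<close>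

lemma bump_laplacian_bound:
  obtains F :: "'a::euclidean_space set" and C where "finite F" "C > 0"
    "\<And>X. \<bar>\<Sum>i\<in>Basis. bump_dd i X\<bar> \<le> C * (\<Sum>k\<in>F. bump (X - k))"
proof -
  obtain F :: "'a set" where F: "finite F" "cball 0 1 \<subseteq> (\<Union>k\<in>F. ball k (1/2))"
    using compact_eq_totally_bounded[of "cball (0::'a) 1"] compact_cball by (auto dest!: spec[of _ "1/2"])
  obtain B where B: "\<And>X::'a. X \<in> cball 0 1 \<Longrightarrow> \<bar>\<Sum>i\<in>Basis. bump_dd i X\<bar> \<le> B"
  proof -
    have "compact ((\<lambda>X::'a. \<Sum>i\<in>Basis. bump_dd i X) ` cball 0 1)"
      by (intro compact_continuous_image continuous_intros) auto
    then have "bounded ((\<lambda>X::'a. \<Sum>i\<in>Basis. bump_dd i X) ` cball 0 1)" by (rule compact_imp_bounded)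
    then obtain B where "\<forall>X\<in>cball (0::'a) 1. \<bar>\<Sum>i\<in>Basis. bump_dd i X\<bar> \<le> B"
      unfolding bounded_iff by auto
    then show ?thesis by (intro that[of B]) auto
  qed
  show ?thesis
  proof (rule that[OF F(1), of "64/27 * (\<bar>B\<bar> + 1)"])
    fix X :: 'a
    show "\<bar>\<Sum>i\<in>Basis. bump_dd i X\<bar> \<le> 64/27 * (\<bar>B\<bar> + 1) * (\<Sum>k\<in>F. bump (X - k))"
    proof (cases "X \<in> cball 0 1")
      case True
      then obtain k where k: "k \<in> F" "X \<in> ball k (1/2)" using F by blast
      have "norm (X - k) \<le> 1/2" using k by (simp add: dist_norm norm_minus_commute)
      then have "(X - k) \<bullet> (X - k) \<le> (1/2)^2"
        unfolding power2_norm_eq_inner[symmetric] by (intro power_mono) auto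
      then have "(3/4)^3 \<le> bump (X - k)"
        unfolding bump_def by (intro power_mono) (auto simp: power2_eq_square)
      also have "\<dots> \<le> (\<Sum>k\<in>F. bump (X - k))"
        using F(1) k(1) bump_nonneg by (intro member_le_sum) auto
      finally have s: "27/64 \<le> (\<Sum>k\<in>F. bump (X - k))" by (simp add: eval_nat_numeral)
      have "\<bar>\<Sum>i\<in>Basis. bump_dd i X\<bar> \<le> \<bar>B\<bar> + 1" using B[OF True] by linarith
      also have "\<dots> = 64/27 * (\<bar>B\<bar> + 1) * (27/64)" by simp
      also have "\<dots> \<le> 64/27 * (\<bar>B\<bar> + 1) * (\<Sum>k\<in>F. bump (X - k))"
        by (rule mult_left_mono[OF s]) auto
      finally show ?thesis .
    next
      case False
      then have "(\<Sum>i\<in>Basis. bump_dd i X) = 0" using bump_zero(3)[of X] by (simp add: sum.neutral)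
      moreover have "0 \<le> (\<Sum>k\<in>F. bump (X - k))" by (intro sum_nonneg bump_nonneg)
      ultimately show ?thesis by (simp only: abs_zero) (intro mult_nonneg_nonneg; simp)
    qed
  qed simp
qed

text \<open>
  The cut-off \<open>sign_approx\<close> tends to the indicator function of the positive numbers as \<open>p\<close> tends
  to 0. The logarithm makes \<open>y * sign_approx' y\<close> uniformly small, which disposes of the error
  term coming from the time derivative of \<open>w * sign_approx z\<close>.
\<close>

definition sign_approx :: "real \<Rightarrow> real \<Rightarrow> real \<Rightarrow> real" where
  "sign_approx Z p y = (if y > 0 then (max 0 (1 + p * ln (y / Z)))\<^sup>2 else 0)"

definition sign_approx_d :: "real \<Rightarrow> real \<Rightarrow> real \<Rightarrow> real" where
  "sign_approx_d Z p y = (if y > 0 then 2 * max 0 (1 + p * ln (y / Z)) * (p / y) else 0)"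

context
  fixes Z p :: real
  assumes Z: "Z > 0" and p: "p > 0"
begin

text \<open>Below this positive threshold the logarithmic factor is cut off, so the singularity of
  ln at 0 is never met and the function is C^1 on the whole line.\<close>

lemma sign_approx_vanish:
  assumes "y < Z * exp (- 1 / p)"
  shows "sign_approx Z p y = 0" "sign_approx_d Z p y = 0"
proof -
  have "1 + p * ln (y / Z) \<le> 0" if "y > 0"
  proof -
    have "y / Z < exp (- 1 / p)" using assms Z by (simp add: field_simps)
    then have "ln (y / Z) < - 1 / p" using that Z
      using ln_less_cancel_iff[of "y / Z" "exp (- 1 / p)"] by simp
    then show ?thesis using p by (simp add: field_simps)
  qed
  then show "sign_approx Z p y = 0" "sign_approx_d Z p y = 0"
    by (auto simp: sign_approx_def sign_approx_d_def max_def)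
qed

lemma sign_approx_has_derivative:
  "(sign_approx Z p has_real_derivative sign_approx_d Z p y) (at y)"
proof (cases "y > 0")
  case True
  have ev: "\<forall>\<^sub>F x in nhds y. sign_approx Z p x = (max 0 (1 + p * ln (x / Z))) ^ Suc (Suc 0)"
    using eventually_nhds_in_open[of "{0<..}" y] True
    by (auto elim!: eventually_mono simp: sign_approx_def eval_nat_numeral)
  have "((\<lambda>x. 1 + p * ln (x / Z)) has_real_derivative p / y) (at y)"
    using True Z by (auto intro!: derivative_eq_intros simp: field_simps)
  from DERIV_chain'[OF this max0_power_has_derivative[of 0]] show ?thesis
    using True by (subst DERIV_cong_ev[OF refl ev refl]) (auto simp: sign_approx_d_def mult_ac)
next
  case False
  then have vanish_at: "y < Z * exp (- 1 / p)" using Z by (smt (verit) exp_gt_zero mult_pos_pos)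
  then have "\<forall>\<^sub>F x in nhds y. sign_approx Z p x = 0"
    using eventually_nhds_in_open[of "{..<Z * exp (- 1 / p)}" y] vanish_at
    by (auto elim!: eventually_mono simp: sign_approx_vanish)
  from DERIV_cong_ev[OF refl this refl] show ?thesis using False by (simp add: sign_approx_d_def)
qed

lemma sign_approx_cont: "isCont (sign_approx Z p) y"
  using sign_approx_has_derivative DERIV_isCont by blast

lemma sign_approx_d_cont: "isCont (sign_approx_d Z p) y"
proof (cases "y > 0")
  case True
  have ev: "\<forall>\<^sub>F x in nhds y. sign_approx_d Z p x = 2 * max 0 (1 + p * ln (x / Z)) * (p / x)"
    using eventually_nhds_in_open[of "{0<..}" y] True
    by (auto elim!: eventually_mono simp: sign_approx_d_def)
  show ?thesis
    unfolding isCont_cong[OF ev] using True Z by (intro continuous_intros) auto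
next
  case False
  then have vanish_at: "y < Z * exp (- 1 / p)" using Z by (smt (verit) exp_gt_zero mult_pos_pos)
  then have "\<forall>\<^sub>F x in nhds y. sign_approx_d Z p x = 0"
    using eventually_nhds_in_open[of "{..<Z * exp (- 1 / p)}" y] vanish_at
    by (auto elim!: eventually_mono simp: sign_approx_vanish)
  from isCont_cong[OF this] show ?thesis by simp
qed

text \<open>The factor p / y in the derivative cancels y, which gives the bound 2 p however steep
  the function is near 0; the last estimate rests on ln x <= x - 1 with x = Z / y. Both bounds
  vanish with p.\<close>

lemma sign_approx_bounds:
  assumes y: "y \<le> Z"
  shows "0 \<le> sign_approx Z p y" "sign_approx Z p y \<le> 1" "0 \<le> sign_approx_d Z p y"
    "y * sign_approx_d Z p y \<le> 2 * p" "y > 0 \<Longrightarrow> y * (1 - sign_approx Z p y) \<le> 2 * p * Z"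
proof -
  show "0 \<le> sign_approx Z p y" "0 \<le> sign_approx_d Z p y"
    using p by (auto simp: sign_approx_def sign_approx_d_def)
  have l: "max 0 (1 + p * ln (y / Z)) \<le> 1" if "y > 0"
    using that y Z p by (auto simp: mult_le_0_iff ln_div)
  then show "sign_approx Z p y \<le> 1"
    by (auto simp: sign_approx_def intro!: power_le_one)
  show "y * sign_approx_d Z p y \<le> 2 * p"
    using l mult_left_mono[of "max 0 (1 + p * ln (y / Z))" 1 "2 * p"] p
    by (auto simp: sign_approx_d_def algebra_simps)
  assume "y > 0"
  let ?m = "max 0 (1 + p * ln (y / Z))"
  have m: "0 \<le> ?m" "?m \<le> 1" using l \<open>y > 0\<close> by auto
  have "1 - ?m\<^sup>2 = (1 - ?m) * (1 + ?m)" by (simp add: power2_eq_square algebra_simps)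
  also have "\<dots> \<le> (1 - ?m) * 2" using m by (intro mult_left_mono) auto
  also have "\<dots> \<le> - p * ln (y / Z) * 2" by (auto simp: max_def)
  also have "\<dots> = 2 * p * ln (Z / y)" using \<open>y > 0\<close> Z by (simp add: ln_div algebra_simps)
  also have "\<dots> \<le> 2 * p * (Z / y)" using p \<open>y > 0\<close> Z ln_le_minus_one[of "Z / y"] by (intro mult_left_mono) auto
  finally have "y * (1 - ?m\<^sup>2) \<le> y * (2 * p * (Z / y))" using \<open>y > 0\<close> by (intro mult_left_mono) auto
  then show "y * (1 - sign_approx Z p y) \<le> 2 * p * Z"
    using \<open>y > 0\<close> by (simp add: sign_approx_def)
qed

text \<open>J is a smooth substitute for the positive part, to be used in Kato's inequality;
  subtracting \<open>J0 0\<close> makes it vanish on the negative axis.\<close>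

lemma sign_approx_antiderivative:
  obtains J where "\<And>y. (J has_real_derivative sign_approx Z p y) (at y)" "\<And>y. y \<le> 0 \<Longrightarrow> J y = 0"
    "\<And>y. y \<le> Z \<Longrightarrow> 0 \<le> J y" "\<And>y. 0 < y \<Longrightarrow> y \<le> Z \<Longrightarrow> J y \<le> y"
proof -
  obtain J0 where "\<And>y. (J0 has_vector_derivative sign_approx Z p y) (at y)"
    using einterval_antiderivative[of "-\<infinity>" "\<infinity>" "sign_approx Z p"] sign_approx_cont by auto
  then have J0: "\<And>y. (J0 has_real_derivative sign_approx Z p y) (at y)"
    by (simp add: has_real_derivative_iff_has_vector_derivative)
  define J where "J y = J0 y - J0 0" for y
  have J: "(J has_real_derivative sign_approx Z p y) (at y)" for y
    unfolding J_def[abs_def] using J0[of y] by (auto intro!: derivative_eq_intros)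
  have neg: "J y = 0" if "y \<le> 0" for y
  proof (cases "y = 0")
    case False
    then have "y < 0" using that by simp
    then obtain c where "y < c" "c < 0" "J 0 - J y = (0 - y) * sign_approx Z p c"
      using MVT2[of y 0 J "sign_approx Z p"] J that by force
    then show ?thesis by (simp add: sign_approx_def J_def)
  qed (simp add: J_def)
  have pos: "0 \<le> J y \<and> J y \<le> y" if "0 < y" "y \<le> Z" for y
  proof -
    obtain c where c: "0 < c" "c < y" "J y - J 0 = (y - 0) * sign_approx Z p c"
      using MVT2[of 0 y J "sign_approx Z p"] J \<open>0 < y\<close> by blast
    then show ?thesis using sign_approx_bounds[of c] that neg[of 0] by (auto simp: mult_left_le)
  qed
  show ?thesis
  proof (rule that[of J])
    show "0 \<le> J y" if "y \<le> Z" for y using pos[of y] neg[of y] that by (cases "y > 0") auto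
  qed (use J neg pos in auto)
qed

end

subsection \<open>Local comparison by an L1 argument of Kato type\<close>

lemma bump_laplacian_zero:
  fixes X :: "'a::euclidean_space"
  assumes "X \<notin> cball a 1"
  shows "(\<Sum>i\<in>Basis. bump_dd i (X - a)) = 0"
  using assms bump_zero(3)[of "X - a"] by (intro sum.neutral) (auto simp: dist_norm norm_minus_commute)

lemma bump_integral:
  fixes f :: "'a::euclidean_space \<Rightarrow> real"
  assumes c: "continuous_on UNIV f"
  shows "(\<lambda>X. bump (X - a) * f X) integrable_on UNIV"
    "cball a 1 \<subseteq> cbox b c \<Longrightarrow> integral UNIV (\<lambda>X. bump (X - a) * f X) = integral (cbox b c) (\<lambda>X. bump (X - a) * f X)"
    "integral UNIV (\<lambda>X. bump (X - a) * f X) = integral\<^sup>L lborel (\<lambda>X. bump (X - a) * f X)"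
proof -
  have c': "continuous_on UNIV (\<lambda>X. bump (X - a) * f X)" using c by (auto intro!: continuous_intros)
  have s: "bump (X - a) * f X = 0" if "X \<notin> cball a 1" for X
    using that bump_zero(1)[of "X - a"] by (auto simp: dist_norm norm_minus_commute)
  show "cball a 1 \<subseteq> cbox b c \<Longrightarrow> integral UNIV (\<lambda>X. bump (X - a) * f X) = integral (cbox b c) (\<lambda>X. bump (X - a) * f X)"
    by (rule compact_support_integral(2)[OF c' s])
  obtain b where b: "cball a 1 \<subseteq> cbox (-b) b" using bounded_subset_cbox_symmetric[OF bounded_cball] by blast
  show "(\<lambda>X. bump (X - a) * f X) integrable_on UNIV" 
    "integral UNIV (\<lambda>X. bump (X - a) * f X) = integral\<^sup>L lborel (\<lambda>X. bump (X - a) * f X)"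
    using compact_support_integral(1,4)[OF c' s b] by auto
qed

lemma bump_integral_bound:
  fixes f :: "'a::euclidean_space \<Rightarrow> real"
  assumes c: "continuous_on UNIV f" and f: "\<And>X. X \<in> cball a 1 \<Longrightarrow> f X \<le> B" and "B \<ge> 0"
  shows "integral UNIV (\<lambda>X. bump (X - a) * f X) \<le> B * integral UNIV (bump :: 'a \<Rightarrow> real)"
proof -
  have "integral UNIV (\<lambda>X. bump (X - a) * f X) \<le> integral UNIV (\<lambda>X. bump (X - a) * B)"
  proof (rule integral_le)
    fix X :: 'a
    show "bump (X - a) * f X \<le> bump (X - a) * B"
      using f[of X] bump_nonneg[of "X - a"] bump_zero(1)[of "X - a"]
      by (cases "X \<in> cball a 1") (auto intro!: mult_left_mono simp: dist_norm norm_minus_commute)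
  qed (use bump_integral(1)[OF c] bump_integral(1)[of "\<lambda>_. B"] in auto)
  also have "\<dots> = B * integral UNIV (\<lambda>X::'a. bump (X - a))" by (simp add: mult.commute)
  also have "integral UNIV (\<lambda>X::'a. bump (X - a)) = integral UNIV (bump :: 'a \<Rightarrow> real)"
  proof -
    have "integral UNIV (\<lambda>X::'a. bump (X - a)) = integral\<^sup>L lborel (\<lambda>X::'a. bump (X - a))"
      using bump_integral(3)[of "\<lambda>_. 1" a] by simp
    also have "\<dots> = integral\<^sup>L (distr lborel borel ((+) (- a))) (bump :: 'a \<Rightarrow> real)"
      using borel_measurable_continuous_onI[OF bump_continuous(1)[OF continuous_on_id]]
      by (subst integral_distr) (auto simp: add.commute)
    also have "\<dots> = integral UNIV (bump :: 'a \<Rightarrow> real)"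
      using bump_integral(3)[of "\<lambda>_::'a. 1" 0] by (simp add: lborel_distr_plus)
    finally show ?thesis .
  qed
  finally show ?thesis .
qed

text \<open>The setting for two solutions: w is the difference of the densities and z that of their
  images under \<phi>. Condition \<open>cmp\<close> makes the two comparable where z is positive,
  and \<open>boundary\<close> makes z nonpositive near every point off D, which takes the place of
  regularity of the boundary.\<close>

locale local_comparison =
  fixes D :: "'a::euclidean_space set" and z zt w wt :: "'a \<Rightarrow> real \<Rightarrow> real"
    and zx zxx :: "'a \<Rightarrow> 'a \<Rightarrow> real \<Rightarrow> real" and C Z :: real
  assumes D: "open D"
    and z: "c21 D z zt zx zxx"
    and w_cont: "continuous_on (D \<times> {0<..}) (\<lambda>(X, t). w X t)"
    and wt_cont: "continuous_on (D \<times> {0<..}) (\<lambda>(X, t). wt X t)"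
    and w_deriv: "\<And>X t. X \<in> D \<Longrightarrow> t > 0 \<Longrightarrow> (w X has_real_derivative wt X t) (at t)"
    and sub: "\<And>X t. X \<in> D \<Longrightarrow> t > 0 \<Longrightarrow> z X t > 0 \<Longrightarrow> wt X t \<le> (\<Sum>i\<in>Basis. zxx i X t)"
    and C: "C > 0" and Z: "Z > 0"
    and cmp: "\<And>X t. X \<in> D \<Longrightarrow> t > 0 \<Longrightarrow> z X t > 0 \<Longrightarrow> z X t \<le> C * w X t \<and> w X t \<le> C * z X t"
    and neg: "\<And>X t. X \<in> D \<Longrightarrow> t > 0 \<Longrightarrow> z X t \<le> 0 \<Longrightarrow> w X t \<le> 0"
    and bd: "\<And>X t. X \<in> D \<Longrightarrow> t > 0 \<Longrightarrow> z X t \<le> Z"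
    and boundary: "\<And>X t. X \<notin> D \<Longrightarrow> t > 0 \<Longrightarrow> \<exists>e>0. \<forall>Y\<in>ball X e \<inter> D. \<forall>s\<in>ball t e. s > 0 \<longrightarrow> z Y s \<le> 0"
begin

lemma z_parts:
  shows z_cont: "continuous_on (D \<times> {0<..}) (\<lambda>(X, t). z X t)"
    and zt_cont: "continuous_on (D \<times> {0<..}) (\<lambda>(X, t). zt X t)"
    and z_deriv: "X \<in> D \<Longrightarrow> t > 0 \<Longrightarrow> (z X has_real_derivative zt X t) (at t)"
    and zx_cont: "i \<in> Basis \<Longrightarrow> continuous_on (D \<times> {0<..}) (\<lambda>(X, t). zx i X t)"
    and zxx_cont: "i \<in> Basis \<Longrightarrow> continuous_on (D \<times> {0<..}) (\<lambda>(X, t). zxx i X t)"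
    and zx_deriv: "i \<in> Basis \<Longrightarrow> X \<in> D \<Longrightarrow> t > 0 \<Longrightarrow>
        ((\<lambda>h. z (X + h *\<^sub>R i) t) has_real_derivative zx i X t) (at 0)"
    and zxx_deriv: "i \<in> Basis \<Longrightarrow> X \<in> D \<Longrightarrow> t > 0 \<Longrightarrow>
        ((\<lambda>h. zx i (X + h *\<^sub>R i) t) has_real_derivative zxx i X t) (at 0)"
  using z unfolding c21_def by auto

lemma extension_continuous:
  fixes f :: "'a \<Rightarrow> real \<Rightarrow> real"
  assumes c: "continuous_on (D \<times> {0<..}) (\<lambda>(X, t). f X t)"
    and f: "\<And>X t. X \<in> D \<Longrightarrow> t > 0 \<Longrightarrow> z X t \<le> 0 \<Longrightarrow> f X t = 0"
  shows "continuous_on (UNIV \<times> {0<..}) (\<lambda>(X, t). if X \<in> D then f X t else 0)"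
proof -
  let ?F = "\<lambda>(X, t). f X t"
  have "continuous_on (UNIV \<times> {0<..}) (\<lambda>p. if p \<in> D \<times> {0<..} then ?F p else 0)"
  proof (rule continuous_on_extend_zero[where F = ?F])
    show "open (D \<times> {0::real<..})" by (intro open_Times D open_greaterThan)
    have "(D \<times> {0<..}) \<inter> (UNIV \<times> {0<..}) = D \<times> {0::real<..}" by auto
    then show "continuous_on ((D \<times> {0<..}) \<inter> (UNIV \<times> {0<..})) ?F" using c by simp
    fix p assume "p \<in> UNIV \<times> {0<..} - D \<times> {0::real<..}"
    then obtain X t where p: "p = (X, t)" "X \<notin> D" "t > 0" by auto
    then obtain e where e: "e > 0" "\<forall>Y\<in>ball X e \<inter> D. \<forall>s\<in>ball t e. s > 0 \<longrightarrow> z Y s \<le> 0"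
      using boundary by blast
    have "?F q = 0" if q: "q \<in> ball p e \<inter> (D \<times> {0<..}) \<inter> (UNIV \<times> {0<..})" for q
    proof -
      obtain Y s where q': "q = (Y, s)" by force
      have "dist X Y < e" "dist t s < e"
        using q dist_fst_le[of p q] dist_snd_le[of p q] unfolding p q' by auto
      then show ?thesis using e q f unfolding q' by auto
    qed
    then show "\<exists>e>0. \<forall>q\<in>ball p e \<inter> D \<times> {0<..} \<inter> UNIV \<times> {0<..}. ?F q = 0" using e by blast
  qed
  then show ?thesis by (rule continuous_on_eq) (auto split: if_splits)
qed

lemma extension_continuous_slice:
  fixes f :: "'a \<Rightarrow> real \<Rightarrow> real"
  assumes "continuous_on (D \<times> {0<..}) (\<lambda>(X, t). f X t)"
    and "\<And>X t. X \<in> D \<Longrightarrow> t > 0 \<Longrightarrow> z X t \<le> 0 \<Longrightarrow> f X t = 0" and "t > 0"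
  shows "continuous_on UNIV (\<lambda>X. if X \<in> D then f X t else 0)"
proof -
  have "continuous_on UNIV (\<lambda>X. (\<lambda>(X, t). if X \<in> D then f X t else 0) (X, t))"
    by (rule continuous_on_compose2[OF extension_continuous[OF assms(1,2)]])
      (use \<open>t > 0\<close> in \<open>auto intro!: continuous_intros\<close>)
  then show ?thesis by simp
qed

text \<open>The positive part of w, set to 0 off D. Its pairing with translated bumps in
  \<open>local_mass\<close> becomes a uniformly local L1 norm once the supremum over the centre is
  taken.\<close>

definition wp :: "'a \<Rightarrow> real \<Rightarrow> real" where
  "wp X t = (if X \<in> D then max 0 (w X t) else 0)"

definition local_mass :: "'a \<Rightarrow> real \<Rightarrow> real" where
  "local_mass a t = integral UNIV (\<lambda>X. bump (X - a) * wp X t)"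

lemma wp_cont: "continuous_on (UNIV \<times> {0<..}) (\<lambda>(X, t). wp X t)"
  unfolding wp_def
proof (rule extension_continuous)
  show "continuous_on (D \<times> {0<..}) (\<lambda>(X, t). max 0 (w X t))"
    using w_cont unfolding split_beta by (intro continuous_on_max continuous_on_const)
  show "max 0 (w X t) = 0" if "X \<in> D" "t > 0" "z X t \<le> 0" for X t
    using neg[OF that] by simp
qed

lemma wp_cont_slice: "t > 0 \<Longrightarrow> continuous_on UNIV (\<lambda>X. wp X t)"
  using continuous_on_compose2[OF wp_cont, of UNIV "\<lambda>X. (X, t)"]
  by (simp add: image_subset_iff continuous_on_Pair)

lemma wp_bounds: "0 \<le> wp X t" "t > 0 \<Longrightarrow> wp X t \<le> C * Z"
proof -
  show "0 \<le> wp X t" by (simp add: wp_def)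
  assume t: "t > 0"
  show "wp X t \<le> C * Z"
  proof (cases "X \<in> D \<and> z X t > 0")
    case True
    then have "w X t \<le> C * z X t" "C * z X t \<le> C * Z" using cmp bd t C by auto
    then have "w X t \<le> C * Z" by linarith
    then show ?thesis using C Z by (auto simp: wp_def)
  next
    case False
    then show ?thesis using neg[of X t] t C Z by (auto simp: wp_def max_def)
  qed
qed

lemma kato:
  assumes t: "t > 0" and p: "p > 0"
    and J: "\<And>y. (J has_real_derivative sign_approx Z p y) (at y)" "\<And>y. y \<le> 0 \<Longrightarrow> J y = 0"
  shows "integral UNIV (\<lambda>X. bump (X - a) * (if X \<in> D then sign_approx Z p (z X t) * (\<Sum>i\<in>Basis. zxx i X t) else 0))
    \<le> integral UNIV (\<lambda>X. (if X \<in> D then J (z X t) else 0) * (\<Sum>i\<in>Basis. bump_dd i (X - a)))"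
proof -
  let ?H = "sign_approx Z p" and ?dH = "sign_approx_d Z p"
  have H0: "y \<le> 0 \<Longrightarrow> ?H y = 0" "y \<le> 0 \<Longrightarrow> ?dH y = 0" for y
    by (auto simp: sign_approx_def sign_approx_d_def)
  have [continuous_intros]: "continuous_on S (\<lambda>x. ?H (f x))" "continuous_on S (\<lambda>x. ?dH (f x))" "continuous_on S (\<lambda>x. J (f x))"
    if "continuous_on S f" for S :: "('a \<times> real) set" and f
    using sign_approx_cont[OF Z p] sign_approx_d_cont[OF Z p] DERIV_isCont[OF J(1)] that
    by (auto intro!: continuous_on_compose2[OF continuous_at_imp_continuous_on[of UNIV] that])
  note zc = z_cont zx_cont zxx_cont
  \<comment> \<open>The i-th component of a flux whose divergence has no mixed first-order terms:
    the two products of \<open>bump_d\<close> with \<open>zx\<close> cancel because J' is the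
    smoothed sign. It vanishes where z <= 0, hence near the complement of D.\<close>
  define Gf where "Gf i X t = bump (X - a) * ?H (z X t) * zx i X t - J (z X t) * bump_d i (X - a)" for i X t
  define gf where "gf i X t = bump (X - a) * ?dH (z X t) * (zx i X t)\<^sup>2 + bump (X - a) * ?H (z X t) * zxx i X t
      - J (z X t) * bump_dd i (X - a)" for i X t
  have zero: "integral UNIV (\<lambda>X. if X \<in> D then gf i X t else 0) = 0" if i: "i \<in> Basis" for i
  proof (rule integral_partial_derivative_compact_support[where a=a and r=1 and i=i])
    show "continuous_on UNIV (\<lambda>X. if X \<in> D then Gf i X t else 0)"
      by (rule extension_continuous_slice[OF _ _ t]; simp add: Gf_def split_beta H0 J(2))
        (use zc i in \<open>auto simp: split_beta intro!: continuous_intros\<close>)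
    show "continuous_on UNIV (\<lambda>X. if X \<in> D then gf i X t else 0)"
      by (rule extension_continuous_slice[OF _ _ t]; simp add: gf_def split_beta H0 J(2))
        (use zc i in \<open>auto simp: split_beta intro!: continuous_intros\<close>)
    fix X
    show "((\<lambda>h. if X + h *\<^sub>R i \<in> D then Gf i (X + h *\<^sub>R i) t else 0) has_real_derivative
        (if X \<in> D then gf i X t else 0)) (at 0)"
    proof (rule has_derivative_line_extend_zero[OF D, where F="\<lambda>X. Gf i X t"])
      fix X assume "X \<notin> D"
      then obtain e where e: "e > 0" "\<forall>Y\<in>ball X e \<inter> D. \<forall>s\<in>ball t e. s > 0 \<longrightarrow> z Y s \<le> 0"
        using boundary t by blast
      then have "\<forall>Y\<in>ball X e \<inter> D. z Y t \<le> 0" using t by auto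
      then show "\<exists>e>0. \<forall>Y\<in>ball X e \<inter> D. Gf i Y t = 0"
        using e(1) by (intro exI[of _ e]) (auto simp: Gf_def H0 J(2))
    next
      assume X: "X \<in> D"
      have b: "((\<lambda>h. bump (X + h *\<^sub>R i - a)) has_real_derivative bump_d i (X - a)) (at 0)"
        "((\<lambda>h. bump_d i (X + h *\<^sub>R i - a)) has_real_derivative bump_dd i (X - a)) (at 0)"
        using bump_derivatives[OF i, of "X - a"] by (simp_all add: algebra_simps)
      note zd = zx_deriv[OF i X t] zxx_deriv[OF i X t]
      have h: "((\<lambda>h. ?H (z (X + h *\<^sub>R i) t)) has_real_derivative ?dH (z X t) * zx i X t) (at 0)"
        using DERIV_chain'[OF zd(1) sign_approx_has_derivative[OF Z p]] by (simp add: mult.commute)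
      have j: "((\<lambda>h. J (z (X + h *\<^sub>R i) t)) has_real_derivative ?H (z X t) * zx i X t) (at 0)"
        using DERIV_chain'[OF zd(1) J(1)] by (simp add: mult.commute)
      show "((\<lambda>h. Gf i (X + h *\<^sub>R i) t) has_real_derivative gf i X t) (at 0)"
        using DERIV_diff[OF DERIV_mult[OF DERIV_mult[OF b(1) h] zd(2)] DERIV_mult[OF j b(2)]]
        unfolding Gf_def gf_def by (simp add: algebra_simps power2_eq_square)
    qed
    fix X assume "X \<notin> cball a 1"
    then show "(if X \<in> D then Gf i X t else 0) = 0"
      using bump_zero[of "X - a"] by (auto simp: Gf_def dist_norm norm_minus_commute)
  qed
  obtain b where b: "cball a 1 \<subseteq> cbox (-b) b" using bounded_subset_cbox_symmetric[OF bounded_cball] by blast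
  have gint: "(\<lambda>X. if X \<in> D then gf i X t else 0) integrable_on UNIV" if i: "i \<in> Basis" for i
  proof (rule compact_support_integral(1)[OF _ _ b])
    show "continuous_on UNIV (\<lambda>X. if X \<in> D then gf i X t else 0)"
      by (rule extension_continuous_slice[OF _ _ t]; simp add: gf_def split_beta H0 J(2))
        (use zc i in \<open>auto simp: split_beta intro!: continuous_intros\<close>)
    fix X assume "X \<notin> cball a 1"
    then show "(if X \<in> D then gf i X t else 0) = 0"
      using bump_zero[of "X - a"] by (auto simp: gf_def dist_norm norm_minus_commute)
  qed
  have c1: "continuous_on UNIV (\<lambda>X. if X \<in> D then ?H (z X t) * (\<Sum>i\<in>Basis. zxx i X t) else 0)"
    by (rule extension_continuous_slice[OF _ _ t]; simp add: split_beta H0)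
      (use zc in \<open>auto simp: split_beta intro!: continuous_intros\<close>)
  have c2: "continuous_on UNIV (\<lambda>X. if X \<in> D then J (z X t) else 0)"
    by (rule extension_continuous_slice[OF _ _ t]; simp add: split_beta J(2))
      (use zc in \<open>auto simp: split_beta intro!: continuous_intros\<close>)
  have i2: "(\<lambda>X. (if X \<in> D then J (z X t) else 0) * (\<Sum>i\<in>Basis. bump_dd i (X - a))) integrable_on UNIV"
    by (rule compact_support_integral(1)[OF _ _ b])
      (use c2 bump_laplacian_zero in \<open>auto intro!: continuous_intros simp del: mem_cball\<close>)
  let ?A = "\<lambda>X. bump (X - a) * (if X \<in> D then ?H (z X t) * (\<Sum>i\<in>Basis. zxx i X t) else 0)"
  let ?B = "\<lambda>X. (if X \<in> D then J (z X t) else 0) * (\<Sum>i\<in>Basis. bump_dd i (X - a))"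
  have "integral UNIV ?A - integral UNIV ?B = integral UNIV (\<lambda>X. ?A X - ?B X)"
    using integral_diff[OF bump_integral(1)[OF c1] i2] by simp
  also have "\<dots> \<le> integral UNIV (\<lambda>X. \<Sum>i\<in>Basis. if X \<in> D then gf i X t else 0)"
  proof (rule integral_le)
    show "(\<lambda>X. ?A X - ?B X) integrable_on UNIV" by (intro integrable_diff bump_integral(1)[OF c1] i2)
    show "(\<lambda>X. \<Sum>i\<in>Basis. if X \<in> D then gf i X t else 0) integrable_on UNIV"
      by (intro integrable_sum gint) auto
    fix X
    show "?A X - ?B X \<le> (\<Sum>i\<in>Basis. if X \<in> D then gf i X t else 0)"
    proof (cases "X \<in> D")
      case True
      have "?A X - ?B X = (\<Sum>i\<in>Basis. bump (X - a) * ?H (z X t) * zxx i X t - J (z X t) * bump_dd i (X - a))"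
        using True by (simp add: sum_subtractf sum_distrib_left mult_ac)
      also have "\<dots> \<le> (\<Sum>i\<in>Basis. gf i X t)"
        using bump_nonneg[of "X - a"] sign_approx_bounds(3)[OF Z p bd[OF True t]]
        by (intro sum_mono) (auto simp: gf_def)
      finally show ?thesis using True by simp
    qed simp
  qed
  also have "\<dots> = (\<Sum>i\<in>Basis. integral UNIV (\<lambda>X. if X \<in> D then gf i X t else 0))"
    by (rule integral_sum) (auto intro: gint)
  also have "\<dots> = 0" using zero by simp
  finally show ?thesis by simp
qed

text \<open>By \<open>boundary\<close> the set where z > 0 keeps away from the complement of D, so
  its closure over a compact time strip is compact inside the domain where \<open>zt\<close> is
  continuous. This bounds the time derivative without any assumption on it up to the boundary of
  D.\<close>

lemma zt_bounded_on_positive_set: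
  assumes "0 < s"
  obtains B where "B \<ge> 0" "\<And>X r. X \<in> cball a 1 \<inter> D \<Longrightarrow> s \<le> r \<Longrightarrow> r \<le> t \<Longrightarrow> z X r > 0 \<Longrightarrow> \<bar>zt X r\<bar> \<le> B"
proof -
  define Q where "Q = {(X, r). X \<in> cball a 1 \<inter> D \<and> s \<le> r \<and> r \<le> t \<and> z X r > 0}"
  have Qs: "Q \<subseteq> cball a 1 \<times> {s..t}" by (auto simp: Q_def)
  have cl: "closure Q \<subseteq> cball a 1 \<times> {s..t}"
    by (rule closure_minimal[OF Qs]) (auto intro: closed_Times)
  have "closure Q \<subseteq> D \<times> {0<..}"
  proof
    fix q assume q: "q \<in> closure Q"
    obtain X r where Xr: "q = (X, r)" by force
    have r: "r > 0" using q cl assms unfolding Xr by auto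
    have "X \<in> D"
    proof (rule ccontr)
      assume "X \<notin> D"
      then obtain e where e: "e > 0" "\<forall>Y\<in>ball X e \<inter> D. \<forall>s\<in>ball r e. s > 0 \<longrightarrow> z Y s \<le> 0"
        using boundary r by blast
      obtain q' where q': "q' \<in> Q" "dist q' q < e" using q e(1) closure_approachable by blast
      obtain Y u where Yu: "q' = (Y, u)" by force
      have "dist X Y < e" "dist r u < e"
        using q' dist_fst_le[of q q'] dist_snd_le[of q q'] unfolding Xr Yu by (auto simp: dist_commute)
      moreover have "u > 0" "Y \<in> D" "z Y u > 0" using q' assms unfolding Yu Q_def by auto
      ultimately have "z Y u \<le> 0" using e(2) by auto
      then show False using \<open>z Y u > 0\<close> by simp
    qed
    then show "q \<in> D \<times> {0<..}" using r Xr by auto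
  qed
  then have "continuous_on (closure Q) (\<lambda>(X, t). zt X t)" using zt_cont continuous_on_subset by blast
  moreover have "compact (closure Q)"
    using bounded_subset[OF bounded_Times[OF bounded_cball bounded_closed_interval] Qs] by simp
  ultimately have "bounded ((\<lambda>(X, t). zt X t) ` closure Q)"
    using compact_continuous_image compact_imp_bounded by blast
  then obtain B where B: "\<forall>v\<in>(\<lambda>(X, t). zt X t) ` closure Q. norm v \<le> B" by (auto simp: bounded_iff)
  show ?thesis
  proof (rule that[of "max 0 B"])
    fix X r assume *: "X \<in> cball a 1 \<inter> D" "s \<le> r" "r \<le> t" "z X r > 0"
    then have "(X, r) \<in> closure Q" using closure_subset by (fastforce simp: Q_def)
    then show "\<bar>zt X r\<bar> \<le> max 0 B" using B by fastforce
  qed simp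
qed

text \<open>
  Testing with translates of one bump measures \<open>w\<close> in a uniformly local \<open>L\<^sup>1\<close> norm. The Laplacian of
  the bump is dominated by finitely many translates, so a Gronwall argument for the supremum over
  all translates closes without any decay at infinity.
\<close>

lemma local_mass_decay:
  obtains K where "K > 0"
    "\<And>B l a s t. (\<And>b r. r > 0 \<Longrightarrow> local_mass b r \<le> B * exp (l * r)) \<Longrightarrow> B \<ge> 0 \<Longrightarrow> l > 0 \<Longrightarrow> 0 < s \<Longrightarrow> s \<le> t \<Longrightarrow>
       local_mass a t \<le> local_mass a s + K * B / l * exp (l * t)"
proof -
  obtain F :: "'a set" and L where F: "finite F" "L > 0"
    "\<And>X. \<bar>\<Sum>i\<in>Basis. bump_dd i X\<bar> \<le> L * (\<Sum>k\<in>F. bump (X - k))"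
    using bump_laplacian_bound by metis
  \<comment> \<open>L comes from the bump estimate, C from J <= C w on the positive set, and
    \<open>card F\<close> counts the translates produced by the Laplacian; the added 1 makes K
    positive even if F is empty.\<close>
  define K where "K = L * C * real (card F) + 1"
  have K: "K > 0" using F C by (simp add: K_def add_nonneg_pos)
  show ?thesis
  proof (rule that[OF K])
    fix B l s t :: real and a :: 'a
    assume B: "\<And>b r. r > 0 \<Longrightarrow> local_mass b r \<le> B * exp (l * r)" "B \<ge> 0" and l: "l > 0" and s: "0 < s" "s \<le> t"
    obtain M where M: "M \<ge> 0"
      "\<And>X r. X \<in> cball a 1 \<inter> D \<Longrightarrow> s/2 \<le> r \<Longrightarrow> r \<le> t + 1 \<Longrightarrow> z X r > 0 \<Longrightarrow> \<bar>zt X r\<bar> \<le> M"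
      using zt_bounded_on_positive_set[of "s/2" a "t + 1"] s by auto
    define V where "V = integral UNIV (bump :: 'a \<Rightarrow> real)"
    have V: "V \<ge> 0" unfolding V_def by (rule integral_nonneg) (use bump_integral(1)[of "\<lambda>_. 1" "0::'a"] bump_nonneg in auto)
    \<comment> \<open>The two error terms come from w times the time derivative of the cut-off,
      integrated over [s, t], and from replacing the positive part of w by
      \<open>w * sign_approx z\<close> at time t. Both are linear in p, which is sent to 0
      afterwards.\<close>
    have main: "local_mass a t - local_mass a s \<le> K * B / l * exp (l * t) + p * (2 * C * M * V * (t - s) + 2 * C * Z * V)" if p: "p > 0" for p
    proof -
      let ?H = "sign_approx Z p" and ?dH = "sign_approx_d Z p"
      have H0: "y \<le> 0 \<Longrightarrow> ?H y = 0" "y \<le> 0 \<Longrightarrow> ?dH y = 0" for y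
        by (auto simp: sign_approx_def sign_approx_d_def)
      obtain J where J: "\<And>y. (J has_real_derivative ?H y) (at y)" "\<And>y. y \<le> 0 \<Longrightarrow> J y = 0"
        "\<And>y. y \<le> Z \<Longrightarrow> 0 \<le> J y" "\<And>y. 0 < y \<Longrightarrow> y \<le> Z \<Longrightarrow> J y \<le> y"
        using sign_approx_antiderivative[OF Z p] by blast
      have [continuous_intros]: "continuous_on S (\<lambda>x. ?H (f x))" "continuous_on S (\<lambda>x. ?dH (f x))" "continuous_on S (\<lambda>x. J (f x))"
        if "continuous_on S f" for S :: "('a \<times> real) set" and f
        using sign_approx_cont[OF Z p] sign_approx_d_cont[OF Z p] DERIV_isCont[OF J(1)] that
        by (auto intro!: continuous_on_compose2[OF continuous_at_imp_continuous_on[of UNIV] that])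
      define g where "g X r = (if X \<in> D then w X r * ?H (z X r) else 0)" for X r
      define g' where "g' X r = (if X \<in> D then wt X r * ?H (z X r) + w X r * (?dH (z X r) * zt X r) else 0)" for X r
      have gc: "continuous_on (UNIV \<times> {0<..}) (\<lambda>(X, r). g X r)"
        unfolding g_def by (rule extension_continuous; simp add: split_beta H0)
          (use w_cont z_cont in \<open>auto simp: split_beta intro!: continuous_intros\<close>)
      have gc': "continuous_on (UNIV \<times> {0<..}) (\<lambda>(X, r). g' X r)"
        unfolding g'_def by (rule extension_continuous; simp add: split_beta H0)
          (use w_cont wt_cont z_cont zt_cont in \<open>auto simp: split_beta intro!: continuous_intros\<close>)
      have slice: "continuous_on UNIV (\<lambda>X. g X r)" "continuous_on UNIV (\<lambda>X. g' X r)" if "r > 0" for r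
        using continuous_on_compose2[OF gc, of UNIV "\<lambda>X. (X, r)"] continuous_on_compose2[OF gc', of UNIV "\<lambda>X. (X, r)"] that
        by (simp_all add: image_subset_iff continuous_on_Pair)
      define y where "y r = integral UNIV (\<lambda>X. bump (X - a) * g X r)" for r
      obtain c where c: "cball a 1 \<subseteq> cbox (-c) c" using bounded_subset_cbox_symmetric[OF bounded_cball] by blast
      have ycb: "y r = integral (cbox (-c) c) (\<lambda>X. bump (X - a) * g X r)" if "r > 0" for r
        unfolding y_def using bump_integral(2)[OF slice(1)[OF that] c] .
      define y' where "y' r = integral UNIV (\<lambda>X. bump (X - a) * g' X r)" for r
      have dg: "((\<lambda>r. g X r) has_real_derivative g' X r) (at r)" if r: "r > 0" for X r
      proof (cases "X \<in> D")
        case True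
        have "((\<lambda>r. ?H (z X r)) has_real_derivative ?dH (z X r) * zt X r) (at r)"
          using DERIV_chain'[OF z_deriv[OF True r] sign_approx_has_derivative[OF Z p]] by (simp add: mult.commute)
        from DERIV_mult[OF w_deriv[OF True r] this] show ?thesis
          using True by (simp add: g_def g'_def algebra_simps)
      qed (simp add: g_def g'_def)
      have dy: "(y has_real_derivative y' r) (at r)" if r: "r > 0" for r
      proof -
        have "((\<lambda>r. integral (cbox (-c) c) (\<lambda>X. bump (X - a) * g X r)) has_field_derivative
            integral (cbox (-c) c) (\<lambda>X. bump (X - a) * g' X r)) (at r within {0<..})"
        proof (rule leibniz_rule_field_derivative)
          show "((\<lambda>x. bump (t - a) * g t x) has_real_derivative bump (t - a) * g' t x) (at x within {0<..})"
            if "x \<in> {0<..}" for x t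
            by (rule has_field_derivative_at_within, rule DERIV_cmult, rule dg) (use that in simp)
          show "(\<lambda>X. bump (X - a) * g X x) integrable_on cbox (-c) c" if "x \<in> {0<..}" for x
            using slice(1)[of x] that by (intro integrable_continuous continuous_intros) (auto intro: continuous_on_subset)
          have "continuous_on ({0<..} \<times> cbox (-c) c) (\<lambda>q. (\<lambda>(X, r). g' X r) (snd q, fst q))"
            by (rule continuous_on_compose2[OF gc']) (auto intro!: continuous_intros)
          then show "continuous_on ({0<..} \<times> cbox (-c) c) (\<lambda>(x, t). bump (t - a) * g' t x)"
            unfolding split_beta by (intro continuous_intros) (simp add: split_beta)
        qed (use r in auto)
        moreover have "y' r = integral (cbox (-c) c) (\<lambda>X. bump (X - a) * g' X r)"
          unfolding y'_def using bump_integral(2)[OF slice(2)[OF r] c] .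
        ultimately have "((\<lambda>r. integral (cbox (-c) c) (\<lambda>X. bump (X - a) * g X r)) has_field_derivative y' r) (at r)"
          using at_within_open[of r "{0<..}"] r by simp
        moreover have ev: "\<forall>\<^sub>F x in nhds r. y x = integral (cbox (-c) c) (\<lambda>X. bump (X - a) * g X x)"
          using eventually_nhds_in_open[of "{0<..}" r] r ycb by (auto elim!: eventually_mono)
        ultimately show ?thesis by (subst DERIV_cong_ev[OF refl ev refl])
      qed
      have y'_bound: "y' r \<le> K * B * exp (l * r) + p * (2 * C * M * V)" if r: "s \<le> r" "r \<le> t" for r
      proof -
        have r0: "r > 0" using r s by simp
        define e where "e X = (if X \<in> D then w X r * (?dH (z X r) * zt X r) else 0)" for X
        define k where "k X = (if X \<in> D then ?H (z X r) * (\<Sum>i\<in>Basis. zxx i X r) else 0)" for X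
        have ec: "continuous_on UNIV e"
          unfolding e_def by (rule extension_continuous_slice[OF _ _ r0]; simp add: split_beta H0)
            (use w_cont z_cont zt_cont in \<open>auto simp: split_beta intro!: continuous_intros\<close>)
        have kc: "continuous_on UNIV k"
          unfolding k_def by (rule extension_continuous_slice[OF _ _ r0]; simp add: split_beta H0)
            (use z_cont zxx_cont in \<open>auto simp: split_beta intro!: continuous_intros\<close>)
        have jc: "continuous_on UNIV (\<lambda>X. if X \<in> D then J (z X r) else 0)"
          by (rule extension_continuous_slice[OF _ _ r0]; simp add: split_beta J(2))
            (use z_cont in \<open>auto simp: split_beta intro!: continuous_intros\<close>)
        have le: "g' X r \<le> k X + e X" for X
        proof (cases "X \<in> D \<and> z X r > 0")
          case True
          then have "?H (z X r) * wt X r \<le> ?H (z X r) * (\<Sum>i\<in>Basis. zxx i X r)"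
            using sub[of X r] r0 sign_approx_bounds(1)[OF Z p bd[of X r]] by (intro mult_left_mono) auto
          then show ?thesis using True by (simp add: g'_def k_def e_def mult.commute)
        next
          case False
          then show ?thesis by (auto simp: g'_def k_def e_def H0)
        qed
        have "y' r \<le> integral UNIV (\<lambda>X. bump (X - a) * k X + bump (X - a) * e X)"
          unfolding y'_def
        proof (rule integral_le)
          show "(\<lambda>X. bump (X - a) * g' X r) integrable_on UNIV" by (rule bump_integral(1)[OF slice(2)[OF r0]])
          show "(\<lambda>X. bump (X - a) * k X + bump (X - a) * e X) integrable_on UNIV"
            by (intro integrable_add bump_integral(1) kc ec)
          show "bump (X - a) * g' X r \<le> bump (X - a) * k X + bump (X - a) * e X" for X
            using mult_left_mono[OF le bump_nonneg[of "X - a"], of X] by (simp add: algebra_simps)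
        qed
        also have "\<dots> = integral UNIV (\<lambda>X. bump (X - a) * k X) + integral UNIV (\<lambda>X. bump (X - a) * e X)"
          by (rule integral_add) (intro bump_integral(1) kc ec)+
        also have "integral UNIV (\<lambda>X. bump (X - a) * e X) \<le> (p * (2 * C * M)) * V"
          unfolding V_def
        proof (rule bump_integral_bound[OF ec])
          show "0 \<le> p * (2 * C * M)" using p C M by simp
          fix X assume X: "X \<in> cball a 1"
          show "e X \<le> p * (2 * C * M)"
          proof (cases "X \<in> D \<and> z X r > 0")
            case True
            then have zz: "z X r > 0" "X \<in> D" by auto
            have b: "\<bar>zt X r\<bar> \<le> M" using M(2)[of X r] X zz r s by auto
            have d: "?dH (z X r) \<ge> 0" "z X r * ?dH (z X r) \<le> 2 * p"
              using sign_approx_bounds(3,4)[OF Z p bd[OF zz(2) r0]] by auto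
            have "0 < C * w X r" using cmp[OF zz(2) r0 zz(1)] zz by linarith
            then have w: "0 \<le> w X r" "w X r \<le> C * z X r" using C cmp[OF zz(2) r0 zz(1)]
              by (simp_all add: zero_less_mult_iff)
            have "e X \<le> w X r * (?dH (z X r) * M)"
              using zz b d w by (auto simp: e_def intro!: mult_left_mono)
            also have "\<dots> \<le> (C * z X r) * (?dH (z X r) * M)" using w d M by (intro mult_right_mono) auto
            also have "\<dots> = C * M * (z X r * ?dH (z X r))" by simp
            also have "\<dots> \<le> C * M * (2 * p)" using d C M by (intro mult_left_mono) auto
            finally show ?thesis by (simp add: mult_ac)
          next
            case False
            then have "e X = 0" by (auto simp: e_def H0)
            then show ?thesis using p C M by simp
          qed
        qed
        also have "integral UNIV (\<lambda>X. bump (X - a) * k X) \<le>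
            integral UNIV (\<lambda>X. (if X \<in> D then J (z X r) else 0) * (\<Sum>i\<in>Basis. bump_dd i (X - a)))"
          unfolding k_def by (rule kato[OF r0 p J(1,2)])
        also have "\<dots> \<le> integral UNIV (\<lambda>X. \<Sum>k\<in>F. (L * C) * (bump (X - (a + k)) * wp X r))"
        proof (rule integral_le)
          show "(\<lambda>X. (if X \<in> D then J (z X r) else 0) * (\<Sum>i\<in>Basis. bump_dd i (X - a))) integrable_on UNIV"
            by (rule compact_support_integral(1)[OF _ _ c])
              (use jc bump_laplacian_zero in \<open>auto intro!: continuous_intros simp del: mem_cball\<close>)
          show "(\<lambda>X. \<Sum>k\<in>F. (L * C) * (bump (X - (a + k)) * wp X r)) integrable_on UNIV"
            by (intro integrable_sum F(1) integrable_on_mult_right bump_integral(1) wp_cont_slice r0)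
          fix X
          have j: "0 \<le> (if X \<in> D then J (z X r) else 0)" "(if X \<in> D then J (z X r) else 0) \<le> C * wp X r"
          proof -
            show "0 \<le> (if X \<in> D then J (z X r) else 0)" using J(3) bd r0 by auto
            show "(if X \<in> D then J (z X r) else 0) \<le> C * wp X r"
            proof (cases "X \<in> D \<and> z X r > 0")
              case True
              then have "J (z X r) \<le> z X r" "z X r \<le> C * w X r" using J(4) bd cmp r0 by auto
              moreover have "C * w X r \<le> C * max 0 (w X r)" using C by (intro mult_left_mono) auto
              ultimately show ?thesis using True by (simp add: wp_def)
            next
              case False
              then show ?thesis using C wp_bounds(1)[of X r] by (auto simp: J(2))
            qed
          qed
          have "(if X \<in> D then J (z X r) else 0) * (\<Sum>i\<in>Basis. bump_dd i (X - a))
             \<le> (if X \<in> D then J (z X r) else 0) * (L * (\<Sum>k\<in>F. bump (X - a - k)))"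
            using F(3)[of "X - a"] by (intro mult_left_mono j) linarith
          also have "\<dots> \<le> (C * wp X r) * (L * (\<Sum>k\<in>F. bump (X - a - k)))"
            using F(2) by (intro mult_right_mono j mult_nonneg_nonneg sum_nonneg bump_nonneg) auto
          also have "\<dots> = (\<Sum>k\<in>F. (L * C) * (bump (X - (a + k)) * wp X r))"
            by (simp add: sum_distrib_left mult_ac diff_diff_eq)
          finally show "(if X \<in> D then J (z X r) else 0) * (\<Sum>i\<in>Basis. bump_dd i (X - a))
              \<le> (\<Sum>k\<in>F. (L * C) * (bump (X - (a + k)) * wp X r))" .
        qed
        also have "\<dots> = (\<Sum>k\<in>F. integral UNIV (\<lambda>X. (L * C) * (bump (X - (a + k)) * wp X r)))"
          by (rule integral_sum[OF F(1)]) (intro integrable_on_mult_right bump_integral(1) wp_cont_slice r0)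
        also have "\<dots> = (\<Sum>k\<in>F. (L * C) * local_mass (a + k) r)" by (simp add: local_mass_def)
        also have "\<dots> \<le> (\<Sum>k\<in>F. (L * C) * (B * exp (l * r)))"
          using B(1)[OF r0] F(2) C by (intro sum_mono mult_left_mono) auto
        also have "\<dots> = (L * C * real (card F)) * (B * exp (l * r))" by simp
        also have "\<dots> \<le> K * (B * exp (l * r))" using B(2) by (intro mult_right_mono) (auto simp: K_def)
        finally show ?thesis by (simp add: mult_ac)
      qed
      define q where "q r = y r - (K * B / l * exp (l * r) + p * (2 * C * M * V) * r)" for r
      have "q t \<le> q s"
      proof (rule DERIV_nonpos_imp_nonincreasing[OF s(2)])
        fix r assume r: "s \<le> r" "r \<le> t"
        have "(q has_real_derivative y' r - (K * B * exp (l * r) + p * (2 * C * M * V))) (at r)"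
          unfolding q_def[abs_def] using r s l by (auto intro!: derivative_eq_intros dy)
        moreover have "y' r - (K * B * exp (l * r) + p * (2 * C * M * V)) \<le> 0" using y'_bound[OF r] by simp
        ultimately show "\<exists>y. (q has_real_derivative y) (at r) \<and> y \<le> 0" by blast
      qed
      moreover have "0 \<le> K * B / l * exp (l * s)" using K B l by simp
      ultimately have 1: "y t - y s \<le> K * B / l * exp (l * t) + p * (2 * C * M * V) * (t - s)"
        unfolding q_def by (simp add: algebra_simps)
      have t0: "t > 0" using s by simp
      have g_le: "g X r \<le> wp X r" if "r > 0" for X r
      proof (cases "X \<in> D \<and> z X r > 0")
        case True
        have "w X r * ?H (z X r) \<le> max 0 (w X r) * 1"
          using sign_approx_bounds(1,2)[OF Z p bd[of X r]] True that by (intro mult_mono) auto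
        then show ?thesis using True by (simp add: g_def wp_def)
      qed (use wp_bounds(1)[of X r] in \<open>auto simp: g_def H0\<close>)
      have 2: "y s \<le> local_mass a s"
        unfolding y_def local_mass_def
        by (rule integral_le) (use s in \<open>auto intro!: bump_integral(1) slice wp_cont_slice mult_left_mono g_le bump_nonneg\<close>)
      have "local_mass a t - y t = integral UNIV (\<lambda>X. bump (X - a) * wp X t - bump (X - a) * g X t)"
        unfolding y_def local_mass_def
        by (rule integral_diff[symmetric]) (intro bump_integral(1) slice wp_cont_slice t0)+
      also have "\<dots> = integral UNIV (\<lambda>X. bump (X - a) * (wp X t - g X t))"
        by (simp add: right_diff_distrib)
      also have "\<dots> \<le> (p * (2 * C * Z)) * V"
        unfolding V_def
      proof (rule bump_integral_bound)
        show "continuous_on UNIV (\<lambda>X. wp X t - g X t)" by (intro continuous_intros wp_cont_slice slice t0)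
        show "0 \<le> p * (2 * C * Z)" using p C Z by simp
        fix X
        show "wp X t - g X t \<le> p * (2 * C * Z)"
        proof (cases "X \<in> D \<and> z X t > 0")
          case True
          then have zz: "z X t > 0" "X \<in> D" by auto
          have "0 < C * w X t" using cmp[OF zz(2) t0 zz(1)] zz by linarith
          then have w: "0 \<le> w X t" "w X t \<le> C * z X t" using C cmp[OF zz(2) t0 zz(1)]
            by (simp_all add: zero_less_mult_iff)
          have "wp X t - g X t = w X t * (1 - ?H (z X t))" using w zz by (simp add: wp_def g_def algebra_simps)
          also have "\<dots> \<le> (C * z X t) * (1 - ?H (z X t))"
            using sign_approx_bounds(2)[OF Z p bd[OF zz(2) t0]] w by (intro mult_right_mono) auto
          also have "\<dots> = C * (z X t * (1 - ?H (z X t)))" by simp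
          also have "\<dots> \<le> C * (2 * p * Z)"
            using sign_approx_bounds(5)[OF Z p bd[OF zz(2) t0] zz(1)] C by (intro mult_left_mono) auto
          finally show ?thesis by (simp add: mult_ac)
        next
          case False
          then have "wp X t - g X t = 0" using neg[of X t] t0 by (auto simp: wp_def g_def H0 max_def)
          then show ?thesis using p C Z by simp
        qed
      qed
      finally show ?thesis using 1 2 by (simp add: algebra_simps)
    qed
    have "local_mass a t - local_mass a s \<le> K * B / l * exp (l * t)"
    proof (rule field_le_epsilon)
      fix e :: real assume e: "e > 0"
      define R where "R = 2 * C * M * V * (t - s) + 2 * C * Z * V"
      have R: "R \<ge> 0" using C M V Z s by (simp add: R_def)
      have "local_mass a t - local_mass a s \<le> K * B / l * exp (l * t) + e / (R + 1) * R"
        using main[of "e / (R + 1)"] e R by (simp add: R_def)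
      also have "e / (R + 1) * R \<le> e" using R e by (simp add: field_simps)
      finally show "local_mass a t - local_mass a s \<le> K * B / l * exp (l * t) + e" by simp
    qed
    then show "local_mass a t \<le> local_mass a s + K * B / l * exp (l * t)" by simp
  qed
qed

text \<open>The uniform bound C Z V on the local masses is halved again and again: letting s tend to
  0 removes the initial mass, and what remains is the Gronwall term with factor K / l. A continuous
  nonnegative function with zero mass then vanishes at the centre of the bump, where the bump is
  1.\<close>

theorem nonpositive:
  assumes init: "\<And>K. compact K \<Longrightarrow>
      ((\<lambda>t. \<integral>\<^sup>+X. ennreal (w X t) * indicator (K \<inter> D) X \<partial>lborel) \<longlongrightarrow> 0) (at_right 0)"
    and X: "X \<in> D" "t > 0"
  shows "w X t \<le> 0"
proof -
  define V where "V = integral UNIV (bump :: 'a \<Rightarrow> real)"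
  have V: "V \<ge> 0" unfolding V_def by (rule integral_nonneg) (use bump_integral(1)[of "\<lambda>_. 1" "0::'a"] bump_nonneg in auto)
  have mass_nonneg: "0 \<le> local_mass a r" if "r > 0" for a r
    unfolding local_mass_def by (rule integral_nonneg) (use bump_integral(1)[OF wp_cont_slice[OF that]] in \<open>auto intro!: mult_nonneg_nonneg bump_nonneg wp_bounds\<close>)
  have mass_tendsto_0: "((\<lambda>s. local_mass a s) \<longlongrightarrow> 0) (at_right 0)" for a
  proof -
    have le: "ennreal (local_mass a s) \<le> (\<integral>\<^sup>+X. ennreal (w X s) * indicator (cball a 1 \<inter> D) X \<partial>lborel)" if s: "s > 0" for s
    proof -
      have "continuous_on UNIV (\<lambda>X. bump (X - a) * wp X s)" by (intro continuous_intros wp_cont_slice s)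
      moreover have "bump (X - a) * wp X s = 0" if "X \<notin> cball a 1" for X
        using that bump_zero(1)[of "X - a"] by (auto simp: dist_norm norm_minus_commute)
      moreover obtain c where c: "cball a 1 \<subseteq> cbox (-c) c" using bounded_subset_cbox_symmetric[OF bounded_cball] by blast
      ultimately have i: "integrable lborel (\<lambda>X. bump (X - a) * wp X s)"
        using compact_support_integral(3)[of "\<lambda>X. bump (X - a) * wp X s" "cball a 1"] by blast
      have "ennreal (local_mass a s) = (\<integral>\<^sup>+X. ennreal (bump (X - a) * wp X s) \<partial>lborel)"
        unfolding local_mass_def bump_integral(3)[OF wp_cont_slice[OF s]]
        by (rule nn_integral_eq_integral[symmetric, OF i]) (simp add: bump_nonneg wp_bounds)
      also have "\<dots> \<le> (\<integral>\<^sup>+X. ennreal (w X s) * indicator (cball a 1 \<inter> D) X \<partial>lborel)"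
      proof (rule nn_integral_mono)
        fix X
        show "ennreal (bump (X - a) * wp X s) \<le> ennreal (w X s) * indicator (cball a 1 \<inter> D) X"
        proof (cases "X \<in> cball a 1 \<inter> D")
          case True
          have "bump (X - a) * wp X s \<le> 1 * wp X s" by (intro mult_right_mono bump_le_1 wp_bounds)
          then have "ennreal (bump (X - a) * wp X s) \<le> ennreal (wp X s)" by (intro ennreal_leI) simp
          also have "\<dots> = ennreal (w X s)" using True by (cases "w X s \<ge> 0") (auto simp: wp_def ennreal_neg)
          finally show ?thesis using True by simp
        next
          case False
          then have "bump (X - a) * wp X s = 0"
            using bump_zero(1)[of "X - a"] by (auto simp: dist_norm norm_minus_commute wp_def)
          then show ?thesis by (simp only: ennreal_0 zero_le)
        qed
      qed
      finally show ?thesis .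
    qed
    have "((\<lambda>s. ennreal (local_mass a s)) \<longlongrightarrow> 0) (at_right 0)"
    proof (rule tendsto_sandwich[OF _ _ tendsto_const init[OF compact_cball]])
      show "\<forall>\<^sub>F s in at_right 0. ennreal (local_mass a s) \<le> (\<integral>\<^sup>+X. ennreal (w X s) * indicator (cball a 1 \<inter> D) X \<partial>lborel)"
        by (rule eventually_mono[OF eventually_at_right_less le])
    qed auto
    then have "((\<lambda>s. ennreal (local_mass a s)) \<longlongrightarrow> ennreal 0) (at_right 0)" by simp
    then show ?thesis
      by (subst (asm) tendsto_ennreal_iff)
        (use mass_nonneg in \<open>simp_all add: eventually_at_right_less eventually_mono[OF eventually_at_right_less]\<close>)
  qed
  obtain K where K: "K > 0"
    "\<And>B l a s t. (\<And>b r. r > 0 \<Longrightarrow> local_mass b r \<le> B * exp (l * r)) \<Longrightarrow> B \<ge> 0 \<Longrightarrow> l > 0 \<Longrightarrow> 0 < s \<Longrightarrow> s \<le> t \<Longrightarrow>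
       local_mass a t \<le> local_mass a s + K * B / l * exp (l * t)"
    using local_mass_decay by blast
  \<comment> \<open>With this rate K / l = 1 / 2, so each use of the decay estimate halves the
    constant B.\<close>
  define l where "l = 2 * K"
  have l: "l > 0" using K by (simp add: l_def)
  have half: "local_mass b r \<le> (B / 2) * exp (l * r)" if B: "\<And>b r. r > 0 \<Longrightarrow> local_mass b r \<le> B * exp (l * r)" "B \<ge> 0" and r: "r > 0" for b r B
  proof -
    have "((\<lambda>s. local_mass b s + K * B / l * exp (l * r)) \<longlongrightarrow> 0 + K * B / l * exp (l * r)) (at_right 0)"
      by (intro tendsto_add mass_tendsto_0 tendsto_const)
    moreover have "\<forall>\<^sub>F s in at_right 0. local_mass b r \<le> local_mass b s + K * B / l * exp (l * r)"
    proof -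
      have "local_mass b r \<le> local_mass b s + K * B / l * exp (l * r)" if "0 < s" "s < r" for s
        by (rule K(2)[OF B l]) (use that in auto)
      then show ?thesis unfolding eventually_at_right_field using r by blast
    qed
    ultimately have "local_mass b r \<le> 0 + K * B / l * exp (l * r)"
      by (intro tendsto_lowerbound) auto
    then show ?thesis using K(1) by (simp add: l_def)
  qed
  have bound: "local_mass b r \<le> (C * Z * V / 2 ^ n) * exp (l * r)" if "r > 0" for b r n
    using that
  proof (induction n arbitrary: b r)
    case 0
    have "local_mass b r \<le> (C * Z) * V"
      unfolding local_mass_def V_def using wp_bounds(2)[OF 0] C Z by (intro bump_integral_bound wp_cont_slice 0) auto
    also have "\<dots> \<le> (C * Z) * V * exp (l * r)"
      using C Z V l 0 mult_left_mono[of 1 "exp (l * r)" "(C * Z) * V"] by simp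
    finally show ?case by simp
  next
    case (Suc n)
    have "local_mass b r \<le> ((C * Z * V / 2 ^ n) / 2) * exp (l * r)"
      by (rule half[OF Suc.IH]) (use C Z V Suc in auto)
    then show ?case by (simp add: field_simps)
  qed
  have "local_mass X t \<le> 0"
  proof (rule LIMSEQ_le_const)
    have "(\<lambda>n. (C * Z * V * exp (l * t)) * (1 / 2) ^ n) \<longlonglongrightarrow> (C * Z * V * exp (l * t)) * 0"
      by (intro tendsto_mult tendsto_const LIMSEQ_power_zero) auto
    then show "(\<lambda>n. (C * Z * V / 2 ^ n) * exp (l * t)) \<longlonglongrightarrow> 0" by (simp add: power_one_over field_simps)
    show "\<exists>N. \<forall>n\<ge>N. local_mass X t \<le> (C * Z * V / 2 ^ n) * exp (l * t)" using bound[OF X(2)] by blast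
  qed
  then have mass_zero: "local_mass X t = 0" using mass_nonneg[OF X(2), of X] by simp
  obtain c where c: "cball X 1 \<subseteq> cbox (-c) c" using bounded_subset_cbox_symmetric[OF bounded_cball] by blast
  have cont: "continuous_on (cbox (-c) c) (\<lambda>x. bump (x - X) * wp x t)"
    using wp_cont_slice[OF X(2)] by (intro continuous_intros) (auto intro: continuous_on_subset)
  have "((\<lambda>x. bump (x - X) * wp x t) has_integral 0) (cbox (-c) c)"
    using integrable_integral[OF integrable_continuous[OF cont]] mass_zero
      bump_integral(2)[OF wp_cont_slice[OF X(2)] c] by (simp add: local_mass_def)
  moreover have "box (-c) c \<noteq> {}"
  proof -
    have "interior (cball X 1) \<subseteq> interior (cbox (-c) c)" using c by (rule interior_mono)
    then show ?thesis by (auto simp: interior_cbox)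
  qed
  ultimately have "bump (X - X) * wp X t = 0"
  proof (intro has_integral_0_cbox_imp_0[OF cont])
    show "X \<in> cbox (-c) c" using c by (rule subsetD) simp
    show "0 \<le> bump (x - X) * wp x t" for x by (intro mult_nonneg_nonneg bump_nonneg wp_bounds)
  qed
  then have "wp X t = 0" by (simp add: bump_def)
  then show ?thesis using X by (simp add: wp_def)
qed

end

subsection \<open>Classical maximum principle and barriers\<close>

text \<open>Convergence in L1loc concerns compact subsets of D, while test functions reach across
  its boundary. Inner regularity of Lebesgue measure leaves a remainder of small measure, on which
  the uniform bound c suffices.\<close>

lemma initial_L1loc_up_to_boundary:
  fixes U :: "'a::euclidean_space \<Rightarrow> real \<Rightarrow> real"
  assumes D: "open D" and init: "initial_L1loc D U u0"
    and bd: "\<And>X t. X \<in> D \<Longrightarrow> t > 0 \<Longrightarrow> \<bar>U X t - u0 X\<bar> \<le> c" and K: "compact K"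
  shows "((\<lambda>t. \<integral>\<^sup>+X. ennreal \<bar>U X t - u0 X\<bar> * indicator (K \<inter> D) X \<partial>lborel) \<longlongrightarrow> 0) (at_right 0)"
proof (rule order_tendstoI)
  fix a :: ennreal assume a: "0 < a"
  obtain e where e: "e > 0" "ennreal e \<le> a"
  proof (cases a)
    case (real r)
    then show ?thesis using a by (intro that[of r]) (auto simp: ennreal_less_zero_iff)
  qed (use that[of 1] in auto)
  define c' where "c' = max 0 c + 1"
  have c': "c' > 0" "c \<le> c'" by (auto simp: c'_def)
  have borel: "K \<inter> D \<in> sets borel" using D compact_imp_closed[OF K] by auto
  then obtain T where T: "closed T" "T \<subseteq> K \<inter> D" "emeasure lebesgue (K \<inter> D - T) < ennreal (e / (2 * c'))"
  proof -
    have "K \<inter> D \<in> sets lebesgue" using borel by (simp add: sets_completionI_sets)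
    moreover have "0 < e / (2 * c')" using e(1) c'(1) by simp
    ultimately show ?thesis by (rule sets_lebesgue_inner_closed) (rule that)
  qed
  have cT: "compact T" using compact_Int_closed[OF K T(1)] T(2) by (simp add: Int_absorb1)
  have bT: "K \<inter> D - T \<in> sets borel" using borel T(1) by auto
  have m: "emeasure lborel (K \<inter> D - T) < ennreal (e / (2 * c'))"
    using T(3) bT by (simp add: emeasure_completion)
  have "((\<lambda>t. LINT X:T|lborel. \<bar>U X t - u0 X\<bar>) \<longlongrightarrow> 0) (at_right 0)"
    and si: "\<And>t. t > 0 \<Longrightarrow> set_integrable lborel T (\<lambda>X. U X t - u0 X)"
    using init cT T(2) unfolding initial_L1loc_def by auto
  then have "\<forall>\<^sub>F t in at_right 0. (LINT X:T|lborel. \<bar>U X t - u0 X\<bar>) < e / 2"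
    using e(1) by (intro order_tendstoD(2)) auto
  then show "\<forall>\<^sub>F t in at_right 0. (\<integral>\<^sup>+X. ennreal \<bar>U X t - u0 X\<bar> * indicator (K \<inter> D) X \<partial>lborel) < a"
    using eventually_at_right_less[of "0::real"]
  proof eventually_elim
    fix t :: real assume lt: "(LINT X:T|lborel. \<bar>U X t - u0 X\<bar>) < e / 2" and t: "t > 0"
    have si': "integrable lborel (\<lambda>X. indicator T X *\<^sub>R \<bar>U X t - u0 X\<bar>)"
      using set_integrable_abs[OF si[OF t]] unfolding set_integrable_def .
    have "(\<integral>\<^sup>+X. ennreal \<bar>U X t - u0 X\<bar> * indicator (K \<inter> D) X \<partial>lborel)
        \<le> (\<integral>\<^sup>+X. ennreal (indicator T X *\<^sub>R \<bar>U X t - u0 X\<bar>) + ennreal c' * indicator (K \<inter> D - T) X \<partial>lborel)"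
    proof (rule nn_integral_mono)
      fix X
      consider "X \<in> T" | "X \<in> K \<inter> D - T" | "X \<notin> K \<inter> D" by blast
      then show "ennreal \<bar>U X t - u0 X\<bar> * indicator (K \<inter> D) X
        \<le> ennreal (indicator T X *\<^sub>R \<bar>U X t - u0 X\<bar>) + ennreal c' * indicator (K \<inter> D - T) X"
      proof cases
        case 1
        then have "X \<in> K \<inter> D" using T(2) by blast
        then show ?thesis using 1 by (simp del: Int_iff)
      next
        case 2
        then show ?thesis using order_trans[OF bd c'(2)] t by (auto intro!: ennreal_leI)
      qed auto
    qed
    also have "\<dots> = (\<integral>\<^sup>+X. ennreal (indicator T X *\<^sub>R \<bar>U X t - u0 X\<bar>) \<partial>lborel)
        + (\<integral>\<^sup>+X. ennreal c' * indicator (K \<inter> D - T) X \<partial>lborel)"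
      using borel_measurable_integrable[OF si'] bT by (intro nn_integral_add) auto
    also have "(\<integral>\<^sup>+X. ennreal (indicator T X *\<^sub>R \<bar>U X t - u0 X\<bar>) \<partial>lborel) = ennreal (LINT X:T|lborel. \<bar>U X t - u0 X\<bar>)"
      unfolding set_lebesgue_integral_def by (rule nn_integral_eq_integral[OF si']) auto
    also have "(\<integral>\<^sup>+X. ennreal c' * indicator (K \<inter> D - T) X \<partial>lborel) = ennreal c' * emeasure lborel (K \<inter> D - T)"
      using bT by (simp add: nn_integral_cmult_indicator)
    also have "\<dots> \<le> ennreal c' * ennreal (e / (2 * c'))" using m by (intro mult_left_mono) auto
    also have "\<dots> = ennreal (e / 2)" using c' e by (simp add: ennreal_mult[symmetric])
    finally have "(\<integral>\<^sup>+X. ennreal \<bar>U X t - u0 X\<bar> * indicator (K \<inter> D) X \<partial>lborel)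
        \<le> ennreal (LINT X:T|lborel. \<bar>U X t - u0 X\<bar>) + ennreal (e / 2)" by (simp add: add_left_mono)
    also have "\<dots> = ennreal ((LINT X:T|lborel. \<bar>U X t - u0 X\<bar>) + e / 2)"
      using e(1) by (intro ennreal_plus[symmetric]) (auto simp: set_lebesgue_integral_def intro!: integral_nonneg_AE)
    also have "\<dots> < ennreal e" using lt e(1) by (intro ennreal_lessI) auto
    finally show "(\<integral>\<^sup>+X. ennreal \<bar>U X t - u0 X\<bar> * indicator (K \<inter> D) X \<partial>lborel) < a" using e(2) by (rule less_le_trans)
  qed
qed simp

section \<open>Minimum principle in a moving ball and spread of positivity\<close>

lemma second_derivative_nonneg_at_minimum:
  fixes g g' :: "real \<Rightarrow> real"
  assumes e: "e > 0" and d1: "\<And>h. \<bar>h\<bar> < e \<Longrightarrow> (g has_real_derivative g' h) (at h)"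
    and d2: "(g' has_real_derivative g2) (at 0)" and min: "\<And>h. \<bar>h\<bar> < e \<Longrightarrow> g 0 \<le> g h"
  shows "g2 \<ge> 0"
proof (rule ccontr)
  assume "\<not> g2 \<ge> 0"
  then obtain d where d: "d > 0" "\<And>h. h > 0 \<Longrightarrow> h < d \<Longrightarrow> g' (0 + h) < g' 0"
    using has_real_derivative_neg_dec_right[OF d2] by auto
  have z: "g' 0 = 0" using DERIV_local_min[OF d1[of 0] e] min e by auto
  define h where "h = min d e / 2"
  have h: "0 < h" "h < d" "h < e" using d e by (auto simp: h_def)
  obtain x where x: "0 < x" "x < h" "g h - g 0 = (h - 0) * g' x"
    using MVT2[of 0 h g g'] d1 h by auto
  have "g' x < 0" using d(2)[of x] x h z by simp
  then have "g h < g 0" using x h mult_pos_neg[of h "g' x"] by simp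
  then show False using min[of h] h by simp
qed

text \<open>At a negative minimum the time derivative is nonpositive and the pure second derivatives
  are nonnegative, against \<open>strict\<close>. As \<open>strict\<close> concerns only points with
  G < 0, terms of order zero can be absorbed there; the coefficient a may change from point to
  point, as a nonlinear equation demands.\<close>

lemma tube_minimum_principle:
  fixes G Gt :: "'a::euclidean_space \<Rightarrow> real \<Rightarrow> real" and Gx Gxx :: "'a \<Rightarrow> 'a \<Rightarrow> real \<Rightarrow> real" and c :: "real \<Rightarrow> 'a"
  assumes r: "r > 0" and c: "continuous_on UNIV c"
    and cont: "continuous_on {(X, t). t1 \<le> t \<and> t \<le> t2 \<and> norm (X - c t) \<le> r} (\<lambda>(X, t). G X t)"
    and bottom: "\<And>X. norm (X - c t1) \<le> r \<Longrightarrow> 0 \<le> G X t1"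
    and side: "\<And>X t. t1 \<le> t \<Longrightarrow> t \<le> t2 \<Longrightarrow> norm (X - c t) = r \<Longrightarrow> 0 \<le> G X t"
    and dt: "\<And>X t. t1 < t \<Longrightarrow> t \<le> t2 \<Longrightarrow> norm (X - c t) < r \<Longrightarrow> (G X has_real_derivative Gt X t) (at t)"
    and dx: "\<And>X t i. i \<in> Basis \<Longrightarrow> t1 < t \<Longrightarrow> t \<le> t2 \<Longrightarrow> norm (X - c t) < r \<Longrightarrow>
        ((\<lambda>h. G (X + h *\<^sub>R i) t) has_real_derivative Gx i X t) (at 0)"
    and dxx: "\<And>X t i. i \<in> Basis \<Longrightarrow> t1 < t \<Longrightarrow> t \<le> t2 \<Longrightarrow> norm (X - c t) < r \<Longrightarrow>
        ((\<lambda>h. Gx i (X + h *\<^sub>R i) t) has_real_derivative Gxx i X t) (at 0)"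
    and strict: "\<And>X t. t1 < t \<Longrightarrow> t \<le> t2 \<Longrightarrow> norm (X - c t) < r \<Longrightarrow> G X t < 0 \<Longrightarrow>
        \<exists>a\<ge>0. Gt X t > a * (\<Sum>i\<in>Basis. Gxx i X t)"
    and X: "t1 \<le> t" "t \<le> t2" "norm (X - c t) \<le> r"
  shows "0 \<le> G X t"
proof -
  define Q where "Q = {(X, t). t1 \<le> t \<and> t \<le> t2 \<and> norm (X - c t) \<le> r}"
  \<comment> \<open>Straightening the tube to a cylinder gives its compactness.\<close>
  have "Q = (\<lambda>(Y, t). (Y + c t, t)) ` (cball 0 r \<times> {t1..t2})"
  proof
    show "Q \<subseteq> (\<lambda>(Y, t). (Y + c t, t)) ` (cball 0 r \<times> {t1..t2})"
    proof
      fix q assume "q \<in> Q"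
      then show "q \<in> (\<lambda>(Y, t). (Y + c t, t)) ` (cball 0 r \<times> {t1..t2})"
        by (intro image_eqI[of _ _ "(fst q - c (snd q), snd q)"]) (auto simp: Q_def)
    qed
  qed (auto simp: Q_def)
  moreover have "compact ((\<lambda>(Y, t). (Y + c t, t)) ` (cball 0 r \<times> {t1..t2}))"
    by (rule compact_continuous_image)
      (auto simp: split_beta intro!: compact_Times continuous_intros continuous_on_compose2[OF c])
  ultimately have "compact Q" by simp
  moreover have "(X, t) \<in> Q" using X by (simp add: Q_def)
  ultimately obtain q where q: "q \<in> Q" "\<And>p. p \<in> Q \<Longrightarrow> (\<lambda>(X, t). G X t) q \<le> (\<lambda>(X, t). G X t) p"
    using continuous_attains_inf[of Q "\<lambda>(X, t). G X t"] cont unfolding Q_def by blast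
  obtain Y s where qs: "q = (Y, s)" by force
  have Y: "t1 \<le> s" "s \<le> t2" "norm (Y - c s) \<le> r" using q(1) by (auto simp: Q_def qs)
  have min: "G Y s \<le> G X t" if "t1 \<le> t" "t \<le> t2" "norm (X - c t) \<le> r" for X t
    using q(2)[of "(X, t)"] that by (simp add: qs Q_def)
  have "0 \<le> G Y s"
  proof (rule ccontr)
    assume "\<not> 0 \<le> G Y s"
    then have neg: "G Y s < 0" by simp
    have s: "t1 < s" using neg bottom[of Y] Y by (cases "t1 = s") auto
    have n: "norm (Y - c s) < r" using neg side[of s Y] Y by (cases "norm (Y - c s) = r") auto
    \<comment> \<open>The minimum may sit at the final time, so it is compared with earlier times
      only; as the ball moves, continuity of c keeps Y in it shortly before s.\<close>
    have "Gt Y s \<le> 0"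
    proof (rule ccontr)
      assume "\<not> Gt Y s \<le> 0"
      then obtain d where d: "d > 0" "\<And>h. h > 0 \<Longrightarrow> h < d \<Longrightarrow> G Y (s - h) < G Y s"
        using has_real_derivative_pos_inc_left[OF dt[OF s Y(2) n]] by auto
      have "((\<lambda>h. norm (Y - c (s - h))) \<longlongrightarrow> norm (Y - c (s - 0))) (at_right 0)"
        using c by (intro tendsto_intros) (auto simp: continuous_on_eq_continuous_at intro!: isCont_tendsto_compose[of _ c] tendsto_eq_intros)
      then have "\<forall>\<^sub>F h in at_right 0. norm (Y - c (s - h)) < r"
        using n by (intro order_tendstoD(2)) auto
      then obtain b where b: "b > 0" "\<And>h. h > 0 \<Longrightarrow> h < b \<Longrightarrow> norm (Y - c (s - h)) < r"
        by (auto simp: eventually_at_right_field)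
      define h where "h = min (min b d) (s - t1) / 2"
      have h: "h > 0" "h < b" "h < d" "h < s - t1" using b d s by (auto simp: h_def min_def)
      have "G Y s \<le> G Y (s - h)" using min[of "s - h" Y] b(2)[of h] h Y by simp
      then show False using d(2)[of h] h by simp
    qed
    moreover have "Gxx i Y s \<ge> 0" if i: "i \<in> Basis" for i
    proof (rule second_derivative_nonneg_at_minimum[where g = "\<lambda>h. G (Y + h *\<^sub>R i) s" and g' = "\<lambda>h. Gx i (Y + h *\<^sub>R i) s"])
      show "r - norm (Y - c s) > 0" using n by simp
      fix h assume h: "\<bar>h\<bar> < r - norm (Y - c s)"
      have "norm (Y + h *\<^sub>R i - c s) \<le> norm (Y - c s) + norm (h *\<^sub>R i)"
        using norm_triangle_ineq[of "Y - c s" "h *\<^sub>R i"] by (simp add: algebra_simps)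
      then have *: "norm (Y + h *\<^sub>R i - c s) < r" using h i by simp
      show "((\<lambda>h. G (Y + h *\<^sub>R i) s) has_real_derivative Gx i (Y + h *\<^sub>R i) s) (at h)"
        by (rule line_derivative_shift[where G = "\<lambda>X. G X s"]) (rule dx[OF i s Y(2) *])
      show "G (Y + 0 *\<^sub>R i) s \<le> G (Y + h *\<^sub>R i) s" using min[of s "Y + h *\<^sub>R i"] * Y by simp
    next
      show "((\<lambda>h. Gx i (Y + h *\<^sub>R i) s) has_real_derivative Gxx i Y s) (at 0)" by (rule dxx[OF i s Y(2) n])
    qed
    then have "a * (\<Sum>i\<in>Basis. Gxx i Y s) \<ge> 0" if "a \<ge> 0" for a using that by (intro mult_nonneg_nonneg sum_nonneg) auto
    ultimately show False using strict[OF s Y(2) n neg] by force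
  qed
  then show ?thesis using min[OF X] by simp
qed

text \<open>
  The barrier is \<open>exp (- K t) * (r\<^sup>2 - |X - c t|\<^sup>2)\<^sup>2\<close> for a ball whose centre \<open>c t\<close> moves from
  \<open>X1\<close> to \<open>X2\<close>. The constant \<open>\<kappa>\<close> does not depend on \<open>z\<close>: this uniformity is what gives a strict
  sign to a derivative, by way of difference quotients.
\<close>

lemma positivity_propagates:
  fixes X1 X2 :: "'a::euclidean_space"
  assumes r: "r > 0" and t: "t1 < t2" "0 < t1" and \<delta>: "0 < \<delta>1" and C: "0 \<le> C"
    and tube: "S = (\<lambda>(Y, s). Y + X1 + s *\<^sub>R (X2 - X1)) ` (cball 0 r \<times> {0..1})"
  obtains \<kappa> where "\<kappa> > 0"
    "\<And>D z zt zx zxx m. c21 D z zt zx zxx \<Longrightarrow> S \<subseteq> D \<Longrightarrow>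
      (\<And>X t. X \<in> S \<Longrightarrow> t1 \<le> t \<Longrightarrow> t \<le> t2 \<Longrightarrow> 0 \<le> z X t) \<Longrightarrow>
      (\<And>X t. X \<in> S \<Longrightarrow> t1 \<le> t \<Longrightarrow> t \<le> t2 \<Longrightarrow>
         \<exists>a\<in>{\<delta>1..\<delta>2}. zt X t \<ge> a * (\<Sum>i\<in>Basis. zxx i X t) - C * z X t) \<Longrightarrow>
      m > 0 \<Longrightarrow> (\<And>X. X \<in> cball X1 r \<Longrightarrow> m \<le> z X t1) \<Longrightarrow> \<kappa> * m \<le> z X2 t2"
proof -
  define V where "V = (1 / (t2 - t1)) *\<^sub>R (X2 - X1)"
  define c where "c t = X1 + (t - t1) *\<^sub>R V" for t
  \<comment> \<open>With p = r^2 - |X - c t|^2 the barrier inequality reduces to k p^2 - L p + g >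
    0: L collects the Laplacian and the motion of the centre, g bounds the part that survives at the
    lateral boundary p = 0, and k is an extra decay rate that makes the discriminant equal to
    -1.\<close>
  define L where "L = (8 + 4 * real DIM('a)) * \<bar>\<delta>2\<bar> + 4 * r * norm V"
  define g where "g = 8 * \<delta>1 * r\<^sup>2"
  define k where "k = (L\<^sup>2 + 1) / (4 * g)"
  have g: "g > 0" using r \<delta> by (simp add: g_def)
  have k: "k > 0" using g by (simp add: k_def add_nonneg_pos)
  have quad: "k * q\<^sup>2 - L * q + g > 0" for q
  proof -
    have "4 * k * (k * q\<^sup>2 - L * q + g) = (2 * k * q - L)\<^sup>2 + (4 * k * g - L\<^sup>2)"
      by (simp add: power2_eq_square algebra_simps)
    moreover have "4 * k * g - L\<^sup>2 = 1" using g by (simp add: k_def field_simps)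
    ultimately have "4 * k * (k * q\<^sup>2 - L * q + g) > 0" by (simp add: add_nonneg_pos)
    then show ?thesis using k by (simp add: zero_less_mult_iff)
  qed
  \<comment> \<open>The share C of the rate pays for the zero-order term
    \<open>C * z\<close>.\<close>
  define K where "K = C + k"
  define \<kappa> where "\<kappa> = exp (- K * (t2 - t1))"
  have cS: "X \<in> S" if "t1 \<le> t" "t \<le> t2" "norm (X - c t) \<le> r" for X t
  proof -
    have "X = (\<lambda>(Y, s). Y + X1 + s *\<^sub>R (X2 - X1)) (X - c t, (t - t1) / (t2 - t1))"
      using t by (simp add: c_def V_def)
    moreover have "(t - t1) / (t2 - t1) \<in> {0..1}" using that t by simp
    ultimately show ?thesis unfolding tube using that
      by (intro image_eqI[of _ _ "(X - c t, (t - t1) / (t2 - t1))"]) (auto simp del: atLeastAtMost_iff)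
  qed
  have ct: "c t1 = X1" "c t2 = X2" using t by (auto simp: c_def V_def)
  show ?thesis
  proof (rule that[of \<kappa>])
    show "\<kappa> > 0" by (simp add: \<kappa>_def)
    fix D z zt zx zxx and m :: real
    assume z: "c21 D z zt zx zxx" and SD: "S \<subseteq> D"
      and nn: "\<And>X t. X \<in> S \<Longrightarrow> t1 \<le> t \<Longrightarrow> t \<le> t2 \<Longrightarrow> 0 \<le> z X t"
      and eq: "\<And>X t. X \<in> S \<Longrightarrow> t1 \<le> t \<Longrightarrow> t \<le> t2 \<Longrightarrow>
         \<exists>a\<in>{\<delta>1..\<delta>2}. zt X t \<ge> a * (\<Sum>i\<in>Basis. zxx i X t) - C * z X t"
      and m: "m > 0" and bot: "\<And>X. X \<in> cball X1 r \<Longrightarrow> m \<le> z X t1"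
    \<comment> \<open>Normalised so that the barrier has maximum m at time t1, attained at the
      centre.\<close>
    define E where "E t = m / r ^ 4 * exp (- K * (t - t1))" for t
    have E: "E t > 0" for t using m r by (simp add: E_def)
    define q where "q X t = r\<^sup>2 - (X - c t) \<bullet> (X - c t)" for X t
    define b where "b X t = E t * (q X t)\<^sup>2" for X t
    define bt where "bt X t = E t * (- K * (q X t)\<^sup>2 + 4 * q X t * ((X - c t) \<bullet> V))" for X t
    define bx where "bx i X t = E t * (- 4 * q X t * ((X - c t) \<bullet> i))" for i X t
    define bxx where "bxx i X t = E t * (8 * ((X - c t) \<bullet> i)\<^sup>2 - 4 * q X t)" for i X t
    have dq: "((\<lambda>h. q (X + h *\<^sub>R i) t) has_real_derivative - 2 * ((X - c t) \<bullet> i)) (at 0)" if "i \<in> Basis" for i X t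
    proof -
      have "(\<lambda>h. q (X + h *\<^sub>R i) t) = (\<lambda>h. r\<^sup>2 - ((X - c t) \<bullet> (X - c t) + 2 * h * ((X - c t) \<bullet> i) + h * h))"
        using that by (auto simp: q_def fun_eq_iff algebra_simps inner_commute)
      then show ?thesis by (auto intro!: derivative_eq_intros)
    qed
    have dqt: "(q X has_real_derivative 2 * ((X - c t) \<bullet> V)) (at t)" for X t
    proof -
      have "q X = (\<lambda>t. r\<^sup>2 - ((X - X1) \<bullet> (X - X1) - 2 * (t - t1) * ((X - X1) \<bullet> V) + (t - t1) * (t - t1) * (V \<bullet> V)))"
        by (auto simp: q_def c_def fun_eq_iff algebra_simps inner_commute)
      then show ?thesis by (auto simp: c_def algebra_simps inner_commute intro!: derivative_eq_intros)
    qed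
    have dE: "(E has_real_derivative - K * E t) (at t)" for t
    proof -
      have "((\<lambda>t. exp (- K * (t - t1))) has_real_derivative - K * exp (- K * (t - t1))) (at t)"
        by (auto intro!: derivative_eq_intros)
      from DERIV_cmult[OF this, of "m / r ^ 4"] show ?thesis
        unfolding E_def[abs_def] by (simp add: mult.left_commute)
    qed
    have dbt: "(b X has_real_derivative bt X t) (at t)" for X t
      unfolding b_def[abs_def] bt_def
      by (auto intro!: derivative_eq_intros dE dqt simp: power2_eq_square algebra_simps)
    have dbx: "((\<lambda>h. b (X + h *\<^sub>R i) t) has_real_derivative bx i X t) (at 0)" if "i \<in> Basis" for i X t
      unfolding b_def bx_def by (auto intro!: derivative_eq_intros dq that simp: algebra_simps)
    have dbxx: "((\<lambda>h. bx i (X + h *\<^sub>R i) t) has_real_derivative bxx i X t) (at 0)" if "i \<in> Basis" for i X t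
    proof -
      have l: "((\<lambda>h. (X + h *\<^sub>R i - c t) \<bullet> i) has_real_derivative 1) (at 0)"
        using that by (auto simp: inner_add_left inner_diff_left intro!: derivative_eq_intros)
      show ?thesis unfolding bx_def bxx_def
        by (auto intro!: derivative_eq_intros dq that l simp: algebra_simps power2_eq_square inner_same_Basis that)
    qed
    have sumb: "(\<Sum>i\<in>Basis. bxx i X t) = E t * (8 * (r\<^sup>2 - q X t) - 4 * real DIM('a) * q X t)" for X t
    proof -
      have "(\<Sum>i\<in>Basis. ((X - c t) \<bullet> i)\<^sup>2) = r\<^sup>2 - q X t"
        by (simp add: q_def euclidean_inner[of "X - c t" "X - c t"] power2_eq_square)
      moreover have "(\<Sum>i\<in>Basis. bxx i X t) = E t * (8 * (\<Sum>i\<in>Basis. ((X - c t) \<bullet> i)\<^sup>2) - real DIM('a) * (4 * q X t))"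
        unfolding bxx_def sum_distrib_left[symmetric] sum_subtractf by simp
      ultimately show ?thesis by (simp only: mult.assoc mult.left_commute)
    qed
    have contz: "continuous_on (S \<times> {t1..t2}) (\<lambda>(X, t). z X t)"
      using z t SD unfolding c21_def by (auto elim!: continuous_on_subset)
    have "0 \<le> z X2 t2 - b X2 t2"
    proof (rule tube_minimum_principle[where c = c and r = r and ?t1.0 = t1 and ?t2.0 = t2
          and G = "\<lambda>X t. z X t - b X t" and Gt = "\<lambda>X t. zt X t - bt X t"
          and Gx = "\<lambda>i X t. zx i X t - bx i X t" and Gxx = "\<lambda>i X t. zxx i X t - bxx i X t"])
      show "continuous_on UNIV c" unfolding c_def by (intro continuous_intros)
      have "continuous_on {(X, t). t1 \<le> t \<and> t \<le> t2 \<and> norm (X - c t) \<le> r} (\<lambda>(X, t). z X t)"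
        by (rule continuous_on_subset[OF contz]) (use cS in auto)
      then show "continuous_on {(X, t). t1 \<le> t \<and> t \<le> t2 \<and> norm (X - c t) \<le> r} (\<lambda>(X, t). z X t - b X t)"
        unfolding split_beta b_def q_def E_def c_def by (intro continuous_intros) auto
      show "0 \<le> z X t1 - b X t1" if X: "norm (X - c t1) \<le> r" for X
      proof -
        have "(X - c t1) \<bullet> (X - c t1) \<le> r\<^sup>2" using X power_mono[of "norm (X - c t1)" r 2] by (simp add: power2_norm_eq_inner)
        then have "(q X t1)\<^sup>2 \<le> (r\<^sup>2)\<^sup>2" by (intro power_mono) (auto simp: q_def)
        then have "b X t1 \<le> m / r ^ 4 * r ^ 4" unfolding b_def E_def using m r by (intro mult_mono) (auto simp: power2_eq_square eval_nat_numeral)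
        also have "\<dots> = m" using r by simp
        also have "m \<le> z X t1" using bot[of X] X ct by (simp add: dist_norm norm_minus_commute)
        finally show ?thesis by simp
      qed
      show "0 \<le> z X t - b X t" if "t1 \<le> t" "t \<le> t2" "norm (X - c t) = r" for X t
      proof -
        have "q X t = 0" using that by (simp add: q_def flip: power2_norm_eq_inner)
        then show ?thesis using nn[OF cS] that by (simp add: b_def)
      qed
      have zd: "X \<in> S \<Longrightarrow> t1 \<le> s \<Longrightarrow> (z X has_real_derivative zt X s) (at s)"
        "X \<in> S \<Longrightarrow> t1 \<le> s \<Longrightarrow> i \<in> Basis \<Longrightarrow> ((\<lambda>h. z (X + h *\<^sub>R i) s) has_real_derivative zx i X s) (at 0)"
        "X \<in> S \<Longrightarrow> t1 \<le> s \<Longrightarrow> i \<in> Basis \<Longrightarrow> ((\<lambda>h. zx i (X + h *\<^sub>R i) s) has_real_derivative zxx i X s) (at 0)" for X s i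
        using z SD t unfolding c21_def by auto
      show "((\<lambda>t. z X t - b X t) has_real_derivative zt X s - bt X s) (at s)"
        if "t1 < s" "s \<le> t2" "norm (X - c s) < r" for X s
        using that cS[of s X] by (intro DERIV_diff dbt zd(1)) auto
      show "((\<lambda>h. z (X + h *\<^sub>R i) s - b (X + h *\<^sub>R i) s) has_real_derivative zx i X s - bx i X s) (at 0)"
        if "i \<in> Basis" "t1 < s" "s \<le> t2" "norm (X - c s) < r" for X s i
        using that cS[of s X] by (intro DERIV_diff dbx zd(2)) auto
      show "((\<lambda>h. zx i (X + h *\<^sub>R i) s - bx i (X + h *\<^sub>R i) s) has_real_derivative zxx i X s - bxx i X s) (at 0)"
        if "i \<in> Basis" "t1 < s" "s \<le> t2" "norm (X - c s) < r" for X s i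
        using that cS[of s X] by (intro DERIV_diff dbxx zd(3)) auto
      show "\<exists>a\<ge>0. zt X s - bt X s > a * (\<Sum>i\<in>Basis. zxx i X s - bxx i X s)"
        if s: "t1 < s" "s \<le> t2" "norm (X - c s) < r" and lt: "z X s - b X s < 0" for X s
      proof -
        obtain a where a: "a \<in> {\<delta>1..\<delta>2}" "zt X s \<ge> a * (\<Sum>i\<in>Basis. zxx i X s) - C * z X s"
          using eq[OF cS[of s X], of s] s by auto
        define p where "p = q X s"
        have "(X - c s) \<bullet> (X - c s) < r\<^sup>2" using s power_strict_mono[of "norm (X - c s)" r 2] by (simp add: power2_norm_eq_inner)
        then have p: "p > 0" by (simp add: p_def q_def)
        have "(X - c s) \<bullet> V \<le> norm (X - c s) * norm V" by (rule norm_cauchy_schwarz)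
        also have "\<dots> \<le> r * norm V" using s by (intro mult_right_mono) auto
        finally have v: "4 * ((X - c s) \<bullet> V) \<le> 4 * r * norm V" by simp
        have "a * (8 + 4 * real DIM('a)) + 4 * ((X - c s) \<bullet> V) \<le> \<bar>\<delta>2\<bar> * (8 + 4 * real DIM('a)) + 4 * r * norm V"
          using a by (intro add_mono mult_right_mono v) auto
        then have "p * (a * (8 + 4 * real DIM('a)) + 4 * ((X - c s) \<bullet> V)) \<le> p * L"
          using p by (intro mult_left_mono) (auto simp: L_def algebra_simps)
        moreover have "g \<le> 8 * a * r\<^sup>2" using a unfolding g_def by (intro mult_right_mono) auto
        ultimately have "0 < k * p\<^sup>2 - p * (a * (8 + 4 * real DIM('a)) + 4 * ((X - c s) \<bullet> V)) + 8 * a * r\<^sup>2"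
          using quad[of p] by (simp add: algebra_simps)
        then have "0 < E s * (k * p\<^sup>2 - p * (a * (8 + 4 * real DIM('a)) + 4 * ((X - c s) \<bullet> V)) + 8 * a * r\<^sup>2)"
          using E[of s] by simp
        also have "\<dots> = a * (\<Sum>i\<in>Basis. bxx i X s) - C * b X s - bt X s"
          unfolding sumb b_def bt_def p_def[symmetric] K_def by (simp add: algebra_simps)
        \<comment> \<open>Here the restriction to z < b is used: it puts the zero-order term of z
          below that of the barrier.\<close>
        also have "\<dots> \<le> a * (\<Sum>i\<in>Basis. bxx i X s) - C * z X s - bt X s"
          using mult_left_mono[of "z X s" "b X s" C] lt C by simp
        finally show ?thesis using a \<delta> by (intro exI[of _ a]) (auto simp: sum_subtractf right_diff_distrib)
      qed
    qed (use r t ct in auto)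
    moreover have "b X2 t2 = \<kappa> * m" using r ct by (simp add: b_def E_def q_def \<kappa>_def power2_eq_square eval_nat_numeral)
    ultimately show "\<kappa> * m \<le> z X2 t2" by simp
  qed
qed

section \<open>Gaussian barriers\<close>

lemma exp_inverse_tendsto:
  fixes k :: real
  assumes "k > 0"
  shows "((\<lambda>t. exp (- k / t)) \<longlongrightarrow> 0) (at_right 0)"
proof -
  have "filterlim (\<lambda>t. k * inverse t) at_top (at_right (0::real))"
    by (rule filterlim_tendsto_pos_mult_at_top[OF tendsto_const assms filterlim_inverse_at_top_right])
  then have "filterlim (\<lambda>t. - (k * inverse t)) at_bot (at_right (0::real))"
    by (simp add: filterlim_uminus_at_top)
  from filterlim_compose[OF exp_at_bot this] show ?thesis by (simp add: divide_inverse)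
qed

text \<open>A modified heat kernel: the power of 1 / s is twice that of the heat kernel. For c = - 1
  / (4 \<kappa>) the surplus leaves a subsolution for every diffusivity between \<kappa> and 2
  \<kappa>. A positive c serves in reversed time, as a supersolution that blows up at a finite
  time.\<close>

definition gaussian :: "real \<Rightarrow> 'a::euclidean_space \<Rightarrow> real \<Rightarrow> real" where
  "gaussian c X s = inverse s ^ DIM('a) * exp (c * (X \<bullet> X) / s)"

lemma gaussian_derivatives:
  fixes X :: "'a::euclidean_space"
  assumes s: "s > 0"
  shows "(gaussian c X has_real_derivative (- real DIM('a) / s - c * (X \<bullet> X) / s\<^sup>2) * gaussian c X s) (at s)"
    and "i \<in> Basis \<Longrightarrow> ((\<lambda>h. gaussian c (X + h *\<^sub>R i) s) has_real_derivative (2 * c * (X \<bullet> i) / s) * gaussian c X s) (at 0)"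
    and "i \<in> Basis \<Longrightarrow> ((\<lambda>h. (2 * c * ((X + h *\<^sub>R i) \<bullet> i) / s) * gaussian c (X + h *\<^sub>R i) s) has_real_derivative
           (4 * c\<^sup>2 * (X \<bullet> i)\<^sup>2 / s\<^sup>2 + 2 * c / s) * gaussian c X s) (at 0)"
    and "(\<Sum>i\<in>Basis. (4 * c\<^sup>2 * (X \<bullet> i)\<^sup>2 / s\<^sup>2 + 2 * c / s) * gaussian c X s) =
           (4 * c\<^sup>2 * (X \<bullet> X) / s\<^sup>2 + 2 * c * real DIM('a) / s) * gaussian c X s"
proof -
  obtain n where n: "DIM('a) = Suc n" using DIM_positive[where 'a='a] by (cases "DIM('a)") auto
  show "(gaussian c X has_real_derivative (- real DIM('a) / s - c * (X \<bullet> X) / s\<^sup>2) * gaussian c X s) (at s)"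
  proof -
    have p: "((\<lambda>s. inverse s ^ Suc n) has_real_derivative - real (Suc n) / s * inverse s ^ Suc n) (at s)"
      using DERIV_power[OF DERIV_inverse[of s UNIV], of "Suc n"] s by (simp add: divide_inverse algebra_simps)
    have e: "((\<lambda>s. exp (c * (X \<bullet> X) / s)) has_real_derivative - c * (X \<bullet> X) / s\<^sup>2 * exp (c * (X \<bullet> X) / s)) (at s)"
      using s by (auto intro!: derivative_eq_intros simp: power2_eq_square)
    show ?thesis using DERIV_mult[OF p e] unfolding gaussian_def[abs_def] n by (simp add: algebra_simps)
  qed
  have d: "((\<lambda>h. gaussian c (X + h *\<^sub>R i) s) has_real_derivative (2 * c * (X \<bullet> i) / s) * gaussian c X s) (at 0)"
    if i: "i \<in> Basis" for i
  proof -
    have eq: "(\<lambda>h. gaussian c (X + h *\<^sub>R i) s) =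
        (\<lambda>h. inverse s ^ DIM('a) * exp (c * (X \<bullet> X + 2 * h * (X \<bullet> i) + h * h) / s))"
      using i by (auto simp: gaussian_def fun_eq_iff inner_add_left inner_add_right inner_commute)
    show ?thesis unfolding eq using s
      by (auto intro!: derivative_eq_intros simp: gaussian_def)
  qed
  then show "i \<in> Basis \<Longrightarrow> ((\<lambda>h. gaussian c (X + h *\<^sub>R i) s) has_real_derivative (2 * c * (X \<bullet> i) / s) * gaussian c X s) (at 0)" .
  show "((\<lambda>h. (2 * c * ((X + h *\<^sub>R i) \<bullet> i) / s) * gaussian c (X + h *\<^sub>R i) s) has_real_derivative
           (4 * c\<^sup>2 * (X \<bullet> i)\<^sup>2 / s\<^sup>2 + 2 * c / s) * gaussian c X s) (at 0)" if i: "i \<in> Basis"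
  proof -
    have l: "((\<lambda>h. 2 * c * ((X + h *\<^sub>R i) \<bullet> i) / s) has_real_derivative 2 * c / s) (at 0)"
      using i s by (auto simp: inner_add_left intro!: derivative_eq_intros)
    show ?thesis using DERIV_mult[OF l d[OF i]] by (simp add: algebra_simps power2_eq_square)
  qed
  have "(\<Sum>i\<in>Basis. (X \<bullet> i)\<^sup>2) = X \<bullet> X" by (simp add: euclidean_inner[of X X] power2_eq_square)
  then show "(\<Sum>i\<in>Basis. (4 * c\<^sup>2 * (X \<bullet> i)\<^sup>2 / s\<^sup>2 + 2 * c / s) * gaussian c X s) =
           (4 * c\<^sup>2 * (X \<bullet> X) / s\<^sup>2 + 2 * c * real DIM('a) / s) * gaussian c X s"
    by (simp add: sum_distrib_right[symmetric] sum.distrib sum_divide_distrib[symmetric] sum_distrib_left[symmetric] algebra_simps)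
qed

subsection \<open>Nonlinear diffusion above a graph\<close>

locale diffusivity =
  fixes \<phi> \<phi>' \<phi>'' :: "real \<Rightarrow> real" and \<delta>1 \<delta>2 :: real
  assumes \<phi>_deriv: "\<And>s. (\<phi> has_real_derivative \<phi>' s) (at s)"
    and \<phi>_deriv2: "\<And>s. (\<phi>' has_real_derivative \<phi>'' s) (at s)"
    and \<phi>_C2: "continuous_on UNIV \<phi>''"
    and \<phi>_0: "\<phi> 0 = 0"
    and \<delta>: "0 < \<delta>1"
    and \<phi>_bounds: "\<And>s. \<delta>1 \<le> \<phi>' s \<and> \<phi>' s \<le> \<delta>2"
begin

lemma \<delta>2: "0 < \<delta>2"
  using \<delta> \<phi>_bounds[of 0] by linarith

lemma \<phi>'_pos: "0 < \<phi>' s"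
  using \<delta> \<phi>_bounds[of s] by linarith

lemma \<phi>_cont: "continuous_on S \<phi>" "continuous_on S \<phi>'" "isCont \<phi> x" "isCont \<phi>' x"
  using \<phi>_deriv \<phi>_deriv2 DERIV_isCont by (blast intro: continuous_at_imp_continuous_on)+

lemma \<phi>_diff:
  assumes "x \<le> y"
  shows "\<delta>1 * (y - x) \<le> \<phi> y - \<phi> x" "\<phi> y - \<phi> x \<le> \<delta>2 * (y - x)"
proof -
  have "\<delta>1 * (y - x) \<le> \<phi> y - \<phi> x \<and> \<phi> y - \<phi> x \<le> \<delta>2 * (y - x)"
  proof (cases "x = y")
    case False
    then obtain c where "\<phi> y - \<phi> x = (y - x) * \<phi>' c"
      using MVT2[of x y \<phi> \<phi>'] \<phi>_deriv assms by force
    moreover have "\<delta>1 * (y - x) \<le> \<phi>' c * (y - x)" "\<phi>' c * (y - x) \<le> \<delta>2 * (y - x)"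
      using \<phi>_bounds[of c] assms by (auto intro!: mult_right_mono)
    ultimately show ?thesis by (simp add: mult.commute)
  qed simp
  then show "\<delta>1 * (y - x) \<le> \<phi> y - \<phi> x" "\<phi> y - \<phi> x \<le> \<delta>2 * (y - x)" by auto
qed

lemma \<phi>_less_iff: "\<phi> x < \<phi> y \<longleftrightarrow> x < y"
proof -
  have "x < y \<Longrightarrow> \<phi> x < \<phi> y" for x y
    using \<phi>_diff(1)[of x y] mult_pos_pos[of \<delta>1 "y - x"] \<delta> by (smt (verit))
  then show ?thesis by (metis linorder_less_linear order_less_asym)
qed

lemma \<phi>_le_iff: "\<phi> x \<le> \<phi> y \<longleftrightarrow> x \<le> y"
  using \<phi>_less_iff[of y x] by (simp add: not_less[symmetric])

lemma \<phi>_surj: "surj \<phi>"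
proof -
  have "\<exists>x. \<phi> x = y" for y
  proof -
    define r where "r = \<bar>y\<bar> / \<delta>1"
    have r: "r \<ge> 0" using \<delta> by (simp add: r_def)
    have "\<phi> (- r) \<le> y" "y \<le> \<phi> r"
      using \<phi>_diff(1)[of 0 r] \<phi>_diff(1)[of "-r" 0] r \<delta> \<phi>_0 by (auto simp: r_def)
    then show ?thesis using IVT'[of \<phi> "-r" y r] \<phi>_cont(1) r by auto
  qed
  then show ?thesis by (metis surjI)
qed

text \<open>Barriers are explicit in the variable \<phi>(U), on which the spatial operator is the
  Laplacian; \<beta> carries them back to the density.\<close>

definition \<beta> :: "real \<Rightarrow> real" where
  "\<beta> = inv \<phi>"

lemma \<phi>_\<beta>: "\<phi> (\<beta> y) = y"
  unfolding \<beta>_def by (rule surj_f_inv_f[OF \<phi>_surj])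

lemma \<beta>_\<phi>: "\<beta> (\<phi> x) = x"
  using \<phi>_\<beta>[of "\<phi> x"] \<phi>_le_iff by (metis order_antisym order_refl)

lemma \<beta>_deriv: "(\<beta> has_real_derivative 1 / \<phi>' (\<beta> y)) (at y)"
proof -
  have "isCont \<beta> (\<phi> (\<beta> y))"
    by (rule isCont_inverse_function[of 1 _ \<beta> \<phi>]) (auto simp: \<beta>_\<phi> \<phi>_cont)
  then have "isCont \<beta> y" by (simp add: \<phi>_\<beta>)
  then have "(\<beta> has_real_derivative inverse (\<phi>' (\<beta> y))) (at y)"
    using \<phi>'_pos[of "\<beta> y"]
    by (intro DERIV_inverse_function[where f = \<phi> and a = "y - 1" and b = "y + 1"]) (auto simp: \<phi>_\<beta> \<phi>_deriv)
  then show ?thesis by (simp add: inverse_eq_divide)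
qed

lemma \<beta>_cont: "continuous_on S \<beta>" "isCont \<beta> x"
  using \<beta>_deriv DERIV_isCont by (blast intro: continuous_at_imp_continuous_on)+

lemma \<beta>_le_iff: "\<beta> x \<le> \<beta> y \<longleftrightarrow> x \<le> y"
  using \<phi>_le_iff[of "\<beta> x" "\<beta> y"] by (simp add: \<phi>_\<beta>)

lemma \<beta>_less_iff: "\<beta> x < \<beta> y \<longleftrightarrow> x < y"
  using \<phi>_less_iff[of "\<beta> x" "\<beta> y"] by (simp add: \<phi>_\<beta>)

lemma \<beta>_0: "\<beta> 0 = 0"
  using \<beta>_\<phi>[of 0] by (simp add: \<phi>_0)

lemma \<beta>_diff:
  assumes "x \<le> y"
  shows "\<beta> y - \<beta> x \<le> (y - x) / \<delta>1"
  using \<phi>_diff(1)[of "\<beta> x" "\<beta> y"] assms \<delta> by (simp add: \<phi>_\<beta> \<beta>_le_iff field_simps)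

text \<open>Written as u_t = Laplacian p with p = \<phi>(u), the equation is linear in the pair (u,
  p), so differences fall under \<open>local_comparison\<close>. The bounds on \<phi>' make u1 - u2
  and p1 - p2 comparable with the constant max of \<delta>2 and 1 / \<delta>1, and monotonicity of
  \<phi> gives them the same sign.\<close>

lemma comparison:
  fixes E :: "'a::euclidean_space set"
  assumes E: "open E"
    and p1: "c21 E p1 p1t p1x p1xx" and p2: "c21 E p2 p2t p2x p2xx"
    and u1c: "continuous_on (E \<times> {0<..}) (\<lambda>(X, t). u1 X t)" "continuous_on (E \<times> {0<..}) (\<lambda>(X, t). u1t X t)"
    and u2c: "continuous_on (E \<times> {0<..}) (\<lambda>(X, t). u2 X t)" "continuous_on (E \<times> {0<..}) (\<lambda>(X, t). u2t X t)"
    and u1d: "\<And>X t. X \<in> E \<Longrightarrow> t > 0 \<Longrightarrow> (u1 X has_real_derivative u1t X t) (at t)"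
    and u2d: "\<And>X t. X \<in> E \<Longrightarrow> t > 0 \<Longrightarrow> (u2 X has_real_derivative u2t X t) (at t)"
    and pu: "\<And>X t. X \<in> E \<Longrightarrow> t > 0 \<Longrightarrow> p1 X t = \<phi> (u1 X t)" "\<And>X t. X \<in> E \<Longrightarrow> t > 0 \<Longrightarrow> p2 X t = \<phi> (u2 X t)"
    and sub: "\<And>X t. X \<in> E \<Longrightarrow> t > 0 \<Longrightarrow> u1t X t \<le> (\<Sum>i\<in>Basis. p1xx i X t)"
    and super: "\<And>X t. X \<in> E \<Longrightarrow> t > 0 \<Longrightarrow> (\<Sum>i\<in>Basis. p2xx i X t) \<le> u2t X t"
    and M: "\<And>X t. X \<in> E \<Longrightarrow> t > 0 \<Longrightarrow> u1 X t - u2 X t \<le> M"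
    and bdry: "\<And>X (t::real). X \<notin> E \<Longrightarrow> t > 0 \<Longrightarrow> \<exists>e>0. \<forall>Y\<in>ball X e \<inter> E. \<forall>s\<in>ball t e. s > 0 \<longrightarrow> u1 Y s \<le> u2 Y s"
    and init: "\<And>K. compact K \<Longrightarrow>
      ((\<lambda>t. \<integral>\<^sup>+X. ennreal (u1 X t - u2 X t) * indicator (K \<inter> E) X \<partial>lborel) \<longlongrightarrow> 0) (at_right 0)"
    and X: "X \<in> E" "t > 0"
  shows "u1 X t \<le> u2 X t"
proof -
  define C where "C = max \<delta>2 (1 / \<delta>1)"
  have C: "C > 0" "\<delta>2 \<le> C" "1 / \<delta>1 \<le> C" using \<delta>2 by (auto simp: C_def less_max_iff_disj)
  interpret local_comparison E "\<lambda>X t. p1 X t - p2 X t" "\<lambda>X t. p1t X t - p2t X t"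
    "\<lambda>X t. u1 X t - u2 X t" "\<lambda>X t. u1t X t - u2t X t" "\<lambda>i X t. p1x i X t - p2x i X t"
    "\<lambda>i X t. p1xx i X t - p2xx i X t" C "\<delta>2 * max 0 M + 1"
  proof
    show "open E" by (rule E)
    show "c21 E (\<lambda>X t. p1 X t - p2 X t) (\<lambda>X t. p1t X t - p2t X t) (\<lambda>i X t. p1x i X t - p2x i X t)
        (\<lambda>i X t. p1xx i X t - p2xx i X t)"
      by (rule c21_diff[OF p1 p2])
    show "continuous_on (E \<times> {0<..}) (\<lambda>(X, t). u1 X t - u2 X t)"
      "continuous_on (E \<times> {0<..}) (\<lambda>(X, t). u1t X t - u2t X t)"
      using u1c u2c unfolding split_beta by (auto intro!: continuous_intros)
    show "C > 0" by (rule C)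
    show "\<delta>2 * max 0 M + 1 > 0" using \<delta>2 by (simp add: add_nonneg_pos)
    fix X and t :: real
    {
      assume X: "X \<in> E" and t: "(0::real) < t"
      show "((\<lambda>t. u1 X t - u2 X t) has_real_derivative u1t X t - u2t X t) (at t)"
        by (intro DERIV_diff u1d u2d X t)
      show "u1t X t - u2t X t \<le> (\<Sum>i\<in>Basis. p1xx i X t - p2xx i X t)"
        using sub[OF X t] super[OF X t] by (simp add: sum_subtractf)
      show "u1 X t - u2 X t \<le> 0" if "p1 X t - p2 X t \<le> 0"
        using that pu[OF X t] \<phi>_le_iff by simp
      have *: "p1 X t - p2 X t \<le> \<delta>2 * (u1 X t - u2 X t) \<and> \<delta>1 * (u1 X t - u2 X t) \<le> p1 X t - p2 X t \<and> u1 X t > u2 X t"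
        if "p1 X t - p2 X t > 0"
        using that pu[OF X t] \<phi>_less_iff[of "u2 X t" "u1 X t"] \<phi>_diff[of "u2 X t" "u1 X t"] by simp
      show "p1 X t - p2 X t \<le> C * (u1 X t - u2 X t) \<and> u1 X t - u2 X t \<le> C * (p1 X t - p2 X t)"
        if pos: "p1 X t - p2 X t > 0"
      proof
        have "\<delta>2 * (u1 X t - u2 X t) \<le> C * (u1 X t - u2 X t)" using *[OF pos] C by (intro mult_right_mono) auto
        then show "p1 X t - p2 X t \<le> C * (u1 X t - u2 X t)" using *[OF pos] by linarith
        have "u1 X t - u2 X t \<le> 1 / \<delta>1 * (p1 X t - p2 X t)" using *[OF pos] \<delta> by (simp add: field_simps)
        also have "\<dots> \<le> C * (p1 X t - p2 X t)" using pos C by (intro mult_right_mono) auto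
        finally show "u1 X t - u2 X t \<le> C * (p1 X t - p2 X t)" .
      qed
      show "p1 X t - p2 X t \<le> \<delta>2 * max 0 M + 1"
      proof (cases "p1 X t - p2 X t > 0")
        case True
        have "\<delta>2 * (u1 X t - u2 X t) \<le> \<delta>2 * max 0 M" using M[OF X t] \<delta>2 by (intro mult_left_mono) auto
        then show ?thesis using *[OF True] by linarith
      next
        case False
        have "0 \<le> \<delta>2 * max 0 M" using \<delta>2 by simp
        then show ?thesis using False by linarith
      qed
    }
    assume "X \<notin> E" "0 < t"
    then obtain e where e: "e > 0" "\<forall>Y\<in>ball X e \<inter> E. \<forall>s\<in>ball t e. s > 0 \<longrightarrow> u1 Y s \<le> u2 Y s"
      using bdry by blast
    have "\<forall>Y\<in>ball X e \<inter> E. \<forall>s\<in>ball t e. s > 0 \<longrightarrow> p1 Y s - p2 Y s \<le> 0"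
      using e(2) pu \<phi>_le_iff by auto
    then show "\<exists>e>0. \<forall>Y\<in>ball X e \<inter> E. \<forall>s\<in>ball t e. s > 0 \<longrightarrow> p1 Y s - p2 Y s \<le> 0"
      using e(1) by blast
  qed
  show ?thesis using nonpositive[OF init X] by simp
qed

lemma \<beta>_time:
  assumes b: "c21 E b bt bx bxx"
  shows "continuous_on (E \<times> {0<..}) (\<lambda>(X, t). \<beta> (b X t))"
    "continuous_on (E \<times> {0<..}) (\<lambda>(X, t). bt X t / \<phi>' (\<beta> (b X t)))"
    "\<And>X t. X \<in> E \<Longrightarrow> t > 0 \<Longrightarrow> ((\<lambda>t. \<beta> (b X t)) has_real_derivative bt X t / \<phi>' (\<beta> (b X t))) (at t)"
proof -
  have c: "continuous_on (E \<times> {0<..}) (\<lambda>(X, t). b X t)" "continuous_on (E \<times> {0<..}) (\<lambda>(X, t). bt X t)"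
    using b by (auto simp: c21_def)
  show c1: "continuous_on (E \<times> {0<..}) (\<lambda>(X, t). \<beta> (b X t))"
    using continuous_on_compose2[OF \<beta>_cont(1)[of UNIV] c(1)] by (simp add: split_beta)
  have "continuous_on (E \<times> {0<..}) (\<lambda>(X, t). \<phi>' (\<beta> (b X t)))"
    using continuous_on_compose2[OF \<phi>_cont(2)[of UNIV] c1] by (simp add: split_beta)
  then show "continuous_on (E \<times> {0<..}) (\<lambda>(X, t). bt X t / \<phi>' (\<beta> (b X t)))"
    using c(2) \<phi>'_pos unfolding split_beta by (intro continuous_on_divide) (auto simp: less_imp_neq[THEN not_sym])
  show "((\<lambda>t. \<beta> (b X t)) has_real_derivative bt X t / \<phi>' (\<beta> (b X t))) (at t)" if "X \<in> E" "t > 0" for X t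
    using DERIV_chain'[of "b X" "bt X t" t UNIV \<beta>, OF _ \<beta>_deriv] b that by (simp add: c21_def)
qed

end

text \<open>D is \<Omega> for the initial-boundary value problem and the whole space for the Cauchy
  problem. The lateral value 1 is encoded in \<open>bc\<close> as a limit from inside, and one form
  of \<open>init\<close> covers both problems because the indicator vanishes in \<Omega>.\<close>

locale graph_diffusion = diffusivity +
  fixes f :: "real^'n \<Rightarrow> real" and \<Omega> D :: "((real^'n) \<times> real) set"
    and U Ut :: "(real^'n) \<times> real \<Rightarrow> real \<Rightarrow> real" and Ux Uxx :: "(real^'n) \<times> real \<Rightarrow> (real^'n) \<times> real \<Rightarrow> real \<Rightarrow> real"
  assumes f_cont: "continuous_on UNIV f"
    and \<Omega>: "\<Omega> = above_graph f"
    and D_cases: "D = \<Omega> \<or> D = UNIV"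
    and U_c21: "c21 D U Ut Ux Uxx"
    and U_bounded: "\<exists>M. \<forall>X\<in>D. \<forall>t>0. \<bar>U X t\<bar> \<le> M"
    and U_eq: "\<And>X t. X \<in> D \<Longrightarrow> t > 0 \<Longrightarrow>
       Ut X t = (\<Sum>i\<in>Basis. \<phi>'' (U X t) * (Ux i X t)\<^sup>2 + \<phi>' (U X t) * Uxx i X t)"
    and bc: "\<And>X t. X \<in> closure D \<Longrightarrow> X \<notin> D \<Longrightarrow> t > 0 \<Longrightarrow>
       ((\<lambda>(Y, s). U Y s) \<longlongrightarrow> 1) (at (X, t) within D \<times> {0<..})"
    and init: "initial_L1loc D U (indicator (- \<Omega>))"
begin

lemma mem_\<Omega>: "(x, s) \<in> \<Omega> \<longleftrightarrow> f x < s"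
  by (simp add: \<Omega> above_graph_def)

lemma open_\<Omega>: "open \<Omega>"
proof -
  have "\<Omega> = {p. f (fst p) < snd p}" by (auto simp: mem_\<Omega>)
  then show ?thesis by (auto intro!: open_Collect_less continuous_intros continuous_on_compose2[OF f_cont])
qed

lemma open_D: "open D" and \<Omega>_D: "\<Omega> \<subseteq> D"
  using D_cases open_\<Omega> by auto

definition v where "v X t = \<phi> (U X t)"
definition vt where "vt X t = \<phi>' (U X t) * Ut X t"
definition vx where "vx i X t = \<phi>' (U X t) * Ux i X t"
definition vxx where "vxx i X t = \<phi>'' (U X t) * (Ux i X t)\<^sup>2 + \<phi>' (U X t) * Uxx i X t"

lemma U_parts:
  shows U_cont: "continuous_on (D \<times> {0<..}) (\<lambda>(X, t). U X t)"
    and Ut_cont: "continuous_on (D \<times> {0<..}) (\<lambda>(X, t). Ut X t)"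
    and U_deriv: "X \<in> D \<Longrightarrow> t > 0 \<Longrightarrow> (U X has_real_derivative Ut X t) (at t)"
    and Ux_cont: "i \<in> Basis \<Longrightarrow> continuous_on (D \<times> {0<..}) (\<lambda>(X, t). Ux i X t)"
    and Uxx_cont: "i \<in> Basis \<Longrightarrow> continuous_on (D \<times> {0<..}) (\<lambda>(X, t). Uxx i X t)"
    and Ux_deriv: "i \<in> Basis \<Longrightarrow> X \<in> D \<Longrightarrow> t > 0 \<Longrightarrow>
        ((\<lambda>h. U (X + h *\<^sub>R i) t) has_real_derivative Ux i X t) (at 0)"
    and Uxx_deriv: "i \<in> Basis \<Longrightarrow> X \<in> D \<Longrightarrow> t > 0 \<Longrightarrow>
        ((\<lambda>h. Ux i (X + h *\<^sub>R i) t) has_real_derivative Uxx i X t) (at 0)"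
  using U_c21 unfolding c21_def by auto

lemma v_c21: "c21 D v vt vx vxx"
proof -
  have [continuous_intros]: "continuous_on S (\<lambda>x. \<phi> (g x))" "continuous_on S (\<lambda>x. \<phi>' (g x))" "continuous_on S (\<lambda>x. \<phi>'' (g x))"
    if "continuous_on S g" for g and S :: "(((real^'n) \<times> real) \<times> real) set"
    using continuous_on_compose2[OF \<phi>_cont(1)[of UNIV] that] continuous_on_compose2[OF \<phi>_cont(2)[of UNIV] that]
      continuous_on_compose2[OF \<phi>_C2 that] by auto
  show ?thesis
    unfolding c21_def
  proof (intro conjI ballI allI impI)
    show "continuous_on (D \<times> {0<..}) (\<lambda>(X, t). v X t)" "continuous_on (D \<times> {0<..}) (\<lambda>(X, t). vt X t)"
      using U_cont Ut_cont unfolding v_def vt_def split_beta by (auto intro!: continuous_intros)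
    show "(v X has_real_derivative vt X t) (at t)" if "X \<in> D" "t > 0" for X t
      using DERIV_chain'[OF U_deriv[OF that] \<phi>_deriv] unfolding v_def[abs_def] vt_def .
    fix i :: "(real^'n) \<times> real" assume i: "i \<in> Basis"
    show "continuous_on (D \<times> {0<..}) (\<lambda>(X, t). vx i X t)" "continuous_on (D \<times> {0<..}) (\<lambda>(X, t). vxx i X t)"
      using U_cont Ux_cont[OF i] Uxx_cont[OF i] unfolding vx_def vxx_def split_beta
      by (auto intro!: continuous_intros)
    fix X t assume X: "X \<in> D" and t: "(0::real) < t"
    have 1: "((\<lambda>h. \<phi>' (U (X + h *\<^sub>R i) t)) has_real_derivative \<phi>'' (U X t) * Ux i X t) (at 0)"
      using DERIV_chain'[OF Ux_deriv[OF i X t] \<phi>_deriv2] by simp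
    show "((\<lambda>h. v (X + h *\<^sub>R i) t) has_real_derivative vx i X t) (at 0)"
      using DERIV_chain'[OF Ux_deriv[OF i X t] \<phi>_deriv] by (simp add: v_def vx_def)
    show "((\<lambda>h. vx i (X + h *\<^sub>R i) t) has_real_derivative vxx i X t) (at 0)"
      using DERIV_mult[OF 1 Uxx_deriv[OF i X t]] by (simp add: vx_def vxx_def power2_eq_square algebra_simps)
  qed
qed

lemma Ut_eq: "X \<in> D \<Longrightarrow> t > 0 \<Longrightarrow> Ut X t = (\<Sum>i\<in>Basis. vxx i X t)"
  by (simp add: U_eq vxx_def)

lemma vt_eq: "X \<in> D \<Longrightarrow> t > 0 \<Longrightarrow> vt X t = \<phi>' (U X t) * (\<Sum>i\<in>Basis. vxx i X t)"
  by (simp add: vt_def Ut_eq)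

lemma near_boundary:
  assumes "X \<notin> D" "t > 0" "c < 1" "1 < d"
  shows "\<exists>e>0. \<forall>Y\<in>ball X e \<inter> D. \<forall>s\<in>ball t e. s > 0 \<longrightarrow> c < U Y s \<and> U Y s < d"
proof (cases "X \<in> closure D")
  case False
  then obtain e where e: "e > 0" "ball X e \<subseteq> - closure D"
    using open_contains_ball[of "- closure D"] by (auto simp: open_Compl)
  then have "ball X e \<inter> D = {}" using closure_subset[of D] by auto
  then show ?thesis using e(1) by blast
next
  case True
  note lim = bc[OF True assms(1,2)]
  have "\<forall>\<^sub>F q in at (X, t) within D \<times> {0<..}. c < (\<lambda>(Y, s). U Y s) q \<and> (\<lambda>(Y, s). U Y s) q < d"
    using order_tendstoD[OF lim] assms by (intro eventually_conj) auto
  then obtain e where e: "e > 0" "\<And>q. q \<in> D \<times> {0<..} \<Longrightarrow> q \<noteq> (X, t) \<Longrightarrow> dist q (X, t) < e \<Longrightarrow>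
      c < (\<lambda>(Y, s). U Y s) q \<and> (\<lambda>(Y, s). U Y s) q < d"
    unfolding eventually_at by auto
  show ?thesis
  proof (intro exI[of _ "e/2"] conjI ballI impI)
    show "e / 2 > 0" using e by simp
    fix Y s assume Y: "Y \<in> ball X (e/2) \<inter> D" and s: "s \<in> ball t (e/2)" "0 < s"
    have "dist (Y, s) (X, t) \<le> dist Y X + dist s t"
      unfolding dist_Pair_Pair by (rule sqrt_sum_squares_le_sum) auto
    also have "\<dots> < e" using Y s by (auto simp: dist_commute)
    finally have "dist (Y, s) (X, t) < e" .
    then show "c < U Y s" "U Y s < d" using e(2)[of "(Y, s)"] Y s assms(1) by auto
  qed
qed

lemma init_bounded:
  obtains c where "\<And>X t. X \<in> D \<Longrightarrow> t > 0 \<Longrightarrow> \<bar>U X t - indicator (- \<Omega>) X\<bar> \<le> c"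
    "\<And>X t. X \<in> D \<Longrightarrow> t > 0 \<Longrightarrow> \<bar>U X t\<bar> \<le> c"
proof -
  obtain M where M: "\<And>X t. X \<in> D \<Longrightarrow> t > 0 \<Longrightarrow> \<bar>U X t\<bar> \<le> M" using U_bounded by blast
  show ?thesis
  proof (rule that[of "M + 1"])
    fix X t assume "X \<in> D" "(0::real) < t"
    then show "\<bar>U X t - indicator (- \<Omega>) X\<bar> \<le> M + 1" "\<bar>U X t\<bar> \<le> M + 1"
      using M[of X t] by (auto simp: indicator_def)
  qed
qed

lemma init_limit:
  assumes "compact K"
  shows "((\<lambda>t. \<integral>\<^sup>+X. ennreal \<bar>U X t - indicator (- \<Omega>) X\<bar> * indicator (K \<inter> D) X \<partial>lborel) \<longlongrightarrow> 0) (at_right 0)"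
proof -
  obtain c where "\<And>X t. X \<in> D \<Longrightarrow> t > 0 \<Longrightarrow> \<bar>U X t - indicator (- \<Omega>) X\<bar> \<le> c"
    using init_bounded by metis
  then show ?thesis by (rule initial_L1loc_up_to_boundary[OF open_D init _ assms])
qed

lemma init_limit_mono:
  assumes K: "compact K" and E: "E \<subseteq> D"
    and w: "\<And>X t. X \<in> E \<Longrightarrow> t > 0 \<Longrightarrow> w X t \<le> \<bar>U X t - indicator (- \<Omega>) X\<bar>"
  shows "((\<lambda>t. \<integral>\<^sup>+X. ennreal (w X t) * indicator (K \<inter> E) X \<partial>lborel) \<longlongrightarrow> 0) (at_right 0)"
proof (rule tendsto_sandwich[OF _ _ tendsto_const init_limit[OF K]])
  show "\<forall>\<^sub>F t in at_right 0. (\<integral>\<^sup>+X. ennreal (w X t) * indicator (K \<inter> E) X \<partial>lborel)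
      \<le> (\<integral>\<^sup>+X. ennreal \<bar>U X t - indicator (- \<Omega>) X\<bar> * indicator (K \<inter> D) X \<partial>lborel)"
    by (rule eventually_mono[OF eventually_at_right_less], rule nn_integral_mono)
      (use w E in \<open>auto simp: indicator_def intro!: ennreal_leI\<close>)
qed auto

section \<open>Bounds for U and monotonicity under shifts\<close>

lemma U_range:
  assumes X: "X \<in> D" "t > 0"
  shows "0 \<le> U X t" "U X t \<le> 1"
proof -
  obtain c where c: "\<And>X t. X \<in> D \<Longrightarrow> t > 0 \<Longrightarrow> \<bar>U X t\<bar> \<le> c" using init_bounded by metis
  \<comment> \<open>The slack e is for the lateral boundary, where U tends to 1 but could so far
    approach it from above.\<close>
  have "U X t \<le> 1 + e" if e: "e > 0" for e
  proof (rule comparison[where ?u1.0 = U and ?u1t = Ut and ?u2.0 = "\<lambda>X t. 1 + e" and ?u2t = "\<lambda>X t. 0"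
        and M = c, OF open_D v_c21 c21_const[where k = "\<phi> (1 + e)"]])
    show "\<exists>r>0. \<forall>Y\<in>ball X r \<inter> D. \<forall>s\<in>ball t r. 0 < s \<longrightarrow> U Y s \<le> 1 + e" if "X \<notin> D" "0 < t" for X t
      using near_boundary[OF that, of 0 "1 + e"] e by (auto intro: less_imp_le)
    show "((\<lambda>t. \<integral>\<^sup>+ X. ennreal (U X t - (1 + e)) * indicator (K \<inter> D) X \<partial>lborel) \<longlongrightarrow> 0) (at_right 0)"
      if "compact K" for K
      using e by (intro init_limit_mono[OF that order_refl]) (auto simp: indicator_def)
    show "U X t - (1 + e) \<le> c" if "X \<in> D" "t > 0" for X t using c[OF that] e by (simp add: abs_le_iff)
  qed (use U_cont Ut_cont U_deriv X e in \<open>auto simp: v_def Ut_eq\<close>)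
  then show "U X t \<le> 1" by (rule field_le_epsilon)
  have "- e \<le> U X t" if e: "e > 0" for e
  proof (rule comparison[where ?u2.0 = U and ?u2t = Ut and ?u1.0 = "\<lambda>X t. - e" and ?u1t = "\<lambda>X t. 0"
        and M = c, OF open_D c21_const[where k = "\<phi> (- e)"] v_c21])
    show "\<exists>r>0. \<forall>Y\<in>ball X r \<inter> D. \<forall>s\<in>ball t r. 0 < s \<longrightarrow> - e \<le> U Y s" if "X \<notin> D" "0 < t" for X t
      using near_boundary[OF that, of "- e" 2] e by (auto intro: less_imp_le)
    show "((\<lambda>t. \<integral>\<^sup>+ X. ennreal (- e - U X t) * indicator (K \<inter> D) X \<partial>lborel) \<longlongrightarrow> 0) (at_right 0)"
      if "compact K" for K
      using e by (intro init_limit_mono[OF that order_refl]) (auto simp: indicator_def)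
    show "- e - U X t \<le> c" if "X \<in> D" "t > 0" for X t using c[OF that] e by (simp add: abs_le_iff)
  qed (use U_cont Ut_cont U_deriv X e in \<open>auto simp: v_def Ut_eq\<close>)
  then have "0 \<le> U X t + e" if "e > 0" for e using that by fastforce
  then show "0 \<le> U X t" by (rule field_le_epsilon)
qed

lemma v_range: "X \<in> D \<Longrightarrow> t > 0 \<Longrightarrow> 0 \<le> v X t" "X \<in> D \<Longrightarrow> t > 0 \<Longrightarrow> v X t \<le> \<phi> 1"
  using U_range \<phi>_le_iff[of 0] \<phi>_le_iff[of _ 1] by (auto simp: v_def \<phi>_0)

lemma \<phi>_1_pos: "\<phi> 1 > 0"
  using \<phi>_less_iff[of 0 1] \<phi>_0 by simp

text \<open>A paraboloid rising linearly in time is a supersolution for every diffusivity up to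
  \<delta>2. The bound has two uses: it starts the proof that U < 1 in \<Omega>, and it makes U
  small inside \<Omega> at short times, where the diffusivity is then close to \<phi>'(0).\<close>

lemma v_linear_bound:
  assumes e: "e > 0" and sub: "cball Q e \<subseteq> \<Omega>" and t: "t > 0"
  shows "v Q t \<le> 4 * \<phi> 1 * \<delta>2 * real DIM((real^'n) \<times> real) / e\<^sup>2 * t"
proof -
  define n where "n = real DIM((real^'n) \<times> real)"
  \<comment> \<open>The factor 2 makes the barrier exceed \<phi>(1), an upper bound of v, not only
    on the sphere of radius e but in a neighbourhood of each of its points.\<close>
  define m where "m = 2 * \<phi> 1 / e\<^sup>2"
  have m: "m > 0" using \<phi>_1_pos e by (simp add: m_def)
  define b where "b X t = m * ((X - Q) \<bullet> (X - Q)) + m * 2 * n * \<delta>2 * t" for X t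
  have bc21: "c21 (ball Q e) b (\<lambda>X t. m * 2 * n * \<delta>2) (\<lambda>i X t. m * 2 * ((X - Q) \<bullet> i)) (\<lambda>i X t. m * 2)"
  proof -
    have "((\<lambda>h. m * ((X + h *\<^sub>R i - Q) \<bullet> (X + h *\<^sub>R i - Q)) + m * 2 * n * \<delta>2 * t) has_real_derivative m * 2 * ((X - Q) \<bullet> i)) (at 0)"
      if "i \<in> Basis" for i X t
    proof -
      have "(\<lambda>h. m * ((X + h *\<^sub>R i - Q) \<bullet> (X + h *\<^sub>R i - Q)) + m * 2 * n * \<delta>2 * t) =
        (\<lambda>h. m * ((X - Q) \<bullet> (X - Q) + 2 * h * ((X - Q) \<bullet> i) + h * h) + m * 2 * n * \<delta>2 * t)"
        using that by (auto simp: fun_eq_iff inner_same_Basis algebra_simps inner_commute)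
      then show ?thesis by (auto intro!: derivative_eq_intros)
    qed
    moreover have "((\<lambda>h. m * 2 * ((X + h *\<^sub>R i - Q) \<bullet> i)) has_real_derivative m * 2) (at 0)" if "i \<in> Basis" for i X
      using that by (auto simp: inner_add_left inner_diff_left inner_same_Basis intro!: derivative_eq_intros)
    ultimately show ?thesis
      unfolding c21_def b_def split_beta
      by (auto intro!: continuous_intros derivative_eq_intros)
  qed
  have b_nn: "0 \<le> b X t" if "t > 0" for X t
    using m \<delta>2 that unfolding b_def n_def by (intro add_nonneg_nonneg mult_nonneg_nonneg) auto
  have subD: "ball Q e \<subseteq> D" using ball_subset_cball sub \<Omega>_D by blast
  have "U Q t \<le> \<beta> (b Q t)"
  proof (rule comparison[where ?u1.0 = U and ?u1t = Ut and ?u2.0 = "\<lambda>X t. \<beta> (b X t)"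
        and ?u2t = "\<lambda>X t. m * 2 * n * \<delta>2 / \<phi>' (\<beta> (b X t))" and M = 1,
        OF open_ball c21_mono[OF v_c21 subD] bc21])
    note \<beta>_time[OF bc21]
    then show "continuous_on (ball Q e \<times> {0<..}) (\<lambda>(X, t). \<beta> (b X t))"
      "continuous_on (ball Q e \<times> {0<..}) (\<lambda>(X, t). m * 2 * n * \<delta>2 / \<phi>' (\<beta> (b X t)))"
      "\<And>X t. X \<in> ball Q e \<Longrightarrow> 0 < t \<Longrightarrow> ((\<lambda>t. \<beta> (b X t)) has_real_derivative m * 2 * n * \<delta>2 / \<phi>' (\<beta> (b X t))) (at t)"
      by auto
    show "continuous_on (ball Q e \<times> {0<..}) (\<lambda>(X, t). U X t)" "continuous_on (ball Q e \<times> {0<..}) (\<lambda>(X, t). Ut X t)"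
      using U_cont Ut_cont subD by (auto elim!: continuous_on_subset)
    show "(\<Sum>i\<in>(Basis :: ((real^'n) \<times> real) set). m * 2) \<le> m * 2 * n * \<delta>2 / \<phi>' (\<beta> (b X t))" for X t
    proof -
      have "m * 2 * n * \<phi>' (\<beta> (b X t)) \<le> m * 2 * n * \<delta>2"
        using \<phi>_bounds m by (intro mult_left_mono) (auto simp: n_def)
      then show ?thesis using \<phi>'_pos[of "\<beta> (b X t)"] by (simp add: n_def pos_le_divide_eq mult_ac)
    qed
    have \<beta>nn: "0 \<le> \<beta> (b X t)" if "t > 0" for X t using b_nn[OF that] \<beta>_le_iff[of 0] by (simp add: \<beta>_0)
    show "U X t - \<beta> (b X t) \<le> 1" if "X \<in> ball Q e" "0 < t" for X t
      using U_range(2)[of X t] subD that \<beta>nn[of t X] by auto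
    show "((\<lambda>t. \<integral>\<^sup>+ X. ennreal (U X t - \<beta> (b X t)) * indicator (K \<inter> ball Q e) X \<partial>lborel) \<longlongrightarrow> 0) (at_right 0)"
      if "compact K" for K
    proof (rule init_limit_mono[OF that subD])
      fix X t assume X: "X \<in> ball Q e" "(0::real) < t"
      then have "X \<in> \<Omega>" using sub by auto
      then show "U X t - \<beta> (b X t) \<le> \<bar>U X t - indicator (- \<Omega>) X\<bar>" using \<beta>nn[OF X(2), of X] by simp
    qed
    show "\<exists>r>0. \<forall>Y\<in>ball X r \<inter> ball Q e. \<forall>s\<in>ball t r. 0 < s \<longrightarrow> U Y s \<le> \<beta> (b Y s)" if X: "X \<notin> ball Q e" "0 < t" for X t
    proof -
      have "isCont (\<lambda>Y. m * ((Y - Q) \<bullet> (Y - Q))) X" by (intro continuous_intros)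
      then have lim: "((\<lambda>Y. m * ((Y - Q) \<bullet> (Y - Q))) \<longlongrightarrow> m * ((X - Q) \<bullet> (X - Q))) (at X)" by (simp add: isCont_def)
      have "e\<^sup>2 \<le> (X - Q) \<bullet> (X - Q)"
        using X power_mono[of e "norm (X - Q)" 2] e by (simp add: power2_norm_eq_inner dist_norm norm_minus_commute[of Q X])
      then have "m * e\<^sup>2 \<le> m * ((X - Q) \<bullet> (X - Q))" using m by (intro mult_left_mono) auto
      then have gt: "\<phi> 1 < m * ((X - Q) \<bullet> (X - Q))" using \<phi>_1_pos e by (simp add: m_def)
      obtain r where r: "r > 0" "\<And>Y. Y \<noteq> X \<Longrightarrow> dist Y X < r \<Longrightarrow> \<phi> 1 < m * ((Y - Q) \<bullet> (Y - Q))"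
        using order_tendstoD(1)[OF lim gt] unfolding eventually_at by auto
      show ?thesis
      proof (intro exI[of _ r] conjI ballI impI)
        fix Y s assume Y: "Y \<in> ball X r \<inter> ball Q e" and s: "s \<in> ball t r" "0 < s"
        have "\<phi> 1 < m * ((Y - Q) \<bullet> (Y - Q))" using r(2)[of Y] Y gt by (cases "Y = X") (auto simp: dist_commute)
        moreover have "0 \<le> m * 2 * n * \<delta>2 * s" using m \<delta>2 s by (simp add: n_def)
        ultimately have "\<phi> 1 \<le> b Y s" unfolding b_def by linarith
        then have "1 \<le> \<beta> (b Y s)" using \<beta>_le_iff[of "\<phi> 1" "b Y s"] by (simp add: \<beta>_\<phi>)
        then show "U Y s \<le> \<beta> (b Y s)" using U_range(2)[of Y s] Y subD s by auto
      qed (rule r)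
    qed
  qed (use U_deriv subD e t in \<open>auto simp: v_def Ut_eq \<phi>_\<beta>\<close>)
  then have "v Q t \<le> b Q t" using \<phi>_le_iff[of "U Q t" "\<beta> (b Q t)"] by (simp add: v_def \<phi>_\<beta>)
  then show ?thesis by (simp add: b_def m_def n_def mult_ac)
qed

text \<open>The linear bound gives v <= \<phi>(1) / 2 on a small ball at an early time t1;
  \<open>positivity_propagates\<close> with a resting centre carries the positivity of \<phi>(1) - v
  on to time t.\<close>

lemma U_less_1:
  assumes X: "X \<in> \<Omega>" and t: "t > 0"
  shows "U X t < 1"
proof -
  obtain e where e: "e > 0" "cball X e \<subseteq> \<Omega>" using open_\<Omega> X open_contains_cball by blast
  define r where "r = e / 2"
  have r: "r > 0" using e by (simp add: r_def)
  define A where "A = 4 * \<phi> 1 * \<delta>2 * real DIM((real^'n) \<times> real) / r\<^sup>2"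
  have A: "A > 0" using \<phi>_1_pos \<delta>2 r by (simp add: A_def)
  have sub: "cball Y r \<subseteq> \<Omega>" if "Y \<in> cball X r" for Y
  proof
    fix W assume "W \<in> cball Y r"
    then have "dist X W \<le> e" using that dist_triangle[of X W Y] by (simp add: r_def)
    then show "W \<in> \<Omega>" using e by auto
  qed
  define t1 where "t1 = min (t / 2) (\<phi> 1 / (2 * A))"
  have t1: "0 < t1" "t1 < t" "t1 \<le> \<phi> 1 / (2 * A)" using t A \<phi>_1_pos by (auto simp: t1_def)
  define S where "S = (\<lambda>(Y, s). Y + X + s *\<^sub>R (X - X)) ` (cball 0 r \<times> {0..1::real})"
  have S: "S \<subseteq> cball X r" by (auto simp: S_def dist_norm)
  have S\<Omega>: "S \<subseteq> D" using S sub[of X] r \<Omega>_D by auto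
  obtain \<kappa> where \<kappa>: "\<kappa> > 0"
    "\<And>D z zt zx zxx m. c21 D z zt zx zxx \<Longrightarrow> S \<subseteq> D \<Longrightarrow>
      (\<And>X s. X \<in> S \<Longrightarrow> t1 \<le> s \<Longrightarrow> s \<le> t \<Longrightarrow> 0 \<le> z X s) \<Longrightarrow>
      (\<And>X s. X \<in> S \<Longrightarrow> t1 \<le> s \<Longrightarrow> s \<le> t \<Longrightarrow>
         \<exists>a\<in>{\<delta>1..\<delta>2}. zt X s \<ge> a * (\<Sum>i\<in>Basis. zxx i X s) - 0 * z X s) \<Longrightarrow>
      m > 0 \<Longrightarrow> (\<And>Y. Y \<in> cball X r \<Longrightarrow> m \<le> z Y t1) \<Longrightarrow> \<kappa> * m \<le> z X t"
    using positivity_propagates[OF r t1(2,1) \<delta> order_refl S_def, of \<delta>2] by blast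
  have "\<kappa> * (\<phi> 1 / 2) \<le> \<phi> 1 - v X t"
  proof (rule \<kappa>(2))
    show "c21 D (\<lambda>X t. \<phi> 1 - v X t) (\<lambda>X t. 0 - vt X t) (\<lambda>i X t. 0 - vx i X t) (\<lambda>i X t. 0 - vxx i X t)"
      by (rule c21_diff[OF c21_const v_c21])
    show "S \<subseteq> D" by (rule S\<Omega>)
    show "0 \<le> \<phi> 1 - v Y s" if "Y \<in> S" "t1 \<le> s" for Y s using v_range(2)[of Y s] that S\<Omega> t1 by auto
    show "\<exists>a\<in>{\<delta>1..\<delta>2}. 0 - vt Y s \<ge> a * (\<Sum>i\<in>Basis. 0 - vxx i Y s) - 0 * (\<phi> 1 - v Y s)"
      if "Y \<in> S" "t1 \<le> s" for Y s
    proof (intro bexI[of _ "\<phi>' (U Y s)"])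
      have "Y \<in> D" "s > 0" using that S\<Omega> t1 by auto
      then show "0 - vt Y s \<ge> \<phi>' (U Y s) * (\<Sum>i\<in>Basis. 0 - vxx i Y s) - 0 * (\<phi> 1 - v Y s)"
        by (simp add: vt_eq sum_negf)
    qed (use \<phi>_bounds in auto)
    show "\<phi> 1 / 2 > 0" using \<phi>_1_pos by simp
    show "\<phi> 1 / 2 \<le> \<phi> 1 - v Y t1" if "Y \<in> cball X r" for Y
    proof -
      have "v Y t1 \<le> A * t1" using v_linear_bound[OF r sub[OF that] t1(1)] by (simp add: A_def)
      also have "\<dots> \<le> A * (\<phi> 1 / (2 * A))" using t1 A by (intro mult_left_mono) auto
      finally show ?thesis using A by simp
    qed
  qed
  moreover have "\<kappa> * (\<phi> 1 / 2) > 0" using \<kappa>(1) \<phi>_1_pos by simp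
  ultimately have "v X t < \<phi> 1" by linarith
  then show ?thesis by (simp add: v_def \<phi>_less_iff)
qed

lemma closure_\<Omega>:
  assumes "(x, s) \<in> closure \<Omega>"
  shows "f x \<le> s"
proof -
  have "closed {p. f (fst p) \<le> snd p}"
    by (auto intro!: closed_Collect_le continuous_intros continuous_on_compose2[OF f_cont])
  moreover have "\<Omega> \<subseteq> {p. f (fst p) \<le> snd p}" by (auto simp: mem_\<Omega>)
  ultimately have "closure \<Omega> \<subseteq> {p. f (fst p) \<le> snd p}" by (intro closure_minimal)
  then show ?thesis using assms by auto
qed

lemma U_slice_cont: "t > 0 \<Longrightarrow> continuous_on D (\<lambda>X. U X t)"
  using continuous_on_compose2[OF U_cont, of D "\<lambda>X. (X, t)"] by (simp add: image_subset_iff continuous_on_Pair)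

lemma init_integrand_measurable:
  assumes K: "compact K" and t: "t > 0"
  shows "(\<lambda>X. ennreal \<bar>U X t - indicator (- \<Omega>) X\<bar> * indicator (K \<inter> D) X) \<in> borel_measurable borel"
proof -
  have "(\<lambda>X. indicator D X *\<^sub>R U X t) \<in> borel_measurable borel"
    using borel_measurable_continuous_on_indicator[OF _ U_slice_cont[OF t]] open_D by simp
  moreover have "K \<in> sets borel" "D \<in> sets borel" "- \<Omega> \<in> sets borel"
    using compact_imp_closed[OF K] open_D open_\<Omega> by auto
  ultimately have "(\<lambda>X. ennreal \<bar>indicator D X *\<^sub>R U X t - indicator (- \<Omega>) X\<bar> * indicator (K \<inter> D) X) \<in> borel_measurable borel"
    by measurable
  also have "(\<lambda>X. ennreal \<bar>indicator D X *\<^sub>R U X t - indicator (- \<Omega>) X\<bar> * indicator (K \<inter> D) X) =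
      (\<lambda>X. ennreal \<bar>U X t - indicator (- \<Omega>) X\<bar> * indicator (K \<inter> D) X)"
    by (auto simp: fun_eq_iff indicator_def)
  finally show ?thesis .
qed

text \<open>
  An arbitrarily small additional upward shift separates the two boundaries, so that near the
  boundary of \<open>D\<close> the comparison holds strictly.
\<close>

lemma U_shift_strict:
  assumes \<xi>: "\<And>X. X \<in> closure \<Omega> \<Longrightarrow> X + \<xi> \<in> \<Omega>" and X: "X \<in> D" and t: "t > 0"
  shows "U (X + \<xi>) t \<le> U X t"
proof -
  have \<xi>D: "X + \<xi> \<in> D" if "X \<in> D" for X
    using D_cases \<xi>[of X] that closure_subset[of \<Omega>] by auto
  note tr = c21_translate[OF v_c21 \<xi>D] c21_translate[OF U_c21 \<xi>D]
  show ?thesis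
  proof (rule comparison[where ?u1.0 = "\<lambda>X. U (X + \<xi>)" and ?u1t = "\<lambda>X. Ut (X + \<xi>)" and ?u2.0 = U and ?u2t = Ut
        and M = 1, OF open_D tr(1) v_c21])
    show "continuous_on (D \<times> {0<..}) (\<lambda>(X, t). U (X + \<xi>) t)" "continuous_on (D \<times> {0<..}) (\<lambda>(X, t). Ut (X + \<xi>) t)"
      using tr(2) by (auto simp: c21_def)
    show "U (X + \<xi>) t - U X t \<le> 1" if "X \<in> D" "0 < t" for X t
      using U_range(2)[OF \<xi>D] U_range(1)[of X t] that by fastforce
    show "((\<lambda>t. \<integral>\<^sup>+ X. ennreal (U (X + \<xi>) t - U X t) * indicator (K \<inter> D) X \<partial>lborel) \<longlongrightarrow> 0) (at_right 0)"
      if K: "compact K" for K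
    proof -
      \<comment> \<open>The difference of the two values of U is split at the initial function; the
        shifted half lives on the translate of K.\<close>
      define K' where "K' = K \<union> (\<lambda>X. X + \<xi>) ` K"
      have K': "compact K'" unfolding K'_def using K by (intro compact_Un compact_continuous_image continuous_intros)
      define F where "F t X = ennreal \<bar>U X t - indicator (- \<Omega>) X\<bar> * indicator (K' \<inter> D) X" for t X
      have lim: "((\<lambda>t. (\<integral>\<^sup>+ X. F t X \<partial>lborel) + (\<integral>\<^sup>+ X. F t X \<partial>lborel)) \<longlongrightarrow> 0 + 0) (at_right 0)"
        unfolding F_def by (intro tendsto_add init_limit K')
      show ?thesis
      proof (rule tendsto_sandwich[OF _ _ tendsto_const lim[unfolded add_0]])
        show "\<forall>\<^sub>F t in at_right 0. (\<integral>\<^sup>+ X. ennreal (U (X + \<xi>) t - U X t) * indicator (K \<inter> D) X \<partial>lborel)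
            \<le> (\<integral>\<^sup>+ X. F t X \<partial>lborel) + (\<integral>\<^sup>+ X. F t X \<partial>lborel)"
        proof (rule eventually_mono[OF eventually_at_right_less])
          fix t :: real assume t: "0 < t"
          have m: "F t \<in> borel_measurable borel"
            unfolding F_def[abs_def] by (rule init_integrand_measurable[OF K' t])
          have "(\<integral>\<^sup>+ X. ennreal (U (X + \<xi>) t - U X t) * indicator (K \<inter> D) X \<partial>lborel)
              \<le> (\<integral>\<^sup>+ X. F t (\<xi> + X) + F t X \<partial>lborel)"
          proof (rule nn_integral_mono)
            fix X
            show "ennreal (U (X + \<xi>) t - U X t) * indicator (K \<inter> D) X \<le> F t (\<xi> + X) + F t X"
            proof (cases "X \<in> K \<inter> D")
              case True
              have "indicator (- \<Omega>) (X + \<xi>) \<le> (indicator (- \<Omega>) X :: real)"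
                using \<xi>[of X] closure_subset[of \<Omega>] by (auto simp: indicator_def)
              then have "U (X + \<xi>) t - U X t \<le> \<bar>U (X + \<xi>) t - indicator (- \<Omega>) (X + \<xi>)\<bar> + \<bar>U X t - indicator (- \<Omega>) X\<bar>"
                by linarith
              then have "ennreal (U (X + \<xi>) t - U X t) \<le> ennreal \<bar>U (X + \<xi>) t - indicator (- \<Omega>) (X + \<xi>)\<bar> + ennreal \<bar>U X t - indicator (- \<Omega>) X\<bar>"
                by (subst ennreal_plus[symmetric]) (auto intro!: ennreal_leI simp del: ennreal_plus)
              then show ?thesis using True \<xi>D[of X] by (simp add: F_def K'_def add.commute[of \<xi>])
            qed simp
          qed
          also have "\<dots> = (\<integral>\<^sup>+ X. F t (\<xi> + X) \<partial>lborel) + (\<integral>\<^sup>+ X. F t X \<partial>lborel)"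
            using m by (intro nn_integral_add) auto
          also have "(\<integral>\<^sup>+ X. F t (\<xi> + X) \<partial>lborel) = (\<integral>\<^sup>+ X. F t X \<partial>(distr lborel borel ((+) \<xi>)))"
            using m by (intro nn_integral_distr[symmetric]) auto
          also have "distr lborel borel ((+) \<xi>) = lborel" by (rule lborel_distr_plus)
          finally show "(\<integral>\<^sup>+ X. ennreal (U (X + \<xi>) t - U X t) * indicator (K \<inter> D) X \<partial>lborel)
            \<le> (\<integral>\<^sup>+ X. F t X \<partial>lborel) + (\<integral>\<^sup>+ X. F t X \<partial>lborel)" .
        qed
      qed auto
    qed
    show "\<exists>e>0. \<forall>Y\<in>ball X e \<inter> D. \<forall>s\<in>ball t e. 0 < s \<longrightarrow> U (Y + \<xi>) s \<le> U Y s" if X: "X \<notin> D" and t: "0 < t" for X t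
    proof (cases "X \<in> closure D")
      case False
      then obtain e where e: "e > 0" "ball X e \<subseteq> - closure D"
        using open_contains_ball[of "- closure D"] by (auto simp: open_Compl)
      then have "ball X e \<inter> D = {}" using closure_subset[of D] by auto
      then show ?thesis using e(1) by blast
    next
      case True
      then have D\<Omega>: "D = \<Omega>" using D_cases X by auto
      then have X\<xi>: "X + \<xi> \<in> \<Omega>" using \<xi> True by simp
      \<comment> \<open>The translate of a boundary point is interior, and there
        \<open>U_less_1\<close> leaves a gap below the boundary value 1.\<close>
      obtain c where c: "U (X + \<xi>) t < c" "c < 1" using U_less_1[OF X\<xi> t] dense by blast
      have op: "open (D \<times> {0::real<..})" by (intro open_Times open_D open_greaterThan)
      have "isCont (\<lambda>(X, t). U X t) (X + \<xi>, t)"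
        using U_cont X\<xi> t \<Omega>_D by (auto simp: continuous_on_eq_continuous_at[OF op])
      then have "\<forall>\<^sub>F q in at (X + \<xi>, t). (\<lambda>(X, t). U X t) q < c"
        using c by (intro order_tendstoD(2)) (auto simp: isCont_def)
      then obtain e where e: "e > 0" "\<And>q. q \<noteq> (X + \<xi>, t) \<Longrightarrow> dist q (X + \<xi>, t) < e \<Longrightarrow> (\<lambda>(X, t). U X t) q < c"
        unfolding eventually_at by auto
      obtain e' where e': "e' > 0" "\<And>Y s. Y \<in> ball X e' \<inter> D \<Longrightarrow> s \<in> ball t e' \<Longrightarrow> s > 0 \<Longrightarrow> c < U Y s"
        using near_boundary[OF X t c(2), of 2] by auto
      show ?thesis
      proof (intro exI[of _ "min e' (e/2)"] conjI ballI impI)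
        show "min e' (e/2) > 0" using e e' by simp
        fix Y s assume Y: "Y \<in> ball X (min e' (e/2)) \<inter> D" and s: "s \<in> ball t (min e' (e/2))" "0 < s"
        have "dist (Y + \<xi>, s) (X + \<xi>, t) \<le> dist Y X + dist s t"
          unfolding dist_Pair_Pair using sqrt_sum_squares_le_sum[of "dist Y X" "dist s t"] by simp
        also have "\<dots> < e" using Y s by (auto simp: dist_commute)
        finally have d: "dist (Y + \<xi>, s) (X + \<xi>, t) < e" .
        have "U (Y + \<xi>) s < c"
          using e(2)[OF _ d] c(1) by (cases "(Y + \<xi>, s) = (X + \<xi>, t)") auto
        also have "c < U Y s" using e'(2)[of Y s] Y s by auto
        finally show "U (Y + \<xi>) s \<le> U Y s" by simp
      qed
    qed
  qed (use U_cont Ut_cont U_deriv X t \<xi>D in \<open>auto simp: v_def Ut_eq\<close>)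
qed

text \<open>A shift that merely maps \<Omega> into itself becomes strict after adding (0, h);
  continuity of U in D allows h to tend to 0.\<close>

lemma U_shift:
  assumes \<xi>: "\<And>X. X \<in> \<Omega> \<Longrightarrow> X + \<xi> \<in> \<Omega>" and X: "X \<in> \<Omega>" and t: "t > 0"
  shows "U (X + \<xi>) t \<le> U X t"
proof -
  have le: "U (X + (\<xi> + (0, h))) t \<le> U X t" if h: "h > 0" for h
  proof (rule U_shift_strict)
    fix Y assume Y: "Y \<in> closure \<Omega>"
    obtain x s where xs: "Y = (x, s)" by force
    have "f x \<le> s" using closure_\<Omega> Y xs by simp
    then have "Y + (0, h) \<in> \<Omega>" using h by (simp add: xs mem_\<Omega>)
    from \<xi>[OF this] show "Y + (\<xi> + (0, h)) \<in> \<Omega>" by (simp add: ac_simps)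
  qed (use X t \<Omega>_D in auto)
  have "isCont (\<lambda>X. U X t) (X + \<xi>)"
    using U_slice_cont[OF t] \<xi>[OF X] \<Omega>_D by (auto simp: continuous_on_eq_continuous_at[OF open_D])
  moreover have "((\<lambda>h. X + (\<xi> + (0, h))) \<longlongrightarrow> X + (\<xi> + (0, 0))) (at_right 0)"
    by (intro tendsto_intros)
  ultimately have "((\<lambda>h. U (X + (\<xi> + (0, h))) t) \<longlongrightarrow> U (X + \<xi>) t) (at_right 0)"
    by (intro isCont_tendsto_compose[where g = "\<lambda>X. U X t"]) (auto simp: zero_prod_def[symmetric])
  then show ?thesis
    by (rule tendsto_upperbound) (use le in \<open>auto simp: eventually_at_right_field intro!: exI[of _ 1]\<close>)
qed

text \<open>The barrier is a Gaussian centred at Z, started at time \<tau> and lowered by its value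
  at distance \<rho>, so that its initial trace is nonpositive in \<Omega>. Its modulus stays within
  \<eta>, which confines the diffusivity along it to [\<kappa>, 2 \<kappa>].\<close>

lemma v_lower_bound:
  assumes \<rho>: "\<rho> > 0" and sub: "cball Z \<rho> \<subseteq> - \<Omega>" and \<kappa>: "\<kappa> > 0" and \<eta>: "\<eta> > 0" "\<eta> < \<phi> 1"
    and near0: "\<And>y. \<bar>y\<bar> \<le> \<eta> \<Longrightarrow> \<kappa> \<le> \<phi>' (\<beta> y) \<and> \<phi>' (\<beta> y) \<le> 2 * \<kappa>"
    and \<tau>: "\<tau> > 0" and P: "P \<in> \<Omega>" and t: "t > 0"
  defines "n \<equiv> DIM((real^'n) \<times> real)"
  shows "\<eta> * \<tau> ^ n * (gaussian (- 1 / (4 * \<kappa>)) (P - Z) (t + \<tau>) - inverse \<tau> ^ n * exp (- \<rho>\<^sup>2 / (4 * \<kappa> * \<tau>))) \<le> v P t"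
proof -
  define c where "c = - 1 / (4 * \<kappa>)"
  have c: "c < 0" "4 * c\<^sup>2 = - c / \<kappa>" "4 * c * \<kappa> = - 1" using \<kappa> by (auto simp: c_def power2_eq_square field_simps)
  \<comment> \<open>Makes the peak of the Gaussian at t = 0 equal to \<eta>.\<close>
  define C where "C = \<eta> * \<tau> ^ n"
  have C: "C > 0" using \<eta> \<tau> by (simp add: C_def)
  define h where "h s = inverse s ^ n * exp (c * \<rho>\<^sup>2 / s)" for s
  define b where "b X t = C * (gaussian c (X - Z) (t + \<tau>) - h \<tau>)" for X t
  define r2 where "r2 X = (X - Z) \<bullet> (X - Z)" for X
  define bt where "bt X t = C * ((- real n / (t + \<tau>) - c * r2 X / (t + \<tau>)\<^sup>2) * gaussian c (X - Z) (t + \<tau>))" for X t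
  define bx where "bx i X t = C * ((2 * c * ((X - Z) \<bullet> i) / (t + \<tau>)) * gaussian c (X - Z) (t + \<tau>))" for i X t
  define bxx where "bxx i X t = C * ((4 * c\<^sup>2 * ((X - Z) \<bullet> i)\<^sup>2 / (t + \<tau>)\<^sup>2 + 2 * c / (t + \<tau>)) * gaussian c (X - Z) (t + \<tau>))" for i X t
  have s: "X + k *\<^sub>R i - Z = (X - Z) + k *\<^sub>R i" for X k i by (simp add: algebra_simps)
  have bc21: "c21 D b bt bx bxx"
    unfolding c21_def
  proof (intro conjI ballI allI impI)
    have ne: "t + \<tau> \<noteq> 0" if "t > 0" for t using that \<tau> by simp
    show "continuous_on (D \<times> {0<..}) (\<lambda>(X, t). b X t)" "continuous_on (D \<times> {0<..}) (\<lambda>(X, t). bt X t)"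
      "continuous_on (D \<times> {0<..}) (\<lambda>(X, t). bx i X t)" "continuous_on (D \<times> {0<..}) (\<lambda>(X, t). bxx i X t)" for i
      unfolding b_def bt_def bx_def bxx_def r2_def gaussian_def split_beta
      by (intro continuous_intros; use ne in force)+
    fix X t assume "X \<in> D" and t: "(0::real) < t"
    have t\<tau>: "t + \<tau> > 0" using t \<tau> by simp
    have "((\<lambda>t. gaussian c (X - Z) (t + \<tau>)) has_real_derivative
        (- real n / (t + \<tau>) - c * ((X - Z) \<bullet> (X - Z)) / (t + \<tau>)\<^sup>2) * gaussian c (X - Z) (t + \<tau>)) (at t)"
      using gaussian_derivatives(1)[OF t\<tau>, of c "X - Z"] DERIV_shift[of "gaussian c (X - Z)" _ t \<tau>] by (simp add: n_def)
    from DERIV_cmult[OF DERIV_diff[OF this DERIV_const], of C "h \<tau>"]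
    show "(b X has_real_derivative bt X t) (at t)" by (simp add: b_def[abs_def] bt_def r2_def)
    fix i :: "(real^'n) \<times> real" assume i: "i \<in> Basis"
    show "((\<lambda>k. b (X + k *\<^sub>R i) t) has_real_derivative bx i X t) (at 0)"
      using DERIV_cmult[OF DERIV_diff[OF gaussian_derivatives(2)[OF t\<tau> i, of c "X - Z"] DERIV_const], of C "h \<tau>"]
      by (simp add: b_def bx_def s)
    show "((\<lambda>k. bx i (X + k *\<^sub>R i) t) has_real_derivative bxx i X t) (at 0)"
      using DERIV_cmult[OF gaussian_derivatives(3)[OF t\<tau> i, of c "X - Z"], of C]
      by (simp add: bx_def bxx_def s)
  qed
  have g_le: "gaussian c (X - Z) (t + \<tau>) \<le> inverse \<tau> ^ n" if "t > 0" for X t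
  proof -
    have "c * ((X - Z) \<bullet> (X - Z)) / (t + \<tau>) \<le> 0"
      using c that \<tau> by (intro divide_nonpos_pos mult_nonpos_nonneg) auto
    then have "gaussian c (X - Z) (t + \<tau>) \<le> inverse (t + \<tau>) ^ n * 1"
      unfolding gaussian_def n_def using that \<tau> by (intro mult_left_mono) auto
    also have "\<dots> \<le> inverse \<tau> ^ n" using that \<tau> by (auto intro!: power_mono le_imp_inverse_le)
    finally show ?thesis .
  qed
  have h\<tau>: "0 \<le> h \<tau>" "h \<tau> \<le> inverse \<tau> ^ n"
    using \<tau> c by (auto simp: h_def intro!: mult_left_le divide_nonpos_pos mult_nonpos_nonneg)
  have C\<tau>: "C * inverse \<tau> ^ n = \<eta>" using \<tau> by (simp add: C_def power_inverse)
  have b_range: "b X t \<le> \<eta>" "- \<eta> \<le> b X t" if "t > 0" for X t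
  proof -
    have "0 \<le> C * gaussian c (X - Z) (t + \<tau>)" using that \<tau> C by (simp add: gaussian_def)
    moreover have "C * gaussian c (X - Z) (t + \<tau>) \<le> C * inverse \<tau> ^ n"
      using g_le[OF that, of X] C by (intro mult_left_mono) auto
    moreover have "0 \<le> C * h \<tau>" "C * h \<tau> \<le> C * inverse \<tau> ^ n" using h\<tau> C by (auto intro: mult_left_mono)
    ultimately have "b X t \<le> C * inverse \<tau> ^ n" "- (C * inverse \<tau> ^ n) \<le> b X t"
      unfolding b_def right_diff_distrib by linarith+
    then show "b X t \<le> \<eta>" "- \<eta> \<le> b X t" using C\<tau> by auto
  qed
  have \<beta>\<eta>: "\<beta> \<eta> < 1" using \<beta>_less_iff[of \<eta> "\<phi> 1"] \<eta> by (simp add: \<beta>_\<phi>)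
  have "\<beta> (b P t) \<le> U P t"
  proof (rule comparison[where ?u2.0 = U and ?u2t = Ut and ?u1.0 = "\<lambda>X t. \<beta> (b X t)"
        and ?u1t = "\<lambda>X t. bt X t / \<phi>' (\<beta> (b X t))" and M = 1, OF open_D bc21 v_c21])
    note \<beta>_time[OF bc21]
    then show "continuous_on (D \<times> {0<..}) (\<lambda>(X, t). \<beta> (b X t))"
      "continuous_on (D \<times> {0<..}) (\<lambda>(X, t). bt X t / \<phi>' (\<beta> (b X t)))"
      "\<And>X t. X \<in> D \<Longrightarrow> 0 < t \<Longrightarrow> ((\<lambda>t. \<beta> (b X t)) has_real_derivative bt X t / \<phi>' (\<beta> (b X t))) (at t)"
      by auto
    show "bt X t / \<phi>' (\<beta> (b X t)) \<le> (\<Sum>i\<in>Basis. bxx i X t)" if "X \<in> D" and t: "0 < t" for X t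
    proof -
      define a where "a = \<phi>' (\<beta> (b X t))"
      have a: "\<kappa> \<le> a" "a \<le> 2 * \<kappa>" "a > 0" using near0[of "b X t"] b_range[OF t, of X] \<phi>'_pos by (auto simp: a_def)
      define q where "q = t + \<tau>"
      have q: "q > 0" using t \<tau> by (simp add: q_def)
      define g where "g = gaussian c (X - Z) q"
      have g: "g \<ge> 0" using q by (simp add: g_def gaussian_def)
      have sum: "(\<Sum>i\<in>Basis. bxx i X t) = C * ((4 * c\<^sup>2 * r2 X / q\<^sup>2 + 2 * c * real n / q) * g)"
        unfolding bxx_def sum_distrib_left[symmetric] q_def[symmetric] g_def[symmetric]
        using gaussian_derivatives(4)[OF q, of c "X - Z"] by (simp add: n_def g_def r2_def)
      have r2: "r2 X \<ge> 0" by (simp add: r2_def)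
      \<comment> \<open>The factors a / \<kappa> - 1 and 1 - a / (2 \<kappa>) on the right are where
        \<kappa> <= a <= 2 \<kappa> enters.\<close>
      have "a * (4 * c\<^sup>2 * r2 X / q\<^sup>2 + 2 * c * real n / q) - (- real n / q - c * r2 X / q\<^sup>2)
          = (- c) * (a / \<kappa> - 1) * (r2 X / q\<^sup>2) + (1 - a / (2 * \<kappa>)) * (real n / q)"
      proof -
        define A B where "A = r2 X / q\<^sup>2" and "B = real n / q"
        have 1: "1 - a / (2 * \<kappa>) = 1 + 2 * c * a" using \<kappa> by (simp add: c_def)
        have 2: "a * (4 * c\<^sup>2) = - c * (a / \<kappa>)" unfolding c(2) by simp
        have "a * (4 * c\<^sup>2 * A + 2 * c * B) - (- B - c * A) = a * (4 * c\<^sup>2) * A + c * A + (1 + 2 * c * a) * B"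
          by (simp add: algebra_simps)
        also have "\<dots> = (- c) * (a / \<kappa> - 1) * A + (1 - a / (2 * \<kappa>)) * B"
          unfolding 1 2 by (simp add: algebra_simps)
        finally show ?thesis by (simp add: A_def B_def)
      qed
      also have "\<dots> \<ge> 0" using a \<kappa> c q r2 by (intro add_nonneg_nonneg mult_nonneg_nonneg) (auto simp: field_simps)
      finally have "(- real n / q - c * r2 X / q\<^sup>2) \<le> a * (4 * c\<^sup>2 * r2 X / q\<^sup>2 + 2 * c * real n / q)" by simp
      then have "C * ((- real n / q - c * r2 X / q\<^sup>2) * g) \<le> C * ((a * (4 * c\<^sup>2 * r2 X / q\<^sup>2 + 2 * c * real n / q)) * g)"
        using C g by (intro mult_left_mono mult_right_mono) auto
      then have "bt X t \<le> a * (\<Sum>i\<in>Basis. bxx i X t)"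
        unfolding sum bt_def q_def[symmetric] g_def[symmetric] by (simp add: mult_ac)
      then show ?thesis using a by (simp add: a_def[symmetric] pos_divide_le_eq mult.commute)
    qed
    have \<beta>b: "\<beta> (b X t) \<le> \<beta> \<eta>" if "t > 0" for X t using b_range[OF that] by (simp add: \<beta>_le_iff)
    show "\<beta> (b X t) - U X t \<le> 1" if "X \<in> D" "0 < t" for X t
      using \<beta>b[OF that(2), of X] \<beta>\<eta> U_range(1)[OF that] by linarith
    show "\<exists>r>0. \<forall>Y\<in>ball X r \<inter> D. \<forall>s\<in>ball t r. 0 < s \<longrightarrow> \<beta> (b Y s) \<le> U Y s" if Xt: "X \<notin> D" "0 < t" for X t
    proof -
      obtain r where "r > 0" "\<forall>Y\<in>ball X r \<inter> D. \<forall>s\<in>ball t r. s > 0 \<longrightarrow> \<beta> \<eta> < U Y s \<and> U Y s < 2"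
        using near_boundary[OF Xt \<beta>\<eta>, of 2] by auto
      moreover have "\<beta> (b Y s) \<le> U Y s" if "0 < s" "\<beta> \<eta> < U Y s" for Y s
        using \<beta>b[OF that(1), of Y] that(2) by linarith
      ultimately show ?thesis by blast
    qed
    show "((\<lambda>t. \<integral>\<^sup>+ X. ennreal (\<beta> (b X t) - U X t) * indicator (K \<inter> D) X \<partial>lborel) \<longlongrightarrow> 0) (at_right 0)"
      if K: "compact K" for K
    proof -
      \<comment> \<open>Bounds the excess of the barrier over the initial function at time t; it
        tends to 0 because h (t + \<tau>) tends to h \<tau>. The divisor \<delta>1 is due to the
        Lipschitz constant of \<beta>.\<close>
      define k where "k t = max 0 (C * (h (t + \<tau>) - h \<tau>) / \<delta>1)" for t
      define V where "V = measure lborel K"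
      have V: "emeasure lborel K = ennreal V"
        using emeasure_compact_finite[OF K] by (simp add: V_def emeasure_eq_ennreal_measure)
      have Kb: "K \<in> sets borel" "D \<in> sets borel" using compact_imp_closed[OF K] open_D by auto
      have "isCont (\<lambda>t. h (t + \<tau>)) 0" unfolding h_def using \<tau> by (intro continuous_intros) auto
      then have "((\<lambda>t. h (t + \<tau>)) \<longlongrightarrow> h (0 + \<tau>)) (at_right 0)"
        by (simp add: isCont_def filterlim_at_split)
      then have "((\<lambda>t. k t * V) \<longlongrightarrow> max 0 (C * (h (0 + \<tau>) - h \<tau>) / \<delta>1) * V) (at_right 0)"
        unfolding k_def using \<delta> by (intro tendsto_intros) auto
      then have "((\<lambda>t. ennreal (k t * V)) \<longlongrightarrow> ennreal 0) (at_right 0)" by (intro tendsto_ennrealI) simp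
      then have lim: "((\<lambda>t. (\<integral>\<^sup>+X. ennreal \<bar>U X t - indicator (- \<Omega>) X\<bar> * indicator (K \<inter> D) X \<partial>lborel) + ennreal (k t * V)) \<longlongrightarrow> 0 + 0) (at_right 0)"
        by (intro tendsto_add init_limit[OF K]) simp
      show ?thesis
      proof (rule tendsto_sandwich[OF _ _ tendsto_const lim[unfolded add_0]])
        show "\<forall>\<^sub>F t in at_right 0. (\<integral>\<^sup>+ X. ennreal (\<beta> (b X t) - U X t) * indicator (K \<inter> D) X \<partial>lborel)
          \<le> (\<integral>\<^sup>+X. ennreal \<bar>U X t - indicator (- \<Omega>) X\<bar> * indicator (K \<inter> D) X \<partial>lborel) + ennreal (k t * V)"
        proof (rule eventually_mono[OF eventually_at_right_less])
          fix t :: real assume t: "0 < t"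
          have k: "\<beta> (b X t) - indicator (- \<Omega>) X \<le> k t" for X
          proof (cases "X \<in> \<Omega>")
            case True
            then have "\<rho> < norm (X - Z)" using sub by (force simp: dist_norm norm_minus_commute)
            then have "\<rho>\<^sup>2 \<le> (X - Z) \<bullet> (X - Z)" using \<rho> power_mono[of \<rho> "norm (X - Z)" 2] by (simp add: power2_norm_eq_inner)
            then have "c * ((X - Z) \<bullet> (X - Z)) / (t + \<tau>) \<le> c * \<rho>\<^sup>2 / (t + \<tau>)"
              using c t \<tau> by (intro divide_right_mono mult_left_mono_neg) auto
            then have "gaussian c (X - Z) (t + \<tau>) \<le> h (t + \<tau>)"
              unfolding gaussian_def h_def n_def using t \<tau> by (intro mult_left_mono) auto
            then have "b X t \<le> C * (h (t + \<tau>) - h \<tau>)" unfolding b_def using C by (intro mult_left_mono) auto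
            moreover have "\<beta> (b X t) \<le> max 0 (b X t / \<delta>1)"
              using \<beta>_diff[of 0 "b X t"] \<beta>_le_iff[of "b X t" 0] by (auto simp: \<beta>_0 max_def)
            ultimately have "\<beta> (b X t) \<le> k t" unfolding k_def using \<delta>
              by (auto simp: max_def divide_right_mono split: if_splits intro: order_trans[OF _ divide_right_mono[of "b X t" _ \<delta>1]])
            then show ?thesis using True by simp
          next
            case False
            then show ?thesis using \<beta>b[OF t, of X] \<beta>\<eta> by (simp add: k_def)
          qed
          have "(\<integral>\<^sup>+ X. ennreal (\<beta> (b X t) - U X t) * indicator (K \<inter> D) X \<partial>lborel)
            \<le> (\<integral>\<^sup>+X. ennreal \<bar>U X t - indicator (- \<Omega>) X\<bar> * indicator (K \<inter> D) X + ennreal (k t) * indicator (K \<inter> D) X \<partial>lborel)"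
          proof (rule nn_integral_mono)
            fix X
            have "\<beta> (b X t) - U X t \<le> \<bar>U X t - indicator (- \<Omega>) X\<bar> + k t" using k[of X] by linarith
            then have "ennreal (\<beta> (b X t) - U X t) \<le> ennreal \<bar>U X t - indicator (- \<Omega>) X\<bar> + ennreal (k t)"
              by (subst ennreal_plus[symmetric]) (auto simp: k_def intro!: ennreal_leI simp del: ennreal_plus)
            then show "ennreal (\<beta> (b X t) - U X t) * indicator (K \<inter> D) X
              \<le> ennreal \<bar>U X t - indicator (- \<Omega>) X\<bar> * indicator (K \<inter> D) X + ennreal (k t) * indicator (K \<inter> D) X"
              by (auto simp: indicator_def)
          qed
          also have "\<dots> = (\<integral>\<^sup>+X. ennreal \<bar>U X t - indicator (- \<Omega>) X\<bar> * indicator (K \<inter> D) X \<partial>lborel)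
              + (\<integral>\<^sup>+X. ennreal (k t) * indicator (K \<inter> D) X \<partial>lborel)"
            using init_integrand_measurable[OF K t] Kb by (intro nn_integral_add) auto
          also have "(\<integral>\<^sup>+X. ennreal (k t) * indicator (K \<inter> D) X \<partial>lborel) = ennreal (k t) * emeasure lborel (K \<inter> D)"
            using Kb by (simp add: nn_integral_cmult_indicator)
          also have "\<dots> \<le> ennreal (k t) * emeasure lborel K" using Kb by (intro mult_left_mono emeasure_mono) auto
          also have "\<dots> = ennreal (k t * V)" unfolding V by (subst ennreal_mult) (auto simp: k_def V_def)
          finally show "(\<integral>\<^sup>+ X. ennreal (\<beta> (b X t) - U X t) * indicator (K \<inter> D) X \<partial>lborel)
            \<le> (\<integral>\<^sup>+X. ennreal \<bar>U X t - indicator (- \<Omega>) X\<bar> * indicator (K \<inter> D) X \<partial>lborel) + ennreal (k t * V)"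
            by (simp add: add_left_mono)
        qed
      qed auto
    qed
  qed (use U_cont Ut_cont U_deriv P \<Omega>_D t in \<open>auto simp: v_def Ut_eq \<phi>_\<beta>\<close>)
  then have "b P t \<le> v P t" using \<phi>_le_iff[of "\<beta> (b P t)" "U P t"] by (simp add: v_def \<phi>_\<beta>)
  then show ?thesis by (simp add: b_def C_def h_def c_def)
qed

text \<open>The supersolution grows away from Q and blows up at time \<tau>: it dominates v on the
  sphere of radius \<rho>, while its value at Q is exponentially small. Everything happens in a
  compact cylinder at positive times, so \<open>tube_minimum_principle\<close> with a resting ball
  applies.\<close>

lemma v_upper_bound:
  assumes \<rho>: "0 < \<rho>" "\<rho> < \<rho>'" and sub: "cball Q \<rho>' \<subseteq> \<Omega>" and a: "\<phi>' 0 < a"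
  defines "n \<equiv> DIM((real^'n) \<times> real)"
  obtains B T where "B > 0" "T > 0"
    "\<And>\<tau> t. 0 < t \<Longrightarrow> t < \<tau> \<Longrightarrow> \<tau> \<le> T \<Longrightarrow> v Q t \<le> B * (\<tau> / (\<tau> - t)) ^ n * exp (- \<rho>\<^sup>2 / (4 * a * \<tau>))"
proof -
  have apos: "a > 0" using a \<phi>'_pos[of 0] by simp
  define e where "e = \<rho>' - \<rho>"
  have e: "e > 0" using \<rho> by (simp add: e_def)
  define A where "A = 4 * \<phi> 1 * \<delta>2 * real DIM((real^'n) \<times> real) / e\<^sup>2"
  have A: "A > 0" using \<phi>_1_pos \<delta>2 e by (simp add: A_def)
  have lin: "v X t \<le> A * t" if "X \<in> cball Q \<rho>" "t > 0" for X t
  proof -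
    have "cball X e \<subseteq> \<Omega>"
    proof
      fix W assume "W \<in> cball X e"
      then have "dist Q W \<le> \<rho>'" using that dist_triangle[of Q W X] by (simp add: e_def)
      then show "W \<in> \<Omega>" using sub by auto
    qed
    from v_linear_bound[OF e this that(2)] show ?thesis by (simp add: A_def)
  qed
  have cbD: "cball Q \<rho> \<subseteq> D" using sub \<rho> \<Omega>_D by force
  have "isCont (\<lambda>y. \<phi>' (\<beta> y)) 0"
    by (rule isCont_o2[OF \<beta>_cont(2) \<phi>_cont(4)])
  then have "((\<lambda>y. \<phi>' (\<beta> y)) \<longlongrightarrow> \<phi>' 0) (at 0)" by (simp add: isCont_def \<beta>_0)
  from order_tendstoD(2)[OF this a]
  obtain y0 where y0: "y0 > 0" "\<And>y. y \<noteq> 0 \<Longrightarrow> dist y 0 < y0 \<Longrightarrow> \<phi>' (\<beta> y) < a"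
    unfolding eventually_at by auto
  have y0': "\<phi>' (\<beta> y) < a" if "0 \<le> y" "y < y0" for y
    using y0(2)[of y] that a by (cases "y = 0") (auto simp: \<beta>_0)
  \<comment> \<open>Up to time T the linear bound keeps v below y0, hence the diffusivity below
    a.\<close>
  define T where "T = y0 / (2 * A)"
  have T: "T > 0" "A * T < y0" using A y0 by (auto simp: T_def)
  define B where "B = A * T"
  have B: "B > 0" using A T by (simp add: B_def)
  show ?thesis
  proof (rule that[OF B T(1)])
    fix \<tau> t :: real assume t: "0 < t" "t < \<tau>" and \<tau>: "\<tau> \<le> T"
    have \<tau>0: "\<tau> > 0" using t by simp
    define c where "c = 1 / (4 * a)"
    have c: "c > 0" "4 * c\<^sup>2 = c / a" using apos by (auto simp: c_def power2_eq_square field_simps)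
    \<comment> \<open>Chosen so that the barrier equals B on the sphere of radius \<rho> at time 0
      and is at least B later; B = A T bounds v there.\<close>
    define E where "E = B * \<tau> ^ n * exp (- \<rho>\<^sup>2 / (4 * a * \<tau>))"
    have E: "E > 0" using B \<tau>0 by (simp add: E_def)
    define r2 where "r2 X = (X - Q) \<bullet> (X - Q)" for X
    define g where "g X t = gaussian c (X - Q) (\<tau> - t)" for X t
    define bt where "bt X t = E * ((real n / (\<tau> - t) + c * r2 X / (\<tau> - t)\<^sup>2) * g X t)" for X t
    define bx where "bx i X t = E * ((2 * c * ((X - Q) \<bullet> i) / (\<tau> - t)) * g X t)" for i X t
    define bxx where "bxx i X t = E * ((4 * c\<^sup>2 * ((X - Q) \<bullet> i)\<^sup>2 / (\<tau> - t)\<^sup>2 + 2 * c / (\<tau> - t)) * g X t)" for i X t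
    have s: "X + k *\<^sub>R i - Q = (X - Q) + k *\<^sub>R i" for X k i by (simp add: algebra_simps)
    have dt: "((\<lambda>r. E * g X r) has_real_derivative bt X r) (at r)" if "r < \<tau>" for X r
    proof -
      have q: "\<tau> - r > 0" using that by simp
      have "((\<lambda>r. \<tau> - r) has_real_derivative - 1) (at r)" by (auto intro!: derivative_eq_intros)
      note d = DERIV_cmult[OF DERIV_chain'[OF this gaussian_derivatives(1)[OF q, of c "X - Q"]], of E]
      have "E * (- 1 * ((- real n / (\<tau> - r) - c * r2 X / (\<tau> - r)\<^sup>2) * g X r)) = bt X r"
        by (simp add: bt_def left_diff_distrib distrib_right)
      then show ?thesis using d unfolding g_def r2_def n_def by (simp only: mult.commute[of _ "- 1"])
    qed
    have dx: "((\<lambda>k. E * g (X + k *\<^sub>R i) r) has_real_derivative bx i X r) (at 0)"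
      "((\<lambda>k. bx i (X + k *\<^sub>R i) r) has_real_derivative bxx i X r) (at 0)" if "r < \<tau>" "i \<in> Basis" for X r i
    proof -
      have q: "\<tau> - r > 0" using that by simp
      show "((\<lambda>k. E * g (X + k *\<^sub>R i) r) has_real_derivative bx i X r) (at 0)"
        using DERIV_cmult[OF gaussian_derivatives(2)[OF q that(2), of c "X - Q"], of E] by (simp add: g_def bx_def s)
      show "((\<lambda>k. bx i (X + k *\<^sub>R i) r) has_real_derivative bxx i X r) (at 0)"
        using DERIV_cmult[OF gaussian_derivatives(3)[OF q that(2), of c "X - Q"], of E] by (simp add: g_def bx_def bxx_def s)
    qed
    have r2: "r2 X \<ge> 0" for X by (simp add: r2_def)
    have g0: "g X r \<ge> inverse \<tau> ^ n" if "0 \<le> r" "r < \<tau>" for X r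
    proof -
      have "0 \<le> c * r2 X / (\<tau> - r)" using c r2 that by simp
      then have "inverse (\<tau> - r) ^ n * 1 \<le> g X r" unfolding g_def gaussian_def n_def r2_def
        using that by (intro mult_left_mono) auto
      moreover have "inverse \<tau> ^ n \<le> inverse (\<tau> - r) ^ n" using that by (auto intro!: power_mono le_imp_inverse_le)
      ultimately show ?thesis by simp
    qed
    \<comment> \<open>Early enough for the linear bound A s0 to lie below a positive lower bound of
      the barrier; this serves as the initial condition.\<close>
    define s0 where "s0 = min (t / 2) (E * inverse \<tau> ^ n / A)"
    have s0: "0 < s0" "s0 < t" "s0 \<le> E * inverse \<tau> ^ n / A" using t E A \<tau>0 by (auto simp: s0_def)
    have "0 \<le> E * g Q t - v Q t"
    proof (rule tube_minimum_principle[where c = "\<lambda>_. Q" and r = \<rho> and ?t1.0 = s0 and ?t2.0 = t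
          and G = "\<lambda>X t. E * g X t - v X t" and Gt = "\<lambda>X t. bt X t - vt X t"
          and Gx = "\<lambda>i X t. bx i X t - vx i X t" and Gxx = "\<lambda>i X t. bxx i X t - vxx i X t"])
      have sub': "{(X, s). s0 \<le> s \<and> s \<le> t \<and> norm (X - Q) \<le> \<rho>} \<subseteq> D \<times> {0<..}"
        using cbD s0 by (auto simp: dist_norm norm_minus_commute)
      have "continuous_on {(X, s). s0 \<le> s \<and> s \<le> t \<and> norm (X - Q) \<le> \<rho>} (\<lambda>(X, t). v X t)"
        by (rule continuous_on_subset[OF _ sub']) (use v_c21 in \<open>simp add: c21_def\<close>)
      moreover have "continuous_on {(X, s). s0 \<le> s \<and> s \<le> t \<and> norm (X - Q) \<le> \<rho>} (\<lambda>(X, t). E * g X t)"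
        unfolding g_def gaussian_def split_beta using t by (intro continuous_intros) auto
      ultimately show "continuous_on {(X, s). s0 \<le> s \<and> s \<le> t \<and> norm (X - Q) \<le> \<rho>} (\<lambda>(X, t). E * g X t - v X t)"
        unfolding split_beta by (rule continuous_on_diff[rotated])
      have inD: "X \<in> D" "X \<in> cball Q \<rho>" if "norm (X - Q) \<le> \<rho>" for X
        using cbD that by (auto simp: dist_norm norm_minus_commute)
      show "0 \<le> E * g X s0 - v X s0" if "norm (X - Q) \<le> \<rho>" for X
      proof -
        have "v X s0 \<le> A * s0" using lin[OF inD(2)[OF that] s0(1)] .
        also have "\<dots> \<le> A * (E * inverse \<tau> ^ n / A)" using s0 A by (intro mult_left_mono) auto
        also have "\<dots> = E * inverse \<tau> ^ n" using A by simp
        also have "\<dots> \<le> E * g X s0" using g0[of s0 X] s0 t E by (intro mult_left_mono) auto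
        finally show ?thesis by simp
      qed
      show "0 \<le> E * g X r - v X r" if r: "s0 \<le> r" "r \<le> t" "norm (X - Q) = \<rho>" for X r
      proof -
        have q: "0 < \<tau> - r" "\<tau> - r \<le> \<tau>" using r t s0 by auto
        have "v X r \<le> A * r" using lin[OF inD(2)] r s0 by auto
        also have "\<dots> \<le> B" unfolding B_def using r t \<tau> A by (intro mult_left_mono) auto
        also have "B = E * (inverse \<tau> ^ n * exp (c * \<rho>\<^sup>2 / \<tau>))"
          using \<tau>0 by (simp add: E_def c_def power_inverse exp_minus field_simps)
        also have "\<dots> \<le> E * g X r"
        proof (intro mult_left_mono)
          have "r2 X = \<rho>\<^sup>2" using r by (simp add: r2_def flip: power2_norm_eq_inner)
          moreover have "c * \<rho>\<^sup>2 / \<tau> \<le> c * \<rho>\<^sup>2 / (\<tau> - r)" using q c by (intro divide_left_mono) auto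
          ultimately show "inverse \<tau> ^ n * exp (c * \<rho>\<^sup>2 / \<tau>) \<le> g X r"
            unfolding g_def gaussian_def n_def r2_def using q
            by (intro mult_mono power_mono) (auto intro: le_imp_inverse_le)
        qed (use E in auto)
        finally show ?thesis by simp
      qed
      show "((\<lambda>r. E * g X r - v X r) has_real_derivative bt X r - vt X r) (at r)"
        if "s0 < r" "r \<le> t" "norm (X - Q) < \<rho>" for X r
        using v_c21 inD(1)[of X] that t s0 by (intro DERIV_diff dt) (auto simp: c21_def)
      show "((\<lambda>h. E * g (X + h *\<^sub>R i) r - v (X + h *\<^sub>R i) r) has_real_derivative bx i X r - vx i X r) (at 0)"
        if "i \<in> Basis" "s0 < r" "r \<le> t" "norm (X - Q) < \<rho>" for i X r
        by (intro DERIV_diff dx(1)) (use v_c21 inD(1)[of X] that t s0 in \<open>auto simp: c21_def\<close>)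
      show "((\<lambda>h. bx i (X + h *\<^sub>R i) r - vx i (X + h *\<^sub>R i) r) has_real_derivative bxx i X r - vxx i X r) (at 0)"
        if "i \<in> Basis" "s0 < r" "r \<le> t" "norm (X - Q) < \<rho>" for i X r
        by (intro DERIV_diff dx(2)) (use v_c21 inD(1)[of X] that t s0 in \<open>auto simp: c21_def\<close>)
      show "\<exists>a\<ge>0. bt X r - vt X r > a * (\<Sum>i\<in>Basis. bxx i X r - vxx i X r)"
        if r: "s0 < r" "r \<le> t" "norm (X - Q) < \<rho>" for X r
      proof (intro exI conjI)
        have X: "X \<in> D" "X \<in> cball Q \<rho>" and r0: "r > 0" using inD[of X] r s0 by auto
        have "v X r \<le> A * r" by (rule lin[OF X(2) r0])
        also have "\<dots> \<le> A * T" using r t \<tau> A by (intro mult_left_mono) auto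
        also have "\<dots> < y0" by (rule T)
        finally have "\<phi>' (\<beta> (v X r)) < a" by (rule y0'[OF v_range(1)[OF X(1) r0]])
        then have la: "\<phi>' (U X r) < a" by (simp add: v_def \<beta>_\<phi>)
        define d where "d = \<phi>' (U X r)"
        have d: "0 < d" "d < a" using la \<phi>'_pos by (auto simp: d_def)
        then show "0 \<le> \<phi>' (U X r)" by (simp add: d_def)
        define q where "q = \<tau> - r"
        have q: "q > 0" using r t by (simp add: q_def)
        have gp: "g X r > 0" using q by (simp add: g_def gaussian_def q_def)
        have np: "real n / q > 0" using q by (simp add: n_def)
        define R where "R = r2 X / q\<^sup>2"
        have R: "R \<ge> 0" using r2 by (simp add: R_def)
        have sum: "(\<Sum>i\<in>Basis. bxx i X r) = E * ((4 * c\<^sup>2 * R + 2 * c * (real n / q)) * g X r)"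
          unfolding bxx_def sum_distrib_left[symmetric] q_def[symmetric] g_def
          using gaussian_derivatives(4)[OF q, of c "X - Q"] by (simp add: n_def g_def r2_def R_def)
        have k: "d * (4 * c\<^sup>2 * R) \<le> c * R"
        proof -
          have "d * (4 * c\<^sup>2) = c * (d / a)" unfolding c(2) by simp
          also have "\<dots> \<le> c * 1" using d c by (intro mult_left_mono) (auto simp: divide_le_eq)
          finally show ?thesis using mult_right_mono[of "d * (4 * c\<^sup>2)" "c * 1" R] R by (simp add: mult.assoc)
        qed
        have "d * (2 * c * (real n / q)) < 1 * (real n / q)"
        proof -
          have "d * (2 * c) < 1" using d by (simp add: c_def divide_less_eq)
          from mult_strict_right_mono[OF this np] show ?thesis by (simp only: mult.assoc)
        qed
        then have "d * (4 * c\<^sup>2 * R + 2 * c * (real n / q)) < real n / q + c * R" using k by (simp only: distrib_left)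
        then have "E * ((d * (4 * c\<^sup>2 * R + 2 * c * (real n / q))) * g X r) < E * ((real n / q + c * R) * g X r)"
          using E gp by (intro mult_strict_left_mono mult_strict_right_mono) auto
        then have "d * (\<Sum>i\<in>Basis. bxx i X r) < bt X r"
          unfolding sum bt_def q_def[symmetric] R_def by (simp add: mult.assoc mult.left_commute)
        then show "\<phi>' (U X r) * (\<Sum>i\<in>Basis. bxx i X r - vxx i X r) < bt X r - vt X r"
          by (simp add: sum_subtractf right_diff_distrib vt_eq[OF X(1) r0] d_def)
      qed
    qed (use \<rho> s0 in auto)
    then have "v Q t \<le> E * g Q t" by simp
    also have "\<dots> = B * (\<tau> / (\<tau> - t)) ^ n * exp (- \<rho>\<^sup>2 / (4 * a * \<tau>))"
      using t by (simp add: E_def g_def gaussian_def n_def power_divide power_inverse field_simps)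
    finally show "v Q t \<le> B * (\<tau> / (\<tau> - t)) ^ n * exp (- \<rho>\<^sup>2 / (4 * a * \<tau>))" .
  qed
qed

section \<open>Distance to the complement and its effect at short times\<close>

abbreviation dst :: "(real^'n) \<times> real \<Rightarrow> real" where
  "dst X \<equiv> infdist X (- \<Omega>)"

lemma closed_compl: "closed (- \<Omega>)" "- \<Omega> \<noteq> {}"
proof -
  show "closed (- \<Omega>)" using open_\<Omega> by auto
  have "(0, f 0) \<in> - \<Omega>" by (simp add: mem_\<Omega>)
  then show "- \<Omega> \<noteq> {}" by blast
qed

lemma nearest_point:
  obtains Z where "Z \<in> - \<Omega>" "dist X Z = dst X"
  using infdist_attains_inf[OF closed_compl] by metis

lemma dst_le: "Z \<in> - \<Omega> \<Longrightarrow> dst X \<le> dist X Z"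
  by (rule infdist_le)

lemma dst_pos: "X \<in> \<Omega> \<longleftrightarrow> dst X > 0"
proof -
  have "dst X = 0 \<longleftrightarrow> X \<in> - \<Omega>" using in_closed_iff_infdist_zero[OF closed_compl] by simp
  moreover have "dst X \<ge> 0" by (rule infdist_nonneg)
  ultimately show ?thesis by (cases "X \<in> \<Omega>") auto
qed

lemma cball_subset:
  assumes "r < dst X"
  shows "cball X r \<subseteq> \<Omega>"
proof
  fix Z assume "Z \<in> cball X r"
  then show "Z \<in> \<Omega>" using dst_le[of Z X] assms by (cases "Z \<in> \<Omega>") auto
qed

text \<open>Two crude exponential bounds replace the exact limit: up to smaller terms, v P t is at
  least a multiple of exp (- e1 / t), and v Q t is at most a multiple of exp (- e2 / t), with e1 <
  e2. The gap between r and \<rho> leaves room for diffusivities on either side of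
  \<phi>'(0).\<close>

theorem distance_order:
  assumes PQ: "P \<in> \<Omega>" "Q \<in> \<Omega>" and less: "dst P < dst Q"
  shows "\<forall>\<^sub>F t in at_right 0. U Q t < U P t"
proof -
  define n where "n = DIM((real^'n) \<times> real)"
  obtain r where r: "dst P < r" "r < dst Q" using less dense by blast
  obtain \<rho> where \<rho>: "r < \<rho>" "\<rho> < dst Q" using r dense by blast
  obtain \<rho>' where \<rho>': "\<rho> < \<rho>'" "\<rho>' < dst Q" using \<rho> dense by blast
  have rpos: "0 < r" using r infdist_nonneg[of P "- \<Omega>"] by linarith
  define \<alpha> where "\<alpha> = \<phi>' 0"
  have \<alpha>: "\<alpha> > 0" using \<phi>'_pos by (simp add: \<alpha>_def)
  \<comment> \<open>The bound 1 / 4 secures \<alpha> < 2 \<kappa>; the other one keeps the rates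
    ordered, r^2 (1 + \<theta>) < \<rho>^2 (1 - \<theta>).\<close>
  define \<theta> where "\<theta> = min (1 / 4) ((\<rho>\<^sup>2 - r\<^sup>2) / (2 * (\<rho>\<^sup>2 + r\<^sup>2)))"
  have sq: "r\<^sup>2 < \<rho>\<^sup>2" using rpos \<rho> by (intro power_strict_mono) auto
  have sq0: "0 < \<rho>\<^sup>2 + r\<^sup>2" using rpos by (simp add: add_nonneg_pos)
  have \<theta>: "0 < \<theta>" "\<theta> \<le> 1 / 4" "\<theta> \<le> (\<rho>\<^sup>2 - r\<^sup>2) / (2 * (\<rho>\<^sup>2 + r\<^sup>2))"
    unfolding \<theta>_def using sq sq0 by (simp_all only: min.cobounded1 min.cobounded2) simp
  have \<theta>2: "r\<^sup>2 * (1 + \<theta>) < \<rho>\<^sup>2 * (1 - \<theta>)"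
  proof -
    have "2 * (\<theta> * (\<rho>\<^sup>2 + r\<^sup>2)) \<le> \<rho>\<^sup>2 - r\<^sup>2" using \<theta>(3) sq0 by (simp add: pos_le_divide_eq mult_ac)
    moreover have "0 < \<theta> * (\<rho>\<^sup>2 + r\<^sup>2)" using \<theta>(1) sq0 by simp
    ultimately have "\<theta> * (\<rho>\<^sup>2 + r\<^sup>2) < \<rho>\<^sup>2 - r\<^sup>2" by linarith
    then show ?thesis by (simp add: algebra_simps)
  qed
  define \<kappa> where "\<kappa> = \<alpha> * (1 - \<theta>)"
  define a where "a = \<alpha> * (1 + \<theta>)"
  have \<kappa>: "0 < \<kappa>" "\<kappa> < \<alpha>" using \<alpha> \<theta> by (auto simp: \<kappa>_def algebra_simps)
  have \<kappa>2: "\<alpha> < 2 * \<kappa>"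
  proof -
    have "\<alpha> * (2 * \<theta>) < \<alpha> * 1" using \<alpha> \<theta> by (intro mult_strict_left_mono) auto
    then show ?thesis by (simp add: \<kappa>_def algebra_simps)
  qed
  have a: "\<phi>' 0 < a" "0 < a" using \<alpha> \<theta> by (auto simp: a_def \<alpha>_def[symmetric] algebra_simps add_pos_pos)
  define e1 where "e1 = r\<^sup>2 / (4 * \<kappa>)"
  define e2' where "e2' = \<rho>\<^sup>2 / (4 * a)"
  have e1: "0 < e1" using rpos \<kappa> by (simp add: e1_def)
  have e12: "e1 < e2'"
  proof -
    have "\<alpha> * (r\<^sup>2 * (1 + \<theta>)) < \<alpha> * (\<rho>\<^sup>2 * (1 - \<theta>))" using \<theta>2 \<alpha> by (rule mult_strict_left_mono)
    then have "r\<^sup>2 * a < \<rho>\<^sup>2 * \<kappa>" by (simp add: a_def \<kappa>_def mult_ac)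
    then show ?thesis using \<kappa> a by (simp add: e1_def e2'_def field_simps)
  qed
  \<comment> \<open>With this l the rate e2 is the midpoint of e1 and e2'.\<close>
  define l where "l = (1 - e1 / e2') / 2"
  have l: "0 < l" "l < 1" using e1 e12 by (auto simp: l_def field_simps)
  define e2 where "e2 = e2' * (1 - l)"
  have e2: "e1 < e2" using e1 e12 by (simp add: e2_def l_def field_simps)

  obtain Z1 where Z1: "Z1 \<in> - \<Omega>" "dist P Z1 = dst P" by (rule nearest_point)
  obtain z s where zs: "Z1 = (z, s)" by force
  define \<epsilon> where "\<epsilon> = r - dst P"
  have \<epsilon>: "\<epsilon> > 0" using r by (simp add: \<epsilon>_def)
  \<comment> \<open>Lowering the nearest point by \<epsilon> puts it strictly below the graph, hence
    at the centre of a small ball in the complement, and keeps it within r of P.\<close>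
  define Z where "Z = (z, s - \<epsilon>)"
  have PZ: "norm (P - Z) \<le> r"
  proof -
    have "dist P Z \<le> dist P Z1 + dist Z1 Z" by (rule dist_triangle)
    also have "dist Z1 Z = \<epsilon>" using \<epsilon> by (simp add: Z_def zs dist_Pair_Pair dist_real_def)
    finally show ?thesis using Z1(2) by (simp add: \<epsilon>_def dist_norm)
  qed
  have "open {p. snd p < f (fst p)}"
    by (auto intro!: open_Collect_less continuous_intros continuous_on_compose2[OF f_cont])
  moreover have "Z \<in> {p. snd p < f (fst p)}" using Z1(1) \<epsilon> by (simp add: zs Z_def mem_\<Omega>)
  ultimately obtain r0 where r0: "r0 > 0" "cball Z r0 \<subseteq> {p. snd p < f (fst p)}"
    using open_contains_cball by blast
  have r0\<Omega>: "cball Z r0 \<subseteq> - \<Omega>"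
  proof
    fix q assume "q \<in> cball Z r0"
    then have "snd q < f (fst q)" using r0 by auto
    then show "q \<in> - \<Omega>" using mem_\<Omega>[of "fst q" "snd q"] by simp
  qed
  \<comment> \<open>With \<tau> = m t the term subtracted in the lower bound becomes exp (- (e1 + 1)
    / t), negligible against exp (- e1 / t).\<close>
  define m where "m = r0\<^sup>2 / (4 * \<kappa> * (e1 + 1))"
  have m: "m > 0" using r0 \<kappa> e1 by (simp add: m_def)

  have cont: "isCont (\<lambda>y. \<phi>' (\<beta> y)) 0"
    by (rule isCont_o2[OF \<beta>_cont(2) \<phi>_cont(4)])
  then have lim: "((\<lambda>y. \<phi>' (\<beta> y)) \<longlongrightarrow> \<alpha>) (at 0)" by (simp add: isCont_def \<beta>_0 \<alpha>_def)
  have "\<forall>\<^sub>F y in at 0. \<kappa> < \<phi>' (\<beta> y) \<and> \<phi>' (\<beta> y) < 2 * \<kappa>"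
    using order_tendstoD[OF lim] \<kappa> \<kappa>2 by (intro eventually_conj) auto
  then obtain y0 where y0: "y0 > 0" "\<And>y. y \<noteq> 0 \<Longrightarrow> dist y 0 < y0 \<Longrightarrow> \<kappa> < \<phi>' (\<beta> y) \<and> \<phi>' (\<beta> y) < 2 * \<kappa>"
    unfolding eventually_at by auto
  define \<eta> where "\<eta> = min (y0 / 2) (\<phi> 1 / 2)"
  have \<eta>: "\<eta> > 0" "\<eta> < \<phi> 1" "\<eta> < y0" using y0 \<phi>_1_pos by (auto simp: \<eta>_def)
  have near0: "\<kappa> \<le> \<phi>' (\<beta> y) \<and> \<phi>' (\<beta> y) \<le> 2 * \<kappa>" if "\<bar>y\<bar> \<le> \<eta>" for y
    using y0(2)[of y] that \<eta> \<kappa> \<kappa>2 by (cases "y = 0") (auto simp: \<beta>_0 \<alpha>_def[symmetric] dist_real_def)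

  have lower: "\<eta> * ((m / (1 + m)) ^ n * exp (- e1 / t) - exp (- (e1 + 1) / t)) \<le> v P t" if t: "t > 0" for t
  proof -
    define \<tau> where "\<tau> = m * t"
    have \<tau>: "\<tau> > 0" using m t by (simp add: \<tau>_def)
    have q: "t + \<tau> = (1 + m) * t" by (simp add: \<tau>_def algebra_simps)
    have q0: "t + \<tau> > 0" using t \<tau> by simp
    have "(P - Z) \<bullet> (P - Z) \<le> r\<^sup>2" using PZ power_mono[of "norm (P - Z)" r 2] by (simp add: power2_norm_eq_inner)
    then have "(P - Z) \<bullet> (P - Z) / (4 * \<kappa> * (t + \<tau>)) \<le> r\<^sup>2 / (4 * \<kappa> * t)"
      using \<kappa> t \<tau> by (intro frac_le mult_left_mono) auto
    then have "- e1 / t \<le> - 1 / (4 * \<kappa>) * ((P - Z) \<bullet> (P - Z)) / (t + \<tau>)"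
      by (simp add: e1_def)
    then have "inverse (t + \<tau>) ^ n * exp (- e1 / t) \<le> gaussian (- 1 / (4 * \<kappa>)) (P - Z) (t + \<tau>)"
      unfolding gaussian_def n_def using q0 by (intro mult_left_mono) auto
    then have "\<eta> * \<tau> ^ n * (inverse (t + \<tau>) ^ n * exp (- e1 / t) - inverse \<tau> ^ n * exp (- r0\<^sup>2 / (4 * \<kappa> * \<tau>)))
        \<le> \<eta> * \<tau> ^ n * (gaussian (- 1 / (4 * \<kappa>)) (P - Z) (t + \<tau>) - inverse \<tau> ^ n * exp (- r0\<^sup>2 / (4 * \<kappa> * \<tau>)))"
      using \<eta> \<tau> by (intro mult_left_mono) auto
    also have "\<dots> \<le> v P t"
      using v_lower_bound[OF r0(1) r0\<Omega> \<kappa>(1) \<eta>(1,2) near0 \<tau> PQ(1) t] by (simp add: n_def)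
    also have "\<eta> * \<tau> ^ n * (inverse (t + \<tau>) ^ n * exp (- e1 / t) - inverse \<tau> ^ n * exp (- r0\<^sup>2 / (4 * \<kappa> * \<tau>)))
       = \<eta> * ((\<tau> * inverse (t + \<tau>)) ^ n * exp (- e1 / t) - (\<tau> * inverse \<tau>) ^ n * exp (- r0\<^sup>2 / (4 * \<kappa> * \<tau>)))"
      by (simp add: algebra_simps power_mult_distrib)
    also have "\<tau> * inverse (t + \<tau>) = m / (1 + m)"
      unfolding q unfolding \<tau>_def divide_inverse[symmetric] using t by (intro nonzero_mult_divide_mult_cancel_right) simp
    also have "\<tau> * inverse \<tau> = 1" using \<tau> by simp
    also have "- r0\<^sup>2 / (4 * \<kappa> * \<tau>) = - (e1 + 1) / t"
      using m \<kappa> t e1 r0 by (simp add: \<tau>_def m_def field_simps)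
    finally show ?thesis by simp
  qed

  obtain B T where BT: "B > 0" "T > 0"
    "\<And>\<tau> t. 0 < t \<Longrightarrow> t < \<tau> \<Longrightarrow> \<tau> \<le> T \<Longrightarrow> v Q t \<le> B * (\<tau> / (\<tau> - t)) ^ n * exp (- \<rho>\<^sup>2 / (4 * a * \<tau>))"
    using v_upper_bound[of \<rho> \<rho>' Q a] cball_subset[OF \<rho>'(2)] \<rho>' \<rho> rpos a unfolding n_def by auto
  have upper: "v Q t \<le> B * (1 / l) ^ n * exp (- e2 / t)" if t: "t > 0" "t \<le> T * (1 - l)" for t
  proof -
    \<comment> \<open>Taking \<tau> proportional to t makes the prefactor constant, at the cost of
      multiplying the rate by 1 - l.\<close>
    define \<tau> where "\<tau> = t / (1 - l)"
    have \<tau>: "t < \<tau>" "\<tau> \<le> T" using t l by (auto simp: \<tau>_def field_simps)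
    have "\<tau> / (\<tau> - t) = 1 / l" using t l by (simp add: \<tau>_def field_simps)
    moreover have "- \<rho>\<^sup>2 / (4 * a * \<tau>) = - e2 / t" using t l a by (simp add: \<tau>_def e2_def e2'_def)
    ultimately show ?thesis using BT(3)[OF t(1) \<tau>] by simp
  qed

  define c1 where "c1 = \<eta> * (m / (1 + m)) ^ n"
  define c3 where "c3 = B * (1 / l) ^ n"
  have c1: "c1 > 0" using \<eta> m by (simp add: c1_def)
  \<comment> \<open>The inequality between the two bounds, divided by exp (- e1 / t).\<close>
  have "((\<lambda>t. \<eta> * exp (- 1 / t) + c3 * exp (- (e2 - e1) / t)) \<longlongrightarrow> \<eta> * 0 + c3 * 0) (at_right 0)"
    using e2 by (intro tendsto_intros exp_inverse_tendsto) auto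
  then have "\<forall>\<^sub>F t in at_right 0. \<eta> * exp (- 1 / t) + c3 * exp (- (e2 - e1) / t) < c1"
    using c1 by (intro order_tendstoD(2)) auto
  moreover have "\<forall>\<^sub>F t in at_right 0. t < T * (1 - l)"
    using BT(2) l by (simp add: eventually_at_right_field) (meson diff_gt_0_iff_gt mult_pos_pos)
  ultimately show ?thesis using eventually_at_right_less[of 0]
  proof eventually_elim
    fix t :: real
    assume 1: "\<eta> * exp (- 1 / t) + c3 * exp (- (e2 - e1) / t) < c1" and t: "t < T * (1 - l)" "0 < t"
    have x1: "exp (- 1 / t) * exp (- e1 / t) = exp (- (e1 + 1) / t)"
      by (simp add: exp_add[symmetric] diff_divide_distrib)
    have x2: "exp (- (e2 - e1) / t) * exp (- e1 / t) = exp (- e2 / t)"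
      by (simp add: exp_add[symmetric] diff_divide_distrib)
    have "(\<eta> * exp (- 1 / t) + c3 * exp (- (e2 - e1) / t)) * exp (- e1 / t) < c1 * exp (- e1 / t)"
      using 1 by (intro mult_strict_right_mono) auto
    then have "\<eta> * exp (- (e1 + 1) / t) + c3 * exp (- e2 / t) < c1 * exp (- e1 / t)"
      by (simp only: distrib_right mult.assoc x1 x2)
    then have "v Q t < v P t"
      using lower[OF t(2)] upper[of t] t by (simp add: c1_def c3_def algebra_simps)
    then show "U Q t < U P t" by (simp add: v_def \<phi>_less_iff)
  qed
qed

corollary same_values_same_distance:
  assumes "P \<in> \<Omega>" "Q \<in> \<Omega>" "\<And>t. t > 0 \<Longrightarrow> U P t = U Q t"
  shows "dst P = dst Q"
proof -
  have "\<not> dst P < dst Q" if PQ: "P \<in> \<Omega>" "Q \<in> \<Omega>" "\<And>t. t > 0 \<Longrightarrow> U P t = U Q t" for P Q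
  proof
    assume "dst P < dst Q"
    from distance_order[OF PQ(1,2) this] have "\<forall>\<^sub>F t in at_right 0. U Q t < U P t \<and> 0 < t"
      using eventually_at_right_less[of 0] by (rule eventually_conj)
    then obtain t where "U Q t < U P t" "0 < t"
      using eventually_happens[of _ "at_right (0::real)"] by auto
    then show False using PQ(3) by simp
  qed
  from this[OF assms] this[OF assms(2,1)] assms(3) show ?thesis by force
qed

text \<open>The difference of v and its shift satisfies a linear parabolic inequality whose
  zero-order coefficient comes from comparing \<phi>' at two values of U. Compactness of \<Xi>
  bounds this coefficient for all shifts at once, which makes \<kappa> uniform.\<close>

lemma shift_positivity:
  assumes r: "r > 0" and t: "t1 < t2" "0 < t1"
    and S: "S = (\<lambda>(Y, s). Y + X1 + s *\<^sub>R (X2 - X1)) ` (cball 0 r \<times> {0..1::real})" "S \<subseteq> \<Omega>"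
    and \<Xi>: "compact \<Xi>" "\<And>\<xi> X. \<xi> \<in> \<Xi> \<Longrightarrow> X \<in> \<Omega> \<Longrightarrow> X + \<xi> \<in> \<Omega>"
  obtains \<kappa> where "\<kappa> > 0"
    "\<And>\<xi> m. \<xi> \<in> \<Xi> \<Longrightarrow> m > 0 \<Longrightarrow> (\<And>X. X \<in> cball X1 r \<Longrightarrow> m \<le> v X t1 - v (X + \<xi>) t1) \<Longrightarrow>
       \<kappa> * m \<le> v X2 t2 - v (X2 + \<xi>) t2"
proof -
  have cS: "compact S"
    unfolding S(1) by (intro compact_continuous_image compact_Times compact_cball compact_Icc)
      (auto simp: split_beta intro!: continuous_intros)
  define K where "K = (\<lambda>(X, \<xi>). X + \<xi>) ` (S \<times> \<Xi>)"
  have cK: "compact (K \<times> {t1..t2})"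
    unfolding K_def by (intro compact_continuous_image compact_Times cS \<Xi>(1) compact_Icc)
      (auto simp: split_beta intro!: continuous_intros)
  have K: "K \<subseteq> \<Omega>" using \<Xi>(2) S(2) by (auto simp: K_def)
  have "continuous_on (D \<times> {0<..}) (\<lambda>q. \<Sum>i\<in>Basis. (\<lambda>(X, t). vxx i X t) q)"
    using v_c21 by (intro continuous_on_sum) (simp add: c21_def)
  then have "continuous_on (K \<times> {t1..t2}) (\<lambda>q. \<Sum>i\<in>Basis. (\<lambda>(X, t). vxx i X t) q)"
    by (rule continuous_on_subset) (use K \<Omega>_D t in auto)
  from compact_imp_bounded[OF compact_continuous_image[OF this cK]]
  obtain B where B: "\<And>X s. X \<in> K \<Longrightarrow> t1 \<le> s \<Longrightarrow> s \<le> t2 \<Longrightarrow> \<bar>\<Sum>i\<in>Basis. vxx i X s\<bar> \<le> B"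
    unfolding bounded_iff by (force simp del: sum.cong)
  have "continuous_on {0..1} \<phi>''" using \<phi>_C2 continuous_on_subset by blast
  from compact_imp_bounded[OF compact_continuous_image[OF this compact_Icc]]
  obtain L where L: "\<And>x. 0 \<le> x \<Longrightarrow> x \<le> 1 \<Longrightarrow> \<bar>\<phi>'' x\<bar> \<le> L" unfolding bounded_iff by force
  have L0: "L \<ge> 0" using L[of 0] by linarith
  \<comment> \<open>L bounds \<phi>'' on [0, 1], which contains the values of U; 1 / \<delta>1 turns
    a difference of U into one of v; B bounds the Laplacian of the shifted v.\<close>
  define C where "C = L / \<delta>1 * \<bar>B\<bar>"
  have C: "C \<ge> 0" using L0 \<delta> by (simp add: C_def)
  obtain \<kappa> where \<kappa>: "\<kappa> > 0"
    "\<And>D z zt zx zxx m. c21 D z zt zx zxx \<Longrightarrow> S \<subseteq> D \<Longrightarrow>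
      (\<And>X s. X \<in> S \<Longrightarrow> t1 \<le> s \<Longrightarrow> s \<le> t2 \<Longrightarrow> 0 \<le> z X s) \<Longrightarrow>
      (\<And>X s. X \<in> S \<Longrightarrow> t1 \<le> s \<Longrightarrow> s \<le> t2 \<Longrightarrow>
         \<exists>a\<in>{\<delta>1..\<delta>2}. zt X s \<ge> a * (\<Sum>i\<in>Basis. zxx i X s) - C * z X s) \<Longrightarrow>
      m > 0 \<Longrightarrow> (\<And>Y. Y \<in> cball X1 r \<Longrightarrow> m \<le> z Y t1) \<Longrightarrow> \<kappa> * m \<le> z X2 t2"
    using positivity_propagates[OF r t \<delta> C S(1), of \<delta>2] by blast
  show ?thesis
  proof (rule that[OF \<kappa>(1)])
    fix \<xi> m assume \<xi>: "\<xi> \<in> \<Xi>" and m: "m > 0" and bot: "\<And>X. X \<in> cball X1 r \<Longrightarrow> m \<le> v X t1 - v (X + \<xi>) t1"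
    have sh: "X + \<xi> \<in> \<Omega>" if "X \<in> \<Omega>" for X using \<Xi>(2) \<xi> that by blast
    note v\<Omega> = c21_mono[OF v_c21 \<Omega>_D]
    show "\<kappa> * m \<le> v X2 t2 - v (X2 + \<xi>) t2"
    proof (rule \<kappa>(2)[OF c21_diff[OF v\<Omega> c21_translate[OF v\<Omega> sh]] S(2) _ _ m bot])
      have le: "U (X + \<xi>) s \<le> U X s" if "X \<in> S" "t1 \<le> s" for X s
        using U_shift[OF sh, of X s] that S(2) t by auto
      show nn: "0 \<le> v X s - v (X + \<xi>) s" if "X \<in> S" "t1 \<le> s" for X s
        using le[OF that] by (simp add: v_def \<phi>_le_iff)
      show "\<exists>a\<in>{\<delta>1..\<delta>2}. vt X s - vt (X + \<xi>) s \<ge> a * (\<Sum>i\<in>Basis. vxx i X s - vxx i (X + \<xi>) s) - C * (v X s - v (X + \<xi>) s)"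
        if X: "X \<in> S" "t1 \<le> s" "s \<le> t2" for X s
      proof (intro bexI[of _ "\<phi>' (U X s)"])
        have s: "s > 0" using X t by simp
        have "X \<in> \<Omega>" using X S(2) by blast
        then have XD: "X \<in> D" "X + \<xi> \<in> D" using sh[of X] \<Omega>_D by auto
        define x y where "x = U X s" and "y = U (X + \<xi>) s"
        have xy: "0 \<le> y" "y \<le> x" "x \<le> 1" using U_range[OF XD(1) s] U_range[OF XD(2) s] le[OF X(1,2)] by (auto simp: x_def y_def)
        have d: "x - y \<le> (v X s - v (X + \<xi>) s) / \<delta>1"
          using \<phi>_diff(1)[OF xy(2)] \<delta> by (simp add: v_def x_def y_def field_simps)
        have "\<bar>\<phi>' x - \<phi>' y\<bar> \<le> L * (x - y)"
        proof (cases "x = y")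
          case False
          then obtain c where c: "y < c" "c < x" "\<phi>' x - \<phi>' y = (x - y) * \<phi>'' c"
            using MVT2[of y x \<phi>' \<phi>''] \<phi>_deriv2 xy by force
          have "\<bar>\<phi>' x - \<phi>' y\<bar> = (x - y) * \<bar>\<phi>'' c\<bar>" using c xy by (simp add: abs_mult)
          also have "\<dots> \<le> (x - y) * L" using L[of c] c xy by (intro mult_left_mono) auto
          finally show ?thesis by (simp add: mult.commute)
        qed simp
        also have "\<dots> \<le> L * ((v X s - v (X + \<xi>) s) / \<delta>1)" by (rule mult_left_mono[OF d L0])
        finally have 1: "\<bar>\<phi>' x - \<phi>' y\<bar> \<le> L / \<delta>1 * (v X s - v (X + \<xi>) s)" by simp
        define Q where "Q = (\<Sum>i\<in>Basis. vxx i (X + \<xi>) s)"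
        have "X + \<xi> \<in> K" using X(1) \<xi> by (auto simp: K_def)
        then have Q: "\<bar>Q\<bar> \<le> \<bar>B\<bar>" using B[of "X + \<xi>" s] X by (simp add: Q_def)
        have "\<bar>(\<phi>' x - \<phi>' y) * Q\<bar> \<le> (L / \<delta>1 * (v X s - v (X + \<xi>) s)) * \<bar>B\<bar>"
          unfolding abs_mult using 1 Q nn[OF X(1,2)] L0 \<delta> by (intro mult_mono) auto
        also have "\<dots> = C * (v X s - v (X + \<xi>) s)" by (simp add: C_def)
        finally have "- (C * (v X s - v (X + \<xi>) s)) \<le> (\<phi>' x - \<phi>' y) * Q" by (simp add: abs_le_iff)
        moreover have "vt X s - vt (X + \<xi>) s = \<phi>' x * (\<Sum>i\<in>Basis. vxx i X s - vxx i (X + \<xi>) s) + (\<phi>' x - \<phi>' y) * Q"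
          unfolding vt_eq[OF XD(1) s] vt_eq[OF XD(2) s] x_def[symmetric] y_def[symmetric] Q_def sum_subtractf
          by (simp add: algebra_simps)
        ultimately show "vt X s - vt (X + \<xi>) s \<ge> \<phi>' (U X s) * (\<Sum>i\<in>Basis. vxx i X s - vxx i (X + \<xi>) s) - C * (v X s - v (X + \<xi>) s)"
          unfolding x_def by linarith
      qed (use \<phi>_bounds in auto)
    qed
  qed
qed

text \<open>From a point strictly below the graph, a short step towards X stays in the complement
  and comes nearer to X.\<close>

lemma nearest_on_graph:
  assumes X: "X \<in> \<Omega>" and Z: "Z \<in> - \<Omega>" "dist X Z = dst X"
  shows "snd Z = f (fst Z)"
proof (rule ccontr)
  assume "snd Z \<noteq> f (fst Z)"
  then have lt: "snd Z < f (fst Z)" using Z(1) mem_\<Omega>[of "fst Z" "snd Z"] by simp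
  have "open {p. snd p < f (fst p)}"
    by (auto intro!: open_Collect_less continuous_intros continuous_on_compose2[OF f_cont])
  then obtain e where e: "e > 0" "ball Z e \<subseteq> {p. snd p < f (fst p)}"
    using lt open_contains_ball by blast
  have dpos: "dst X > 0" using X dst_pos by blast
  define d where "d = min 1 (e / (2 * dst X))"
  have d: "0 < d" "d \<le> 1" "d \<le> e / (2 * dst X)" using e dpos by (auto simp: d_def)
  define Y where "Y = Z + d *\<^sub>R (X - Z)"
  have "dist Z Y = d * dst X" using d Z(2) by (simp add: Y_def dist_norm)
  also have "\<dots> \<le> e / (2 * dst X) * dst X" using d dpos by (intro mult_right_mono) auto
  also have "\<dots> < e" using dpos e by simp
  finally have "Y \<in> ball Z e" by simp
  then have "snd Y < f (fst Y)" using e by auto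
  then have "Y \<in> - \<Omega>" using mem_\<Omega>[of "fst Y" "snd Y"] by simp
  then have "dst X \<le> dist X Y" by (rule dst_le)
  also have "X - Y = (1 - d) *\<^sub>R (X - Z)" by (simp add: Y_def algebra_simps)
  then have "dist X Y = (1 - d) * dst X" using d Z(2) by (simp add: dist_norm)
  finally show False using mult_pos_pos[OF d(1) dpos] by (simp add: algebra_simps)
qed

text \<open>Lowering by h a nearest point of the raised X preserves the distance but leaves it
  strictly below the graph, where no nearest point of X can lie.\<close>

lemma dst_vertical:
  assumes X: "X \<in> \<Omega>" and h: "h > 0"
  shows "dst X < dst (X + (0, h))"
proof (rule ccontr)
  assume "\<not> dst X < dst (X + (0, h))"
  then have le: "dst (X + (0, h)) \<le> dst X" by simp
  obtain Z where Z: "Z \<in> - \<Omega>" "dist (X + (0, h)) Z = dst (X + (0, h))" by (rule nearest_point)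
  obtain z s where zs: "Z = (z, s)" by force
  define Y where "Y = (z, s - h)"
  have "s \<le> f z" using Z(1) by (simp add: zs mem_\<Omega>)
  then have Y: "Y \<in> - \<Omega>" using h by (simp add: Y_def mem_\<Omega>)
  have "X + (0, h) - Z = X - Y" by (cases X) (simp add: zs Y_def)
  then have "dist X Y = dst (X + (0, h))" using Z(2) by (simp only: dist_norm)
  then have "dist X Y = dst X" using le dst_le[OF Y, of X] by simp
  then have "snd Y = f (fst Y)" by (rule nearest_on_graph[OF X Y])
  then show False using \<open>s \<le> f z\<close> h by (simp add: Y_def)
qed

lemma upward_shift: "X \<in> \<Omega> \<Longrightarrow> h \<ge> 0 \<Longrightarrow> X + (0, h) \<in> \<Omega>"
  by (cases X) (auto simp: mem_\<Omega>)

abbreviation up :: "(real^'n) \<times> real" where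
  "up \<equiv> (0, 1)"

lemma up_Basis: "up \<in> Basis"
  by (simp add: Basis_prod_def)

text \<open>The short-time order and the mean value theorem give a point X1 above P with negative
  vertical derivative at an early time t1. Near X1 an upward shift by h then lowers v by at least c
  h; this spreads to P with a factor \<kappa> common to all small h, and so survives division by
  h.\<close>

lemma vertical_derivative_negative:
  assumes P: "P \<in> \<Omega>" and t: "t > 0"
  shows "Ux up P t < 0"
proof -
  have "P + (0, 1) \<in> \<Omega>" using upward_shift[OF P] by simp
  from distance_order[OF P this dst_vertical[OF P]]
  have "\<forall>\<^sub>F s in at_right 0. U (P + (0, 1)) s < U P s" by simp
  moreover have "\<forall>\<^sub>F s in at_right 0. 0 < s \<and> s < t"
    using t by (auto simp: eventually_at_right_field)
  ultimately have "\<forall>\<^sub>F s in at_right 0. U (P + (0, 1)) s < U P s \<and> 0 < s \<and> s < t" by eventually_elim auto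
  then obtain t1 where t1: "U (P + (0, 1)) t1 < U P t1" "0 < t1" "t1 < t"
    using eventually_happens[of _ "at_right (0::real)"] by auto
  have line: "((\<lambda>h. v (X + h *\<^sub>R up) s) has_real_derivative vx up (X + h *\<^sub>R up) s) (at h)"
    if "X \<in> \<Omega>" "h \<ge> 0" "s > 0" for X h s
  proof (rule line_derivative_shift[where G = "\<lambda>X. v X s"])
    have "X + h *\<^sub>R up \<in> D" using upward_shift[OF that(1,2)] \<Omega>_D by auto
    then show "((\<lambda>k. v (X + h *\<^sub>R up + k *\<^sub>R up) s) has_real_derivative vx up (X + h *\<^sub>R up) s) (at 0)"
      using v_c21 up_Basis that(3) by (simp add: c21_def del: scaleR_Pair)
  qed
  have "\<exists>h>0. h < 1 \<and> v (P + 1 *\<^sub>R up) t1 - v (P + 0 *\<^sub>R up) t1 = (1 - 0) * vx up (P + h *\<^sub>R up) t1"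
    by (rule MVT2) (use line[OF P] t1 in auto)
  then obtain h0 where h0: "0 < h0" "h0 < 1" "v (P + (0, 1)) t1 - v P t1 = vx up (P + (0, h0)) t1"
    by (auto simp: zero_prod_def[symmetric])
  define X1 where "X1 = P + (0, h0)"
  have X1: "X1 \<in> \<Omega>" using upward_shift[OF P] h0 by (simp add: X1_def)
  define c where "c = - vx up X1 t1 / 2"
  have "v (P + (0, 1)) t1 < v P t1" using t1 by (simp add: v_def \<phi>_less_iff)
  then have c: "c > 0" using h0(3) by (simp add: c_def X1_def)
  have "continuous_on D (\<lambda>X. (\<lambda>(X, t). vx up X t) (X, t1))"
    by (rule continuous_on_compose2[of "D \<times> {0<..}"])
      (use v_c21 up_Basis t1 in \<open>auto simp: c21_def intro!: continuous_intros\<close>)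
  then have "isCont (\<lambda>X. vx up X t1) X1"
    using X1 \<Omega>_D open_D by (auto simp: continuous_on_eq_continuous_at)
  then have "\<forall>\<^sub>F X in at X1. vx up X t1 < - c"
    using c by (intro order_tendstoD(2)) (auto simp: isCont_def c_def)
  then obtain r1 where r1: "r1 > 0" "\<And>X. X \<noteq> X1 \<Longrightarrow> dist X X1 < r1 \<Longrightarrow> vx up X t1 < - c"
    unfolding eventually_at by auto
  have r1': "vx up X t1 \<le> - c" if "dist X X1 < r1" for X
    using r1(2)[of X] that c by (cases "X = X1") (auto simp: c_def)
  obtain r2 where r2: "r2 > 0" "cball P r2 \<subseteq> \<Omega>" using P open_\<Omega> open_contains_cball by blast
  \<comment> \<open>A third of r1, so that points of the r-ball about X1, raised by at most r, still
    lie within r1 of X1.\<close>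
  define r where "r = min (r1 / 3) r2"
  have r: "0 < r" "r \<le> r2" "2 * r < r1" using r1 r2 by (auto simp: r_def min_def)
  define S where "S = (\<lambda>(Y, s). Y + X1 + s *\<^sub>R (P - X1)) ` (cball 0 r \<times> {0..1::real})"
  have S: "S \<subseteq> \<Omega>"
  proof
    fix X assume "X \<in> S"
    then obtain Y s where Y: "Y \<in> cball 0 r" "0 \<le> s" "s \<le> 1" "X = Y + X1 + s *\<^sub>R (P - X1)" by (auto simp: S_def)
    have "P + Y \<in> cball P r2" using Y(1) r by (simp add: dist_norm)
    then have "P + Y \<in> \<Omega>" using r2 by blast
    moreover have "X = (P + Y) + (0, (1 - s) * h0)"
      unfolding Y(4) X1_def by (cases P, cases Y) (simp add: algebra_simps)
    moreover have "(1 - s) * h0 \<ge> 0" using Y h0 by simp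
    ultimately show "X \<in> \<Omega>" by (simp only: upward_shift)
  qed
  define \<Xi> where "\<Xi> = (\<lambda>k. (0 :: real^'n, k)) ` {0..r}"
  have \<Xi>: "compact \<Xi>" unfolding \<Xi>_def by (intro compact_continuous_image continuous_intros compact_Icc)
  have \<Xi>2: "\<xi> \<in> \<Xi> \<Longrightarrow> X \<in> \<Omega> \<Longrightarrow> X + \<xi> \<in> \<Omega>" for \<xi> X by (auto simp: \<Xi>_def intro!: upward_shift)
  obtain \<kappa> where \<kappa>: "\<kappa> > 0"
    "\<And>\<xi> m. \<xi> \<in> \<Xi> \<Longrightarrow> m > 0 \<Longrightarrow> (\<And>X. X \<in> cball X1 r \<Longrightarrow> m \<le> v X t1 - v (X + \<xi>) t1) \<Longrightarrow>
       \<kappa> * m \<le> v P t - v (P + \<xi>) t"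
    using shift_positivity[OF r(1) t1(3,2) S_def S \<Xi> \<Xi>2] by blast
  have X1r: "X \<in> \<Omega>" if "X \<in> cball X1 r" for X
  proof -
    have "X = (\<lambda>(Y, s). Y + X1 + s *\<^sub>R (P - X1)) (X - X1, 0)" by simp
    moreover have "(X - X1, 0) \<in> cball 0 r \<times> {0..1::real}" using that by (simp add: dist_norm norm_minus_commute)
    ultimately have "X \<in> S" unfolding S_def by (rule image_eqI)
    then show ?thesis using S by blast
  qed
  have quot: "(v (P + h *\<^sub>R up) t - v P t) / h \<le> - (\<kappa> * c)" if h: "0 < h" "h \<le> r" for h
  proof -
    have "\<kappa> * (c * h) \<le> v P t - v (P + (0, h)) t"
    proof (rule \<kappa>(2))
      show "(0, h) \<in> \<Xi>" using h by (auto simp: \<Xi>_def)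
      show "c * h > 0" using c h by simp
      fix X assume X: "X \<in> cball X1 r"
      have "\<exists>k>0. k < h \<and> v (X + h *\<^sub>R up) t1 - v (X + 0 *\<^sub>R up) t1 = (h - 0) * vx up (X + k *\<^sub>R up) t1"
        by (rule MVT2) (use line[OF X1r[OF X]] t1 h in auto)
      then obtain k where k: "0 < k" "k < h" "v (X + (0, h)) t1 - v X t1 = h * vx up (X + (0, k)) t1"
        by (auto simp: zero_prod_def[symmetric])
      have "dist (X + (0, k)) X1 \<le> dist (X + (0, k)) X + dist X X1" by (rule dist_triangle)
      also have "\<dots> < r1" using X k h r by (auto simp: dist_norm norm_minus_commute)
      finally have "h * vx up (X + (0, k)) t1 \<le> h * (- c)" using h by (intro mult_left_mono r1') auto
      then show "c * h \<le> v X t1 - v (X + (0, h)) t1" using k by (simp add: mult.commute)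
    qed
    then show ?thesis using h by (simp add: field_simps)
  qed
  have PD: "P \<in> D" using P \<Omega>_D by auto
  have "((\<lambda>h. v (P + h *\<^sub>R up) t) has_real_derivative vx up P t) (at 0)"
    using v_c21 up_Basis PD t unfolding c21_def by blast
  then have "((\<lambda>h. (v (P + h *\<^sub>R up) t - v P t) / h) \<longlongrightarrow> vx up P t) (at 0)"
    by (simp add: DERIV_def zero_prod_def[symmetric])
  then have "((\<lambda>h. (v (P + h *\<^sub>R up) t - v P t) / h) \<longlongrightarrow> vx up P t) (at_right 0)"
    by (simp add: filterlim_at_split)
  then have "vx up P t \<le> - (\<kappa> * c)"
  proof (rule tendsto_upperbound)
    show "\<forall>\<^sub>F h in at_right 0. (v (P + h *\<^sub>R up) t - v P t) / h \<le> - (\<kappa> * c)"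
      unfolding eventually_at_right_field using quot r(1) by (intro exI[of _ r]) auto
  qed simp
  then have "\<phi>' (U P t) * Ux up P t < 0" using mult_pos_pos[OF \<kappa>(1) c] by (simp add: vx_def)
  then show ?thesis using \<phi>'_pos[of "U P t"] by (simp add: mult_less_0_iff)
qed

text \<open>The strong maximum principle in forward form: the tube around the segment is thin enough
  to stay in \<Omega>, and the family of shifts consists of \<xi> alone.\<close>

lemma shift_strict_propagates:
  assumes \<xi>: "\<And>X. X \<in> \<Omega> \<Longrightarrow> X + \<xi> \<in> \<Omega>" and seg: "closed_segment X1 X2 \<subseteq> \<Omega>"
    and t: "0 < t1" "t1 < t2" and lt: "U (X1 + \<xi>) t1 < U X1 t1"
  shows "U (X2 + \<xi>) t2 < U X2 t2"
proof -
  obtain e where e: "e > 0" "(\<Union>x\<in>closed_segment X1 X2. cball x e) \<subseteq> \<Omega>"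
    using compact_subset_open_imp_cball_epsilon_subset[OF compact_segment open_\<Omega> seg] by blast
  have X1: "X1 \<in> \<Omega>" using seg by auto
  define m where "m = (v X1 t1 - v (X1 + \<xi>) t1) / 2"
  have m: "m > 0" using lt by (simp add: m_def v_def \<phi>_less_iff)
  have c: "continuous_on \<Omega> (\<lambda>X. v X t1)"
    unfolding v_def by (rule continuous_on_compose2[OF \<phi>_cont(1)[of UNIV]])
      (use U_slice_cont[OF t(1)] \<Omega>_D continuous_on_subset in auto)
  have "continuous_on \<Omega> (\<lambda>X. v X t1 - v (X + \<xi>) t1)"
    by (intro continuous_on_diff c continuous_on_compose2[OF c]) (use \<xi> in \<open>auto intro!: continuous_intros\<close>)
  then have "isCont (\<lambda>X. v X t1 - v (X + \<xi>) t1) X1"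
    using X1 open_\<Omega> by (auto simp: continuous_on_eq_continuous_at)
  then have "\<forall>\<^sub>F X in at X1. m < v X t1 - v (X + \<xi>) t1"
    using m by (intro order_tendstoD(1)) (auto simp: isCont_def m_def)
  then obtain r1 where r1: "r1 > 0" "\<And>X. X \<noteq> X1 \<Longrightarrow> dist X X1 < r1 \<Longrightarrow> m < v X t1 - v (X + \<xi>) t1"
    unfolding eventually_at by auto
  have r1': "m \<le> v X t1 - v (X + \<xi>) t1" if "dist X X1 < r1" for X
    using r1(2)[of X] that m by (cases "X = X1") (auto simp: m_def)
  define r where "r = min e (r1 / 2)"
  have r: "r > 0" "r \<le> e" "r < r1" using e r1 by (auto simp: r_def)
  define S where "S = (\<lambda>(Y, s). Y + X1 + s *\<^sub>R (X2 - X1)) ` (cball 0 r \<times> {0..1::real})"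
  have S: "S \<subseteq> \<Omega>"
  proof
    fix X assume "X \<in> S"
    then obtain Y s where Y: "Y \<in> cball 0 r" "0 \<le> s" "s \<le> 1" "X = Y + X1 + s *\<^sub>R (X2 - X1)" by (auto simp: S_def)
    define W where "W = X1 + s *\<^sub>R (X2 - X1)"
    have "W \<in> closed_segment X1 X2" unfolding closed_segment_def W_def
      using Y by (intro CollectI exI[of _ s]) (simp add: algebra_simps)
    moreover have "X \<in> cball W e" using Y r by (simp add: W_def dist_norm)
    ultimately show "X \<in> \<Omega>" using e(2) by blast
  qed
  obtain \<kappa> where \<kappa>: "\<kappa> > 0"
    "\<And>\<xi>' m. \<xi>' \<in> {\<xi>} \<Longrightarrow> m > 0 \<Longrightarrow> (\<And>X. X \<in> cball X1 r \<Longrightarrow> m \<le> v X t1 - v (X + \<xi>') t1) \<Longrightarrow>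
       \<kappa> * m \<le> v X2 t2 - v (X2 + \<xi>') t2"
    using shift_positivity[OF r(1) t(2,1) S_def S, of "{\<xi>}"] \<xi> by auto
  have "\<kappa> * m \<le> v X2 t2 - v (X2 + \<xi>) t2"
    by (rule \<kappa>(2)) (use m r r1' in \<open>auto simp: dist_commute\<close>)
  moreover have "\<kappa> * m > 0" using \<kappa>(1) m by simp
  ultimately have "v (X2 + \<xi>) t2 < v X2 t2" by linarith
  then show ?thesis by (simp add: v_def \<phi>_less_iff)
qed

text \<open>By contraposition: strictness at X and t is carried forward to P at a later time,
  whereas equality at P is assumed at all times.\<close>

lemma shift_rigidity:
  assumes \<xi>: "\<And>X. X \<in> \<Omega> \<Longrightarrow> X + \<xi> \<in> \<Omega>" and P: "P \<in> \<Omega>" "\<And>t. t > 0 \<Longrightarrow> U (P + \<xi>) t = U P t"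
    and X: "X \<in> \<Omega>" and t: "t > 0"
  shows "U (X + \<xi>) t = U X t"
proof (rule ccontr)
  assume "U (X + \<xi>) t \<noteq> U X t"
  then have lt: "U (X + \<xi>) t < U X t" using U_shift[OF \<xi> X t] by simp
  obtain x s where xs: "X = (x, s)" by force
  obtain p q where pq: "P = (p, q)" by force
  have "compact (f ` closed_segment x p)"
    by (intro compact_continuous_image continuous_on_subset[OF f_cont]) auto
  then obtain M where M: "\<And>w. w \<in> closed_segment x p \<Longrightarrow> f w \<le> M"
    using compact_imp_bounded[of "f ` closed_segment x p"] by (auto simp: bounded_iff abs_le_iff)
  \<comment> \<open>H lies above the graph over the whole horizontal segment and is at least the
    heights of X and P: the path goes up, across and down, and each leg takes one unit of
    time.\<close>
  define H where "H = max (M + 1) (max s q)"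
  have vert: "closed_segment (w, a) (w, b) \<subseteq> \<Omega>" if "f w < a" "f w < b" for w a b
  proof
    fix Y assume "Y \<in> closed_segment (w, a) (w, b)"
    then obtain u where u: "0 \<le> u" "u \<le> 1" "Y = (1 - u) *\<^sub>R (w, a) + u *\<^sub>R (w, b)" by (auto simp: closed_segment_def)
    have "f w < (1 - u) * a + u * b"
      using convex_bound_lt[of "- a" "- f w" "- b" "1 - u" u] that u by simp
    then show "Y \<in> \<Omega>" unfolding u(3) by (simp add: mem_\<Omega> flip: scaleR_add_left)
  qed
  have s1: "closed_segment X (x, H) \<subseteq> \<Omega>"
    unfolding xs using X M[of x] by (intro vert) (auto simp: xs mem_\<Omega> H_def)
  have s2: "closed_segment (x, H) (p, H) \<subseteq> \<Omega>"
  proof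
    fix Y assume "Y \<in> closed_segment (x, H) (p, H)"
    then obtain u where u: "0 \<le> u" "u \<le> 1" "Y = (1 - u) *\<^sub>R (x, H) + u *\<^sub>R (p, H)" by (auto simp: closed_segment_def)
    have "(1 - u) *\<^sub>R x + u *\<^sub>R p \<in> closed_segment x p" using u by (auto simp: closed_segment_def)
    then have "f ((1 - u) *\<^sub>R x + u *\<^sub>R p) < H" using M by (force simp: H_def)
    then show "Y \<in> \<Omega>" unfolding u(3) by (simp add: mem_\<Omega> algebra_simps)
  qed
  have s3: "closed_segment (p, H) P \<subseteq> \<Omega>"
    unfolding pq using P M[of p] by (intro vert) (auto simp: pq mem_\<Omega> H_def)
  have 1: "U ((x, H) + \<xi>) (t + 1) < U (x, H) (t + 1)"
    by (rule shift_strict_propagates[OF \<xi> s1 t less_add_one lt])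
  have 2: "U ((p, H) + \<xi>) (t + 1 + 1) < U (p, H) (t + 1 + 1)"
    using t by (intro shift_strict_propagates[OF \<xi> s2 _ less_add_one 1]) auto
  have "U (P + \<xi>) (t + 1 + 1 + 1) < U P (t + 1 + 1 + 1)"
    using t by (intro shift_strict_propagates[OF \<xi> s3 _ less_add_one 2]) auto
  then show False using P(2)[of "t + 1 + 1 + 1"] t by simp
qed

end

subsection \<open>Geometry of a stationary level surface\<close>

text \<open>Only coordinate derivatives are given. Coordinates are added one at a time, each
  increment being handled by the mean value theorem and continuity of the corresponding partial
  derivative.\<close>

lemma directional_derivative:
  fixes u :: "'a::euclidean_space \<Rightarrow> real"
  assumes D: "open D" "P \<in> D"
    and c: "\<And>i. i \<in> Basis \<Longrightarrow> continuous_on D (ux i)"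
    and d: "\<And>i X. i \<in> Basis \<Longrightarrow> X \<in> D \<Longrightarrow> ((\<lambda>h. u (X + h *\<^sub>R i)) has_real_derivative ux i X) (at 0)"
  shows "((\<lambda>h. (u (P + h *\<^sub>R \<xi>) - u P) / h) \<longlongrightarrow> (\<Sum>i\<in>Basis. (\<xi> \<bullet> i) * ux i P)) (at_right 0)"
proof -
  have "((\<lambda>h. (u (P + h *\<^sub>R (\<Sum>i\<in>A. (\<xi> \<bullet> i) *\<^sub>R i)) - u P) / h) \<longlongrightarrow> (\<Sum>i\<in>A. (\<xi> \<bullet> i) * ux i P)) (at_right 0)"
    if "finite A" "A \<subseteq> Basis" for A
    using that
  proof (induction A)
    case empty
    then show ?case by simp
  next
    case (insert j A)
    define \<eta> where "\<eta> = (\<Sum>i\<in>A. (\<xi> \<bullet> i) *\<^sub>R i)"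
    define k where "k = \<xi> \<bullet> j"
    have j: "j \<in> Basis" using insert by simp
    have IH: "((\<lambda>h. (u (P + h *\<^sub>R \<eta>) - u P) / h) \<longlongrightarrow> (\<Sum>i\<in>A. (\<xi> \<bullet> i) * ux i P)) (at_right 0)"
      using insert unfolding \<eta>_def by simp
    have "((\<lambda>h. (u (P + h *\<^sub>R \<eta> + (h * k) *\<^sub>R j) - u (P + h *\<^sub>R \<eta>)) / h) \<longlongrightarrow> k * ux j P) (at_right 0)"
    proof (rule tendstoI)
      fix e :: real assume e: "e > 0"
      define e' where "e' = e / (\<bar>k\<bar> + 1)"
      have e': "e' > 0" "\<bar>k\<bar> * e' < e" using e by (auto simp: e'_def field_simps)
      have "isCont (ux j) P" using c[OF j] D by (simp add: continuous_on_eq_continuous_at)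
      then obtain r1 where r1: "r1 > 0" "\<And>X. dist X P < r1 \<Longrightarrow> dist (ux j X) (ux j P) < e'"
        using e'(1) unfolding continuous_at_eps_delta by blast
      obtain r2 where r2: "r2 > 0" "ball P r2 \<subseteq> D" using D open_contains_ball by blast
      define N where "N = norm \<eta> + \<bar>k\<bar> + 1"
      have N: "N > 0" by (simp add: N_def add_nonneg_pos)
      define b where "b = min r1 r2 / N"
      have b: "b > 0" using r1 r2 N by (simp add: b_def)
      have "dist ((u (P + h *\<^sub>R \<eta> + (h * k) *\<^sub>R j) - u (P + h *\<^sub>R \<eta>)) / h) (k * ux j P) < e" if h: "0 < h" "h < b" for h
      proof -
        define Q where "Q s = P + h *\<^sub>R \<eta> + s *\<^sub>R ((h * k) *\<^sub>R j)" for s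
        have Q: "dist (Q s) P < min r1 r2" if "0 \<le> s" "s \<le> 1" for s
        proof -
          have "norm (h *\<^sub>R \<eta> + s *\<^sub>R ((h * k) *\<^sub>R j)) \<le> h * norm \<eta> + s * (h * \<bar>k\<bar>)"
            using norm_triangle_ineq[of "h *\<^sub>R \<eta>" "s *\<^sub>R ((h * k) *\<^sub>R j)"] h j that by (simp add: abs_mult)
          also have "\<dots> \<le> h * norm \<eta> + 1 * (h * \<bar>k\<bar>)" using h that by (intro add_mono mult_right_mono) auto
          also have "\<dots> < h * N" using h by (simp add: N_def algebra_simps)
          also have "\<dots> < b * N" using h N by (intro mult_strict_right_mono) auto
          also have "\<dots> = min r1 r2" using N by (simp add: b_def)
          finally show ?thesis by (simp add: Q_def dist_norm add.assoc)
        qed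
        have der: "((\<lambda>s. u (Q s)) has_real_derivative (h * k) * ux j (Q s)) (at s)" if "0 \<le> s" "s \<le> 1" for s
        proof -
          have "Q s \<in> ball P r2" using Q[OF that] by (simp add: dist_commute)
          then have QD: "Q s \<in> D" using r2 by blast
          have "((\<lambda>x. u (P + h *\<^sub>R \<eta> + x *\<^sub>R j)) has_real_derivative ux j (Q s)) (at (s * (h * k)))"
            using d[OF j QD] unfolding Q_def
            by (intro line_derivative_shift[where G = u and X = "P + h *\<^sub>R \<eta>" and i = j]) simp
          moreover have "((\<lambda>s. s * (h * k)) has_real_derivative h * k) (at s)" by (auto intro!: derivative_eq_intros)
          ultimately show ?thesis
            using DERIV_chain'[of "\<lambda>s. s * (h * k)" "h * k" s UNIV "\<lambda>x. u (P + h *\<^sub>R \<eta> + x *\<^sub>R j)" "ux j (Q s)"]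
            by (simp add: Q_def mult.commute)
        qed
        have "\<exists>s>0. s < 1 \<and> u (Q 1) - u (Q 0) = (1 - 0) * ((h * k) * ux j (Q s))"
          by (rule MVT2) (use der in auto)
        then obtain s where s: "0 < s" "s < 1" "u (Q 1) - u (Q 0) = h * k * ux j (Q s)" by auto
        have "(u (P + h *\<^sub>R \<eta> + (h * k) *\<^sub>R j) - u (P + h *\<^sub>R \<eta>)) / h = k * ux j (Q s)"
          using s(3) h by (simp add: Q_def)
        moreover have "dist (k * ux j (Q s)) (k * ux j P) = \<bar>k\<bar> * dist (ux j (Q s)) (ux j P)"
          by (simp add: dist_real_def abs_mult right_diff_distrib flip: abs_mult)
        moreover have "\<bar>k\<bar> * dist (ux j (Q s)) (ux j P) \<le> \<bar>k\<bar> * e'"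
          using r1(2)[of "Q s"] Q[of s] s by (intro mult_left_mono) auto
        ultimately show ?thesis using e'(2) by simp
      qed
      then show "\<forall>\<^sub>F h in at_right 0. dist ((u (P + h *\<^sub>R \<eta> + (h * k) *\<^sub>R j) - u (P + h *\<^sub>R \<eta>)) / h) (k * ux j P) < e"
        unfolding eventually_at_right_field using b by blast
    qed
    from tendsto_add[OF this IH] show ?case
      using insert by (simp add: \<eta>_def k_def algebra_simps diff_divide_distrib add_divide_distrib)
  qed
  from this[OF finite_Basis order_refl] show ?thesis by (simp add: euclidean_representation)
qed

text \<open>Tilting towards \<nu> extends nonnegativity to the bounding hyperplane, which contains
  the negative of each of its vectors; so G has no tangential part.\<close>

lemma half_space_gradient:
  fixes G \<nu> :: "'a::real_inner"
  assumes \<nu>: "norm \<nu> = 1" and pos: "\<And>\<xi>. \<xi> \<bullet> \<nu> > 0 \<Longrightarrow> G \<bullet> \<xi> \<ge> 0"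
  shows "G = norm G *\<^sub>R \<nu>"
proof -
  have \<nu>\<nu>: "\<nu> \<bullet> \<nu> = 1" using \<nu> by (simp add: dot_square_norm)
  have nonneg: "G \<bullet> \<xi> \<ge> 0" if "\<xi> \<bullet> \<nu> = 0" for \<xi>
  proof (rule ccontr)
    assume neg: "\<not> G \<bullet> \<xi> \<ge> 0"
    \<comment> \<open>Small enough that the tilt raises \<open>G \<bullet> \<xi>\<close> by at most
      half of its modulus.\<close>
    define e where "e = - (G \<bullet> \<xi>) / (2 * (\<bar>G \<bullet> \<nu>\<bar> + 1))"
    have e: "e > 0" unfolding e_def using neg by (intro divide_pos_pos) auto
    have "(\<xi> + e *\<^sub>R \<nu>) \<bullet> \<nu> > 0" using that e \<nu>\<nu> by (simp add: inner_add_left)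
    from pos[OF this] have "0 \<le> G \<bullet> \<xi> + e * (G \<bullet> \<nu>)" by (simp add: inner_add_right)
    also have "e * (G \<bullet> \<nu>) \<le> e * (\<bar>G \<bullet> \<nu>\<bar> + 1)" using e by (intro mult_left_mono) auto
    also have "\<dots> = - (G \<bullet> \<xi>) / 2"
    proof -
      have "- a / (2 * b) * b = - a / 2" if "b \<noteq> 0" for a b :: real using that by simp
      moreover have "\<bar>G \<bullet> \<nu>\<bar> + 1 \<noteq> 0" by linarith
      ultimately show ?thesis unfolding e_def by blast
    qed
    finally show False using neg by simp
  qed
  define \<xi> where "\<xi> = G - (G \<bullet> \<nu>) *\<^sub>R \<nu>"
  have \<xi>: "\<xi> \<bullet> \<nu> = 0" by (simp add: \<xi>_def inner_diff_left \<nu>\<nu>)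
  have "G \<bullet> \<xi> \<ge> 0" "G \<bullet> (- \<xi>) \<ge> 0" using nonneg[of \<xi>] nonneg[of "- \<xi>"] \<xi> by auto
  then have "G \<bullet> \<xi> = 0" by simp
  moreover have "\<xi> \<bullet> \<xi> = G \<bullet> \<xi> - (G \<bullet> \<nu>) * (\<xi> \<bullet> \<nu>)" by (simp add: \<xi>_def inner_diff_left inner_commute)
  ultimately have "\<xi> = 0" using \<xi> by simp
  then have G: "G = (G \<bullet> \<nu>) *\<^sub>R \<nu>" by (simp add: \<xi>_def)
  have "G \<bullet> \<nu> \<ge> 0" using pos[of \<nu>] \<nu>\<nu> by simp
  then have "norm G = G \<bullet> \<nu>" using arg_cong[OF G, of norm] \<nu> by simp
  then show ?thesis using G by simp
qed

locale stationary_surface = graph_diffusion \<phi> \<phi>' \<phi>'' \<delta>1 \<delta>2 f \<Omega> D U Ut Ux Uxx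
  for \<phi> \<phi>' \<phi>'' \<delta>1 \<delta>2 and f :: "real^'n \<Rightarrow> real" and \<Omega> D U Ut Ux Uxx +
  fixes \<Gamma> :: "((real^'n) \<times> real) set"
  assumes \<Gamma>: "stationary_level_surface \<Omega> U \<Gamma>"
begin

lemma \<Gamma>_parts:
  shows \<Gamma>_ne: "\<Gamma> \<noteq> {}" and \<Gamma>_sub: "\<Gamma> \<subseteq> \<Omega>" and \<Gamma>_closed: "closedin (top_of_set \<Omega>) \<Gamma>"
    and \<Gamma>_const: "P \<in> \<Gamma> \<Longrightarrow> Q \<in> \<Gamma> \<Longrightarrow> t > 0 \<Longrightarrow> U P t = U Q t"
    and \<Gamma>_manifold: "P \<in> \<Gamma> \<Longrightarrow> \<exists>V (W :: (real^'n) set). P \<in> V \<and> openin (top_of_set \<Gamma>) V \<and> open W \<and> V homeomorphic W"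
  using \<Gamma> closedin_imp_subset[of euclidean \<Omega> \<Gamma>]
  unfolding stationary_level_surface_def hypersurface_in_def constant_on_def by auto

section \<open>The surface as a graph over the whole horizontal space\<close>

definition R where "R = dst (SOME P. P \<in> \<Gamma>)"

lemma dst_\<Gamma>: "P \<in> \<Gamma> \<Longrightarrow> dst P = R"
proof -
  assume P: "P \<in> \<Gamma>"
  then have Q: "(SOME P. P \<in> \<Gamma>) \<in> \<Gamma>" by (rule someI)
  show "dst P = R"
    unfolding R_def using P Q \<Gamma>_sub by (intro same_values_same_distance \<Gamma>_const) auto
qed

lemma R_pos: "R > 0"
proof -
  obtain P where "P \<in> \<Gamma>" using \<Gamma>_ne by blast
  then show ?thesis using dst_\<Gamma>[of P] dst_pos[of P] \<Gamma>_sub by auto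
qed

lemma dst_strict: "s < s' \<Longrightarrow> f x < s' \<Longrightarrow> dst (x, s) < dst (x, s')"
proof (cases "f x < s")
  case True
  then show "s < s' \<Longrightarrow> dst (x, s) < dst (x, s')"
    using dst_vertical[of "(x, s)" "s' - s"] by (simp add: mem_\<Omega>)
next
  case False
  then have "dst (x, s) = 0" using dst_pos[of "(x, s)"] infdist_nonneg[of "(x, s)" "- \<Omega>"] by (simp add: mem_\<Omega>)
  then show "f x < s' \<Longrightarrow> dst (x, s) < dst (x, s')" using dst_pos[of "(x, s')"] by (simp add: mem_\<Omega>)
qed

lemma level_exists: "\<exists>s. dst (x, s) = R"
proof -
  have "compact (f ` cball x R)"
    by (intro compact_continuous_image continuous_on_subset[OF f_cont]) auto
  then have "bounded (f ` cball x R)" by (rule compact_imp_bounded)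
  then obtain M where "\<forall>a\<in>f ` cball x R. norm a \<le> M" unfolding bounded_iff ..
  then have M: "f w \<le> M" if "w \<in> cball x R" for w using that by (auto simp: abs_le_iff)
  \<comment> \<open>M bounds f over the horizontal ball of radius R, so every point of the
    complement over that ball is at least R below the height M + R.\<close>
  have "R \<le> dst (x, M + R)"
  proof (rule ccontr)
    assume "\<not> R \<le> dst (x, M + R)"
    moreover obtain Z where Z: "Z \<in> - \<Omega>" "dist (x, M + R) Z = dst (x, M + R)" by (rule nearest_point)
    ultimately have lt: "dist (x, M + R) Z < R" by simp
    have "dist x (fst Z) \<le> R" "dist (M + R) (snd Z) < R"
      using lt dist_fst_le[of "(x, M + R)" Z] dist_snd_le[of "(x, M + R)" Z] by auto
    then have "M < snd Z" "f (fst Z) \<le> M" using M by (auto simp: dist_real_def)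
    then show False using Z(1) mem_\<Omega>[of "fst Z" "snd Z"] by simp
  qed
  moreover have "dst (x, f x) \<le> R" using dst_pos[of "(x, f x)"] R_pos by (simp add: mem_\<Omega>)
  moreover have "f x \<le> M + R" using M[of x] R_pos by simp
  moreover have "continuous_on {f x..M + R} (\<lambda>s. dst (x, s))" by (intro continuous_intros)
  ultimately obtain s where "dst (x, s) = R" using IVT'[of "\<lambda>s. dst (x, s)" "f x" R "M + R"] by auto
  then show ?thesis ..
qed

definition g where "g x = (SOME s. dst (x, s) = R)"

lemma dst_g: "dst (x, g x) = R"
  unfolding g_def by (rule someI_ex[OF level_exists])

lemma g_\<Omega>: "(x, g x) \<in> \<Omega>"
  using dst_g R_pos by (simp add: dst_pos)

lemma f_less_g: "f x < g x"
  using g_\<Omega> by (simp add: mem_\<Omega>)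

lemma dst_less_R: "dst (x, s) < R \<longleftrightarrow> s < g x"
  using dst_strict[of s "g x" x] dst_strict[of "g x" s x] dst_g[of x] f_less_g[of x]
  by (cases s "g x" rule: linorder_cases) auto

lemma dst_eq_R: "dst (x, s) = R \<longleftrightarrow> s = g x"
  using dst_strict[of s "g x" x] dst_strict[of "g x" s x] dst_g[of x] f_less_g[of x]
  by (cases s "g x" rule: linorder_cases) auto

text \<open>At a fixed height the sign of dst - R is stable under small changes of x, and by strict
  vertical monotonicity that sign tells on which side of the height g lies.\<close>

lemma g_cont: "continuous_on UNIV g"
proof -
  have "(g \<longlongrightarrow> g x) (at x)" for x
  proof (rule order_tendstoI)
    have c: "((\<lambda>x'. dst (x', s)) \<longlongrightarrow> dst (x, s)) (at x)" for s by (intro tendsto_intros)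
    fix a
    {
      assume "a < g x"
      then have "dst (x, a) < R" by (simp add: dst_less_R)
      from order_tendstoD(2)[OF c this] show "\<forall>\<^sub>F x' in at x. a < g x'"
        by eventually_elim (simp add: dst_less_R)
    }
    assume "g x < a"
    then have "R < dst (x, a)" using dst_less_R[of x a] dst_eq_R[of x a] by linarith
    from order_tendstoD(1)[OF c this] show "\<forall>\<^sub>F x' in at x. g x' < a"
    proof eventually_elim
      case (elim x')
      then show "g x' < a" using dst_less_R[of x' a] dst_eq_R[of x' a] by linarith
    qed
  qed
  then show ?thesis by (simp add: continuous_on_def)
qed

lemma graph_cont: "continuous_on UNIV (\<lambda>x. (x, g x))"
  by (intro continuous_intros g_cont)

lemma \<Gamma>_graph: "(x, s) \<in> \<Gamma> \<Longrightarrow> s = g x"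
  using dst_\<Gamma> dst_eq_R by blast

text \<open>The horizontal projection of \<Gamma> is closed because \<Gamma> is relatively closed,
  and open because charts composed with \<open>fst\<close> stay injective, heights on \<Gamma> being
  given by g. Connectedness of the horizontal space does the rest.\<close>

lemma \<Gamma>_all: "(x, g x) \<in> \<Gamma>"
proof -
  have fst\<Gamma>: "fst ` \<Gamma> = {x. (x, g x) \<in> \<Gamma>}" using \<Gamma>_graph by (force simp: image_iff)
  obtain T where T: "closed T" "\<Gamma> = \<Omega> \<inter> T" using \<Gamma>_closed by (auto simp: closedin_closed)
  have "{x. (x, g x) \<in> \<Gamma>} = (\<lambda>x. (x, g x)) -` T" using T g_\<Omega> by auto
  moreover have "closed ((\<lambda>x. (x, g x)) -` T)" by (rule continuous_closed_vimage[OF T(1)])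
      (use graph_cont in \<open>simp add: continuous_on_eq_continuous_at\<close>)
  ultimately have "closed (fst ` \<Gamma>)" using fst\<Gamma> by simp
  moreover have "open (fst ` \<Gamma>)"
  proof (subst open_subopen, intro ballI)
    fix x assume "x \<in> fst ` \<Gamma>"
    then obtain P where P: "P \<in> \<Gamma>" "x = fst P" by blast
    obtain V and W :: "(real^'n) set" where V: "P \<in> V" "openin (top_of_set \<Gamma>) V" "open W" "V homeomorphic W"
      using \<Gamma>_manifold[OF P(1)] by blast
    obtain h k where hk: "homeomorphism V W h k" using V(4) by (auto simp: homeomorphic_def)
    have V\<Gamma>: "V \<subseteq> \<Gamma>" using V(2) by (rule openin_imp_subset)
    have k: "continuous_on W k" "k ` W = V" "\<And>w. w \<in> W \<Longrightarrow> h (k w) = w" using hk by (auto simp: homeomorphism_def)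
    have "open ((\<lambda>w. fst (k w)) ` W)"
    proof (rule invariance_of_domain)
      show "continuous_on W (\<lambda>w. fst (k w))" by (intro continuous_intros k)
      show "inj_on (\<lambda>w. fst (k w)) W"
      proof (rule inj_onI)
        fix w w' assume w: "w \<in> W" "w' \<in> W" "fst (k w) = fst (k w')"
        then have "k w \<in> \<Gamma>" "k w' \<in> \<Gamma>" using k V\<Gamma> by auto
        then have "snd (k w) = g (fst (k w))" "snd (k w') = g (fst (k w'))"
          using \<Gamma>_graph[of "fst (k w)" "snd (k w)"] \<Gamma>_graph[of "fst (k w')" "snd (k w')"] by auto
        then have "k w = k w'" using w(3) by (intro prod_eqI) simp_all
        then show "w = w'" using k(3) w by metis
      qed
    qed (rule V)
    moreover have "(\<lambda>w. fst (k w)) ` W = fst ` V" using k(2) by auto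
    ultimately have "open (fst ` V)" by simp
    then show "\<exists>T. open T \<and> x \<in> T \<and> T \<subseteq> fst ` \<Gamma>" using P V(1) V\<Gamma> by blast
  qed
  ultimately have "fst ` \<Gamma> = UNIV" using \<Gamma>_ne clopen[of "fst ` \<Gamma>"] by auto
  then show ?thesis using fst\<Gamma> by auto
qed

text \<open>The spatial gradient of U at time 1, an arbitrary choice of a positive time.\<close>

definition G :: "(real^'n) \<times> real \<Rightarrow> (real^'n) \<times> real" where
  "G X = (\<Sum>i\<in>Basis. Ux i X 1 *\<^sub>R i)"

lemma G_inner: "G X \<bullet> \<xi> = (\<Sum>i\<in>Basis. (\<xi> \<bullet> i) * Ux i X 1)"
  unfolding G_def inner_sum_left by (intro sum.cong) (auto simp: inner_commute)

lemma G_nonzero: "X \<in> \<Omega> \<Longrightarrow> G X \<noteq> 0"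
proof
  assume X: "X \<in> \<Omega>" and "G X = 0"
  then have "Ux up X 1 = 0" using inner_sum_left_Basis[OF up_Basis, of "\<lambda>i. Ux i X 1"] unfolding G_def by simp
  then show False using vertical_derivative_negative[OF X, of 1] by simp
qed

lemma Ux_slice_cont: "i \<in> Basis \<Longrightarrow> continuous_on \<Omega> (\<lambda>X. Ux i X 1)"
  using continuous_on_compose2[OF Ux_cont, of i \<Omega> "\<lambda>X. (X, 1)"] \<Omega>_D
  by (auto simp: image_subset_iff continuous_on_Pair)

text \<open>
  Every ball of radius \<open>R\<close> about a nearest boundary point lies below \<open>\<Gamma>\<close>, hence in the superlevel
  set; so its inner normal at \<open>P\<close> is the direction of the (nonzero) gradient of \<open>U\<close>, and the
  nearest point is unique and depends continuously on \<open>P\<close>.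
\<close>

lemma nearest_formula:
  assumes Z: "Z \<in> - \<Omega>" "dist (x, g x) Z = R"
  shows "Z = (x, g x) + (R / norm (G (x, g x))) *\<^sub>R G (x, g x)"
proof -
  define P where "P = (x, g x)"
  define \<nu> where "\<nu> = (1 / R) *\<^sub>R (Z - P)"
  have P: "P \<in> \<Omega>" using g_\<Omega> by (simp add: P_def)
  have nu: "norm \<nu> = 1" using Z(2) R_pos by (simp add: \<nu>_def P_def dist_norm norm_minus_commute)
  \<comment> \<open>Raising X vertically to \<Gamma> can only lower U, by
    \<open>U_shift\<close>.\<close>
  have above: "U P 1 \<le> U X 1" if X: "X \<in> \<Omega>" "dist X Z < R" for X
  proof -
    obtain y s where ys: "X = (y, s)" by force
    have "dst X < R" using dst_le[OF Z(1), of X] X(2) by simp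
    then have s: "s < g y" by (simp add: ys dst_less_R)
    have "U (X + (0, g y - s)) 1 \<le> U X 1"
      by (rule U_shift[OF _ X(1)]) (use s in \<open>auto intro!: upward_shift\<close>)
    also have "X + (0, g y - s) = (y, g y)" by (simp add: ys)
    also have "U (y, g y) 1 = U P 1" unfolding P_def by (intro \<Gamma>_const \<Gamma>_all) simp
    finally show ?thesis .
  qed
  have "G P \<bullet> \<xi> \<ge> 0" if \<xi>: "\<xi> \<bullet> \<nu> > 0" for \<xi>
  proof -
    have lim: "((\<lambda>h. (U (P + h *\<^sub>R \<xi>) 1 - U P 1) / h) \<longlongrightarrow> G P \<bullet> \<xi>) (at_right 0)"
      unfolding G_inner
      by (rule directional_derivative[where u = "\<lambda>X. U X 1" and ux = "\<lambda>i X. Ux i X 1", OF open_\<Omega> P Ux_slice_cont])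
        (use Ux_deriv \<Omega>_D in \<open>blast intro: zero_less_one\<close>)+
    have "((\<lambda>h. P + h *\<^sub>R \<xi>) \<longlongrightarrow> P + 0 *\<^sub>R \<xi>) (at_right 0)" by (intro tendsto_intros)
    then have "((\<lambda>h. P + h *\<^sub>R \<xi>) \<longlongrightarrow> P) (at_right 0)" by simp
    then have in\<Omega>: "\<forall>\<^sub>F h in at_right 0. P + h *\<^sub>R \<xi> \<in> \<Omega>"
      by (rule topological_tendstoD[OF _ open_\<Omega> P])
    \<comment> \<open>The parameter at which the ray from P in direction \<xi> leaves the ball of
      radius R about Z.\<close>
    define b where "b = 2 * R * (\<xi> \<bullet> \<nu>) / (\<xi> \<bullet> \<xi>)"
    have "\<xi> \<noteq> 0" using \<xi> by auto
    then have b: "b > 0" using \<xi> R_pos by (simp add: b_def)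
    have "\<forall>\<^sub>F h in at_right 0. 0 < h \<and> h < b" using b by (auto simp: eventually_at_right_field)
    with in\<Omega> have "\<forall>\<^sub>F h in at_right 0. 0 \<le> (U (P + h *\<^sub>R \<xi>) 1 - U P 1) / h"
    proof eventually_elim
      case (elim h)
      have ZP: "Z - P = R *\<^sub>R \<nu>" using R_pos by (simp add: \<nu>_def)
      have "(norm (P + h *\<^sub>R \<xi> - Z))\<^sup>2 = (norm (h *\<^sub>R \<xi> - R *\<^sub>R \<nu>))\<^sup>2" unfolding ZP[symmetric] by (simp add: algebra_simps)
      also have "\<dots> = h\<^sup>2 * (\<xi> \<bullet> \<xi>) - 2 * h * R * (\<xi> \<bullet> \<nu>) + R\<^sup>2 * (\<nu> \<bullet> \<nu>)"
        unfolding power2_norm_eq_inner by (simp add: inner_diff_left inner_diff_right inner_commute power2_eq_square algebra_simps)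
      also have "\<nu> \<bullet> \<nu> = 1" using nu by (simp add: dot_square_norm)
      finally have eq: "(norm (P + h *\<^sub>R \<xi> - Z))\<^sup>2 = R\<^sup>2 - h * (2 * R * (\<xi> \<bullet> \<nu>) - h * (\<xi> \<bullet> \<xi>))"
        by (simp add: power2_eq_square algebra_simps)
      have "h * (\<xi> \<bullet> \<xi>) < 2 * R * (\<xi> \<bullet> \<nu>)" using elim \<open>\<xi> \<noteq> 0\<close> by (simp add: b_def pos_less_divide_eq)
      then have "(norm (P + h *\<^sub>R \<xi> - Z))\<^sup>2 < R\<^sup>2" unfolding eq using elim by simp
      then have "dist (P + h *\<^sub>R \<xi>) Z < R" using R_pos by (simp add: dist_norm power2_less_imp_less)
      then show ?case using above[of "P + h *\<^sub>R \<xi>"] elim by simp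
    qed
    then show ?thesis by (intro tendsto_lowerbound[OF lim]) auto
  qed
  then have eq: "G P = norm (G P) *\<^sub>R \<nu>" by (intro half_space_gradient[OF nu]) (auto simp: inner_commute)
  have "norm (G P) \<noteq> 0" using G_nonzero[OF P] by simp
  then have "(R / norm (G P)) *\<^sub>R G P = R *\<^sub>R \<nu>" by (subst eq) simp
  also have "\<dots> = Z - P" using R_pos by (simp add: \<nu>_def)
  finally show ?thesis by (simp add: P_def)
qed

text \<open>The map F to the nearest point moves the horizontal coordinate by at most R, so w + x -
  fst (F x) lies in the closed R-ball about w. Brouwer gives a fixed point, that is, F x over w, and
  \<open>nearest_on_graph\<close> puts it on the graph.\<close>

lemma boundary_point_touched:
  obtains x where "dist (x, g x) (w, f w) = R"
proof -
  define F where "F x = (x, g x) + (R / norm (G (x, g x))) *\<^sub>R G (x, g x)" for x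
  have F: "F x \<in> - \<Omega>" "dist (x, g x) (F x) = R" for x
  proof -
    obtain Z where Z: "Z \<in> - \<Omega>" "dist (x, g x) Z = R" using nearest_point[of "(x, g x)"] dst_g by metis
    then have "Z = F x" unfolding F_def by (rule nearest_formula)
    then show "F x \<in> - \<Omega>" "dist (x, g x) (F x) = R" using Z by auto
  qed
  have "continuous_on \<Omega> G" unfolding G_def by (intro continuous_intros Ux_slice_cont)
  then have Gc: "continuous_on UNIV (\<lambda>x. G (x, g x))"
    by (rule continuous_on_compose2) (use graph_cont g_\<Omega> in auto)
  have Fc: "continuous_on UNIV F"
    unfolding F_def by (intro continuous_intros graph_cont Gc) (use G_nonzero g_\<Omega> in auto)
  have "\<exists>x\<in>cball w R. fst (F x) = w"
  proof (rule brouwer_surjective_cball[where S = "{w}"])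
    show "continuous_on (cball w R) (\<lambda>x. fst (F x))"
      using continuous_on_fst[OF continuous_on_subset[OF Fc]] by auto
    fix y z assume "y \<in> {w}" "z \<in> cball w R"
    have "dist z (fst (F z)) \<le> R" using dist_fst_le[of "(z, g z)" "F z"] F(2)[of z] by simp
    then show "y + (z - fst (F z)) \<in> cball w R" using \<open>y \<in> {w}\<close> by (simp add: dist_norm norm_minus_commute)
  qed (use R_pos in auto)
  then obtain x where x: "fst (F x) = w" by blast
  have "snd (F x) = f (fst (F x))"
    by (rule nearest_on_graph[OF g_\<Omega>[of x] F(1)]) (simp add: F(2) dst_g)
  then have "F x = (w, f w)" using x by (simp add: prod_eq_iff)
  then show ?thesis using that F(2) by metis
qed

lemma maximal_increment_constant:
  assumes max: "\<And>x. f (x + y) - f x \<le> f (x0 + y) - f x0"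
  shows "f (x + y) - f x = f (x0 + y) - f x0"
proof -
  define h where "h = f (x0 + y) - f x0"
  define \<xi> where "\<xi> = (y, h)"
  have \<xi>: "X + \<xi> \<in> \<Omega>" if "X \<in> \<Omega>" for X
    using that max[of "fst X"] by (cases X) (auto simp: \<xi>_def mem_\<Omega> h_def)
  obtain p where p: "dist (p, g p) (x0, f x0) = R" by (rule boundary_point_touched)
  define P where "P = (p, g p)"
  \<comment> \<open>The shift takes (x0, f x0) to a point of the graph, which bounds the distance
    from above; that \<xi> maps \<Omega> into itself bounds it from below.\<close>
  have "dst (P + \<xi>) = R"
  proof (rule antisym)
    have "(x0, f x0) + \<xi> \<in> - \<Omega>" by (simp add: \<xi>_def h_def mem_\<Omega>)
    from dst_le[OF this, of "P + \<xi>"] show "dst (P + \<xi>) \<le> R" using p by (simp add: P_def dist_norm)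
    obtain Z where Z: "Z \<in> - \<Omega>" "dist (P + \<xi>) Z = dst (P + \<xi>)" by (rule nearest_point)
    have "Z - \<xi> \<in> - \<Omega>" using \<xi>[of "Z - \<xi>"] Z(1) by auto
    from dst_le[OF this, of P] show "R \<le> dst (P + \<xi>)"
      using Z(2) dst_g[of p] by (simp add: P_def dist_norm algebra_simps)
  qed
  then have "P + \<xi> = (p + y, g (p + y))" using dst_eq_R[of "p + y" "g p + h"] by (simp add: P_def \<xi>_def)
  then have eqP: "U (P + \<xi>) t = U P t" if "t > 0" for t
    using \<Gamma>_const[OF \<Gamma>_all[of "p + y"] \<Gamma>_all[of p] that] by (simp add: P_def)
  have PO: "P \<in> \<Omega>" using g_\<Omega> by (simp add: P_def)
  \<comment> \<open>Rigidity gives equality of U at all times, which is read back as equality of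
    distances.\<close>
  have deq: "dst (X + \<xi>) = dst X" if "X \<in> \<Omega>" for X
    by (rule same_values_same_distance[OF \<xi>[OF that] that])
      (rule shift_rigidity[OF \<xi> PO eqP that])
  \<comment> \<open>As a point over x descends to the graph, the distance of its shift tends to 0,
    so the limit is on or below the graph. This is the reverse inequality for the
    increments.\<close>
  have "((\<lambda>e. e - dst ((x + y, f x + e + h))) \<longlongrightarrow> 0 - dst (x + y, f x + 0 + h)) (at_right 0)"
    by (intro tendsto_intros)
  moreover have "\<forall>\<^sub>F e in at_right 0. 0 \<le> e - dst (x + y, f x + e + h)"
  proof (rule eventually_mono[OF eventually_at_right_less])
    fix e :: real assume e: "0 < e"
    have "dst (x + y, f x + e + h) = dst (x, f x + e)"
      using deq[of "(x, f x + e)"] e by (simp add: mem_\<Omega> \<xi>_def)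
    also have "\<dots> \<le> dist (x, f x + e) (x, f x)" by (rule dst_le) (simp add: mem_\<Omega>)
    also have "\<dots> = e" using e by (simp add: dist_Pair_Pair dist_real_def)
    finally show "0 \<le> e - dst (x + y, f x + e + h)" by simp
  qed
  ultimately have "0 \<le> 0 - dst (x + y, f x + 0 + h)" by (intro tendsto_lowerbound) auto
  then have "\<not> dst (x + y, f x + h) > 0" by simp
  then have "f x + h \<le> f (x + y)" using dst_pos[of "(x + y, f x + h)"] by (simp add: mem_\<Omega>)
  then show ?thesis using max[of x] by (simp add: h_def)
qed

text \<open>A minimum of the y-increment at x0 is a maximum of the (- y)-increment at x0 +
  y.\<close>

lemma minimal_increment_constant:
  assumes min: "\<And>x. f (x0 + y) - f x0 \<le> f (x + y) - f x"
  shows "f (x + y) - f x = f (x0 + y) - f x0"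
proof -
  have "f (z + - y) - f z \<le> f ((x0 + y) + - y) - f (x0 + y)" for z
    using min[of "z - y"] by simp
  from maximal_increment_constant[OF this, of "x + y"] show ?thesis by simp
qed

end

subsection \<open>Extremal increments and affine functions\<close>

text \<open>Reduction modulo the lattice generated by B brings every point into the parallelepiped
  of fractional coordinates, which lies in the ball of radius r.\<close>

lemma periodic_attains_sup:
  fixes m :: "'a::euclidean_space \<Rightarrow> real"
  assumes B: "independent B" "span B = UNIV" and m: "continuous_on UNIV m"
    and per: "\<And>b x. b \<in> B \<Longrightarrow> m (x + b) = m x"
  shows "\<exists>x0. \<forall>x. m x \<le> m x0"
proof -
  have fin: "finite B" using B(1) by (rule independent_imp_finite)
  have nat: "m (x + real n *\<^sub>R b) = m x" if "b \<in> B" for b x n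
  proof (induction n)
    case (Suc n)
    have "x + real (Suc n) *\<^sub>R b = (x + real n *\<^sub>R b) + b" by (simp add: algebra_simps)
    then show ?case using Suc per[OF that] by metis
  qed simp
  have int: "m (x + of_int k *\<^sub>R b) = m x" if "b \<in> B" for b x k
  proof (cases "k \<ge> 0")
    case True
    then show ?thesis using nat[OF that, of x "nat k"] by simp
  next
    case False
    then show ?thesis using nat[OF that, of "x + of_int k *\<^sub>R b" "nat (- k)"] by simp
  qed
  have sums: "m (x + (\<Sum>b\<in>A. of_int (k b) *\<^sub>R b)) = m x" if "A \<subseteq> B" for A x k
    using finite_subset[OF that fin] that
  proof (induction A)
    case (insert b A)
    have "m (x + (\<Sum>b\<in>insert b A. of_int (k b) *\<^sub>R b)) = m ((x + (\<Sum>b\<in>A. of_int (k b) *\<^sub>R b)) + of_int (k b) *\<^sub>R b)"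
      using insert by (simp add: ac_simps)
    also have "\<dots> = m (x + (\<Sum>b\<in>A. of_int (k b) *\<^sub>R b))" using insert by (intro int) simp
    also have "\<dots> = m x" using insert by simp
    finally show ?case .
  qed simp
  define r where "r = (\<Sum>b\<in>B. norm b)"
  have r: "r \<ge> 0" by (simp add: r_def sum_nonneg)
  have "cball (0::'a) r \<noteq> {}" using r by simp
  from continuous_attains_sup[OF compact_cball this continuous_on_subset[OF m subset_UNIV]]
  obtain x0 where x0: "\<And>y. y \<in> cball 0 r \<Longrightarrow> m y \<le> m x0" by blast
  have "m x \<le> m x0" for x
  proof -
    have "x \<in> range (\<lambda>u. \<Sum>b\<in>B. u b *\<^sub>R b)" using span_finite[OF fin] B(2) by simp
    then obtain u where u: "x = (\<Sum>b\<in>B. u b *\<^sub>R b)" by blast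
    define y where "y = (\<Sum>b\<in>B. frac (u b) *\<^sub>R b)"
    have "x = y + (\<Sum>b\<in>B. of_int \<lfloor>u b\<rfloor> *\<^sub>R b)"
      unfolding u y_def sum.distrib[symmetric] scaleR_add_left[symmetric] by (simp add: frac_def)
    then have "m x = m y" using sums[OF order_refl, of y] by simp
    moreover have "norm y \<le> r" unfolding y_def r_def
    proof (rule sum_norm_le)
      fix b assume "b \<in> B"
      show "norm (frac (u b) *\<^sub>R b) \<le> norm b"
        using frac_ge_0[of "u b"] frac_lt_1[of "u b"] mult_right_mono[of "frac (u b)" 1 "norm b"] by simp
    qed
    ultimately show ?thesis using x0[of y] by simp
  qed
  then show ?thesis by blast
qed

text \<open>Cauchy's functional equation. By additivity, n times the defect F (r x) - r F x equals
  the defect for the fractional part of n r, which continuity bounds independently of n.\<close>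

lemma continuous_additive_linear:
  fixes F :: "'a::euclidean_space \<Rightarrow> real"
  assumes add: "\<And>x y. F (x + y) = F x + F y" and c: "continuous_on UNIV F"
  shows "linear F"
proof (rule linearI[OF add])
  fix r :: real and x :: 'a
  have F0: "F 0 = 0" using add[of 0 0] by simp
  have nat: "F (real n *\<^sub>R y) = real n * F y" for n y
  proof (induction n)
    case (Suc n)
    have "real (Suc n) *\<^sub>R y = real n *\<^sub>R y + y" by (simp add: algebra_simps)
    then show ?case using Suc by (simp add: add algebra_simps)
  qed (simp add: F0)
  have neg: "F (- y) = - F y" for y using add[of y "- y"] F0 by simp
  have int: "F (of_int k *\<^sub>R y) = of_int k * F y" for k y
  proof (cases "k \<ge> 0")
    case True
    then show ?thesis using nat[of "nat k" y] by simp
  next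
    case False
    then show ?thesis using nat[of "nat (- k)" y] neg[of "of_int k *\<^sub>R y"] by simp
  qed
  have "compact ((\<lambda>s. F (s *\<^sub>R x)) ` {0..1})"
    by (intro compact_continuous_image compact_Icc continuous_on_compose2[OF c]) (auto intro!: continuous_intros)
  then have "bounded ((\<lambda>s. F (s *\<^sub>R x)) ` {0..1})" by (rule compact_imp_bounded)
  then obtain M where "\<forall>a\<in>(\<lambda>s. F (s *\<^sub>R x)) ` {0..1}. norm a \<le> M" unfolding bounded_iff ..
  then have M: "\<bar>F (s *\<^sub>R x)\<bar> \<le> M" if "0 \<le> s" "s \<le> 1" for s using that by auto
  have M0: "M \<ge> 0" using M[of 0] by simp
  have est: "real n * \<bar>F (r *\<^sub>R x) - r * F x\<bar> \<le> 2 * M" for n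
  proof -
    define t where "t = real n * r"
    have fr: "0 \<le> frac t" "frac t \<le> 1" using frac_ge_0[of t] frac_lt_1[of t] by linarith+
    have "real n *\<^sub>R (r *\<^sub>R x) = of_int \<lfloor>t\<rfloor> *\<^sub>R x + frac t *\<^sub>R x"
      by (simp add: t_def frac_def flip: scaleR_add_left)
    then have "real n * F (r *\<^sub>R x) = of_int \<lfloor>t\<rfloor> * F x + F (frac t *\<^sub>R x)"
      using nat[of n "r *\<^sub>R x"] by (simp add: add int)
    moreover have "real n * (r * F x) = of_int \<lfloor>t\<rfloor> * F x + frac t * F x"
      by (simp add: t_def frac_def algebra_simps)
    ultimately have "real n * (F (r *\<^sub>R x) - r * F x) = F (frac t *\<^sub>R x) - frac t * F x"
      by (simp add: right_diff_distrib)
    moreover have "\<bar>frac t * F x\<bar> \<le> 1 * M"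
      unfolding abs_mult using fr M[of 1] by (intro mult_mono) auto
    ultimately have "\<bar>real n * (F (r *\<^sub>R x) - r * F x)\<bar> \<le> 2 * M"
      using M[OF fr] by linarith
    then show ?thesis by (simp add: abs_mult)
  qed
  have "\<bar>F (r *\<^sub>R x) - r * F x\<bar> = 0"
  proof (rule ccontr)
    assume "\<bar>F (r *\<^sub>R x) - r * F x\<bar> \<noteq> 0"
    then have "0 < \<bar>F (r *\<^sub>R x) - r * F x\<bar>" by simp
    then obtain n where "2 * M < real n * \<bar>F (r *\<^sub>R x) - r * F x\<bar>" using reals_Archimedean3 by blast
    then show False using est[of n] by simp
  qed
  then show "F (r *\<^sub>R x) = r *\<^sub>R F x" by simp
qed

lemma affine_of_extremal_increments:
  fixes f :: "'a::euclidean_space \<Rightarrow> real"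
  assumes f: "continuous_on UNIV f" and B: "independent B" "span B = UNIV"
    and ext: "\<And>y. y \<in> B \<Longrightarrow> (\<exists>x0. \<forall>x. f (x + y) - f x \<le> f (x0 + y) - f x0) \<or>
          (\<exists>x0. \<forall>x. f (x0 + y) - f x0 \<le> f (x + y) - f x)"
    and max: "\<And>x0 y x. (\<And>x. f (x + y) - f x \<le> f (x0 + y) - f x0) \<Longrightarrow> f (x + y) - f x = f (x0 + y) - f x0"
    and min: "\<And>x0 y x. (\<And>x. f (x0 + y) - f x0 \<le> f (x + y) - f x) \<Longrightarrow> f (x + y) - f x = f (x0 + y) - f x0"
  shows "\<exists>L b. linear L \<and> (\<forall>x. f x = L x + b)"
proof -
  have basis: "f (x + b) - f x = f b - f 0" if b: "b \<in> B" for b x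
  proof -
    obtain x0 where "\<And>x. f (x + b) - f x = f (x0 + b) - f x0" using ext[OF b] max min by metis
    from this[of x] this[of 0] show ?thesis by simp
  qed
  have all: "f (x + y) - f x = f y - f 0" for x y
  proof -
    have "\<exists>x0. \<forall>x. f (x + y) - f x \<le> f (x0 + y) - f x0"
    proof (rule periodic_attains_sup[OF B])
      show "continuous_on UNIV (\<lambda>x. f (x + y) - f x)"
        by (intro continuous_intros f continuous_on_compose2[OF f]) auto
      fix b x assume "b \<in> B"
      then show "f (x + b + y) - f (x + b) = f (x + y) - f x"
        using basis[of b "x + y"] basis[of b x] by (simp add: ac_simps)
    qed
    then obtain x0 where "\<And>x. f (x + y) - f x = f (x0 + y) - f x0" using max by metis
    from this[of x] this[of 0] show ?thesis by simp
  qed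
  have "linear (\<lambda>x. f x - f 0)"
  proof (rule continuous_additive_linear)
    show "f (x + y) - f 0 = f x - f 0 + (f y - f 0)" for x y using all[of x y] by simp
    show "continuous_on UNIV (\<lambda>x. f x - f 0)" by (intro continuous_intros f)
  qed
  then show ?thesis by (intro exI[of _ "\<lambda>x. f x - f 0"] exI[of _ "f 0"]) simp
qed

text \<open>As \<open>deriv\<close> and \<open>laplacian\<close> are total, the equation carries
  information only once the iterated derivatives of \<phi>(U) are shown to exist; the chain rule
  does this and turns the equation into non-divergence form.\<close>

lemma solution_c21:
  fixes U :: "'a::euclidean_space \<Rightarrow> real \<Rightarrow> real"
  assumes D: "open D" and sol: "bounded_diffusion_solution \<phi> D U"
    and \<phi>: "\<And>s. (\<phi> has_real_derivative \<phi>' s) (at s)" "\<And>s. (\<phi>' has_real_derivative \<phi>'' s) (at s)"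
  obtains Ut Ux Uxx where "c21 D U Ut Ux Uxx" "\<exists>M. \<forall>X\<in>D. \<forall>t>0. \<bar>U X t\<bar> \<le> M"
    "\<And>X t. X \<in> D \<Longrightarrow> t > 0 \<Longrightarrow> Ut X t = (\<Sum>i\<in>Basis. \<phi>'' (U X t) * (Ux i X t)\<^sup>2 + \<phi>' (U X t) * Uxx i X t)"
proof -
  have "C21_on D U" using sol by (simp add: bounded_diffusion_solution_def)
  then obtain Ut Ux Uxx where U0:
    "continuous_on (D \<times> {0<..}) (\<lambda>(X, t). U X t) \<and>
        continuous_on (D \<times> {0<..}) (\<lambda>(X, t). Ut X t) \<and>
        (\<forall>X\<in>D. \<forall>t>0. (U X has_real_derivative Ut X t) (at t)) \<and>
        (\<forall>i\<in>Basis.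
           continuous_on (D \<times> {0<..}) (\<lambda>(X, t). Ux i X t) \<and>
           (\<forall>X\<in>D. \<forall>t>0. ((\<lambda>h. U (X + h *\<^sub>R i) t) has_real_derivative Ux i X t) (at 0))) \<and>
        (\<forall>i\<in>Basis. \<forall>j\<in>Basis.
           continuous_on (D \<times> {0<..}) (\<lambda>(X, t). Uxx i j X t) \<and>
           (\<forall>X\<in>D. \<forall>t>0. ((\<lambda>h. Ux i (X + h *\<^sub>R j) t) has_real_derivative Uxx i j X t) (at 0)))"
    unfolding C21_on_def by (elim exE) (rule that)
  have U:
    "\<And>X t. X \<in> D \<Longrightarrow> t > 0 \<Longrightarrow> (U X has_real_derivative Ut X t) (at t)"
    "\<And>i X t. i \<in> Basis \<Longrightarrow> X \<in> D \<Longrightarrow> t > 0 \<Longrightarrow> ((\<lambda>h. U (X + h *\<^sub>R i) t) has_real_derivative Ux i X t) (at 0)"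
    "\<And>i j X t. i \<in> Basis \<Longrightarrow> j \<in> Basis \<Longrightarrow> X \<in> D \<Longrightarrow> t > 0 \<Longrightarrow>
       ((\<lambda>h. Ux i (X + h *\<^sub>R j) t) has_real_derivative Uxx i j X t) (at 0)"
    using U0 by blast+
  have eq: "\<And>X t. X \<in> D \<Longrightarrow> t > 0 \<Longrightarrow> deriv (U X) t = laplacian (\<lambda>Y. \<phi> (U Y t)) X"
    and bd: "bounded ((\<lambda>(X, t). U X t) ` (D \<times> {0<..}))"
    using sol unfolding bounded_diffusion_solution_def by auto
  show ?thesis
  proof (rule that[of Ut Ux "\<lambda>i. Uxx i i"])
    show "c21 D U Ut Ux (\<lambda>i. Uxx i i)" unfolding c21_def using U0 by blast
    obtain M where "\<forall>a\<in>(\<lambda>(X, t). U X t) ` (D \<times> {0<..}). norm a \<le> M" using bd unfolding bounded_iff ..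
    then show "\<exists>M. \<forall>X\<in>D. \<forall>t>0. \<bar>U X t\<bar> \<le> M" by force
    fix X t assume X: "X \<in> D" and t: "(0::real) < t"
    have pd: "partial_deriv i (\<lambda>Y. \<phi> (U Y t)) Y = \<phi>' (U Y t) * Ux i Y t" if i: "i \<in> Basis" and Y: "Y \<in> D" for i Y
      unfolding partial_deriv_def using DERIV_chain'[OF U(2)[OF i Y t] \<phi>(1)] by (intro DERIV_imp_deriv) simp
    have "partial_deriv i (partial_deriv i (\<lambda>Y. \<phi> (U Y t))) X = \<phi>'' (U X t) * (Ux i X t)\<^sup>2 + \<phi>' (U X t) * Uxx i i X t"
      if i: "i \<in> Basis" for i
    proof -
      have 1: "((\<lambda>h. \<phi>' (U (X + h *\<^sub>R i) t)) has_real_derivative \<phi>'' (U X t) * Ux i X t) (at 0)"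
        using DERIV_chain'[OF U(2)[OF i X t] \<phi>(2)] by simp
      have 2: "((\<lambda>h. \<phi>' (U (X + h *\<^sub>R i) t) * Ux i (X + h *\<^sub>R i) t) has_real_derivative
          \<phi>'' (U X t) * (Ux i X t)\<^sup>2 + \<phi>' (U X t) * Uxx i i X t) (at 0)"
        using DERIV_mult[OF 1 U(3)[OF i i X t]] by (simp add: power2_eq_square algebra_simps)
      have "((\<lambda>h. X + h *\<^sub>R i) \<longlongrightarrow> X + 0 *\<^sub>R i) (nhds 0)" by (intro tendsto_intros filterlim_ident)
      then have "\<forall>\<^sub>F h in nhds 0. X + h *\<^sub>R i \<in> D" using D X by (intro topological_tendstoD) auto
      \<comment> \<open>The formula for the first partial derivative is available at points of D,
        hence for small h.\<close>
      then have ev: "\<forall>\<^sub>F h in nhds 0. partial_deriv i (\<lambda>Y. \<phi> (U Y t)) (X + h *\<^sub>R i) = \<phi>' (U (X + h *\<^sub>R i) t) * Ux i (X + h *\<^sub>R i) t"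
        by eventually_elim (rule pd[OF i])
      have "((\<lambda>h. partial_deriv i (\<lambda>Y. \<phi> (U Y t)) (X + h *\<^sub>R i)) has_real_derivative
          \<phi>'' (U X t) * (Ux i X t)\<^sup>2 + \<phi>' (U X t) * Uxx i i X t) (at 0)"
        using 2 by (subst DERIV_cong_ev[OF refl ev refl])
      then show ?thesis unfolding partial_deriv_def[of i "partial_deriv i (\<lambda>Y. \<phi> (U Y t))"] by (rule DERIV_imp_deriv)
    qed
    then show "Ut X t = (\<Sum>i\<in>Basis. \<phi>'' (U X t) * (Ux i X t)\<^sup>2 + \<phi>' (U X t) * Uxx i i X t)"
      using eq[OF X t] DERIV_imp_deriv[OF U(1)[OF X t]] by (simp add: laplacian_def)
  qed
qed

lemma initial_L1loc_cong:
  assumes "initial_L1loc D U u" "\<And>X. X \<in> D \<Longrightarrow> u X = u' X"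
  shows "initial_L1loc D U u'"
proof -
  have "(\<lambda>X. indicator K X *\<^sub>R (U X t - u X)) = (\<lambda>X. indicator K X *\<^sub>R (U X t - u' X))"
    "(\<lambda>X. indicator K X *\<^sub>R \<bar>U X t - u X\<bar>) = (\<lambda>X. indicator K X *\<^sub>R \<bar>U X t - u' X\<bar>)" if "K \<subseteq> D" for K t
    using assms(2) that by (auto simp: fun_eq_iff indicator_def)
  then have eq: "set_integrable lborel K (\<lambda>X. U X t - u' X) = set_integrable lborel K (\<lambda>X. U X t - u X)"
    "(LINT X:K|lborel. \<bar>U X t - u' X\<bar>) = (LINT X:K|lborel. \<bar>U X t - u X\<bar>)" if "K \<subseteq> D" for K t
    unfolding set_integrable_def set_lebesgue_integral_def using that by simp_all
  show ?thesis
    unfolding initial_L1loc_def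
  proof (intro allI impI)
    fix K assume K: "compact K \<and> K \<subseteq> D"
    then show "(\<forall>t>0. set_integrable lborel K (\<lambda>X. U X t - u' X)) \<and>
        ((\<lambda>t. LINT X:K|lborel. \<bar>U X t - u' X\<bar>) \<longlongrightarrow> 0) (at_right 0)"
      using assms(1) unfolding initial_L1loc_def by (simp add: eq)
  qed
qed

lemma frontier_above_graph:
  fixes f :: "real^'n \<Rightarrow> real"
  assumes f: "continuous_on UNIV f"
  shows "frontier (above_graph f) = {(x, s). s = f x}"
proof -
  have op: "open (above_graph f)"
  proof -
    have "above_graph f = {p. f (fst p) < snd p}" by (auto simp: above_graph_def)
    then show ?thesis by (auto intro!: open_Collect_less continuous_intros continuous_on_compose2[OF f])
  qed
  have "closed {p. f (fst p) \<le> snd p}"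
    by (auto intro!: closed_Collect_le continuous_intros continuous_on_compose2[OF f])
  then have "closure (above_graph f) \<subseteq> {p. f (fst p) \<le> snd p}"
    by (intro closure_minimal) (auto simp: above_graph_def)
  moreover have "(x, f x) \<in> closure (above_graph f)" for x
    unfolding closure_approachable
  proof (intro allI impI)
    fix e :: real assume "e > 0"
    then show "\<exists>y\<in>above_graph f. dist y (x, f x) < e"
      by (intro bexI[of _ "(x, f x + e / 2)"]) (auto simp: above_graph_def dist_Pair_Pair dist_real_def)
  qed
  ultimately show ?thesis
    unfolding frontier_def interior_open[OF op] by (auto simp: above_graph_def)
qed

theorem theorem1:
  fixes f :: "real^'n \<Rightarrow> real"
    and \<phi> \<phi>' \<phi>'' :: "real \<Rightarrow> real"
    and \<delta>\<^sub>1 \<delta>\<^sub>2 :: real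
    and \<Omega> \<Gamma> :: "((real^'n) \<times> real) set"
    and U :: "(real^'n) \<times> real \<Rightarrow> real \<Rightarrow> real"
    and B :: "(real^'n) set"
  assumes f_cont: "continuous_on UNIV f"
    and \<Omega>: "\<Omega> = above_graph f"
    and \<phi>_deriv: "\<And>s. (\<phi> has_real_derivative \<phi>' s) (at s)"
    and \<phi>_deriv2: "\<And>s. (\<phi>' has_real_derivative \<phi>'' s) (at s)"
    and \<phi>_C2: "continuous_on UNIV \<phi>''"
    and \<phi>_0: "\<phi> 0 = 0"
    and \<delta>: "0 < \<delta>\<^sub>1" "0 < \<delta>\<^sub>2"
    and \<phi>_bounds: "\<And>s. \<delta>\<^sub>1 \<le> \<phi>' s \<and> \<phi>' s \<le> \<delta>\<^sub>2"
    and U: "initial_boundary_solution \<phi> \<Omega> U \<or> cauchy_solution \<phi> \<Omega> U"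
    and basis: "independent B" "span B = UNIV"
    and extremum: "\<And>y. y \<in> B \<Longrightarrow>
          (\<exists>x0. \<forall>x. f (x + y) - f x \<le> f (x0 + y) - f x0) \<or>
          (\<exists>x0. \<forall>x. f (x0 + y) - f x0 \<le> f (x + y) - f x)"
    and \<Gamma>: "stationary_level_surface \<Omega> U \<Gamma>"
  shows "(\<exists>L b. linear L \<and> (\<forall>x. f x = L x + b)) \<and>
         (\<exists>\<nu> c. \<nu> \<noteq> 0 \<and> frontier \<Omega> = {X. \<nu> \<bullet> X = c})"
proof -
  have op: "open \<Omega>"
  proof -
    have "\<Omega> = {p. f (fst p) < snd p}" by (auto simp: \<Omega> above_graph_def)
    then show ?thesis by (auto intro!: open_Collect_less continuous_intros continuous_on_compose2[OF f_cont])
  qed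
  \<comment> \<open>In the first problem continuity on the closure yields the value 1 as a limit
    from inside; in the second, D has no boundary points.\<close>
  obtain D where D: "D = \<Omega> \<or> D = UNIV" "bounded_diffusion_solution \<phi> D U"
    "initial_L1loc D U (indicator (- \<Omega>))"
    "\<And>X t. X \<in> closure D \<Longrightarrow> X \<notin> D \<Longrightarrow> t > 0 \<Longrightarrow> ((\<lambda>(Y, s). U Y s) \<longlongrightarrow> 1) (at (X, t) within D \<times> {0<..})"
    using U
  proof
    assume ib: "initial_boundary_solution \<phi> \<Omega> U"
    show thesis
    proof (rule that[of \<Omega>])
      show "bounded_diffusion_solution \<phi> \<Omega> U" using ib by (simp add: initial_boundary_solution_def)
      show "initial_L1loc \<Omega> U (indicator (- \<Omega>))"
        by (rule initial_L1loc_cong[of \<Omega> U "\<lambda>X. 0"])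
          (use ib in \<open>simp_all add: initial_boundary_solution_def\<close>)
      fix X t assume X: "X \<in> closure \<Omega>" "X \<notin> \<Omega>" and t: "(0::real) < t"
      have "X \<in> frontier \<Omega>" using X interior_subset[of \<Omega>] by (auto simp: frontier_def)
      then have "U X t = 1" using ib t by (simp add: initial_boundary_solution_def)
      moreover have lim: "((\<lambda>(Y, s). U Y s) \<longlongrightarrow> U X t) (at (X, t) within closure \<Omega> \<times> {0<..})"
        using ib X t by (auto simp: initial_boundary_solution_def continuous_on_def)
      have sub: "\<Omega> \<times> {0<..} \<subseteq> closure \<Omega> \<times> {0::real<..}" using closure_subset[of \<Omega>] by blast
      ultimately show "((\<lambda>(Y, s). U Y s) \<longlongrightarrow> 1) (at (X, t) within \<Omega> \<times> {0<..})"
        using tendsto_within_subset[OF lim sub] by simp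
    qed simp
  next
    assume "cauchy_solution \<phi> \<Omega> U"
    then show thesis by - (rule that[OF disjI2[OF refl]]; simp add: cauchy_solution_def)
  qed
  have opD: "open D" using D(1) op by auto
  obtain Ut Ux Uxx where c: "c21 D U Ut Ux Uxx" "\<exists>M. \<forall>X\<in>D. \<forall>t>0. \<bar>U X t\<bar> \<le> M"
    "\<And>X t. X \<in> D \<Longrightarrow> t > 0 \<Longrightarrow> Ut X t = (\<Sum>i\<in>Basis. \<phi>'' (U X t) * (Ux i X t)\<^sup>2 + \<phi>' (U X t) * Uxx i X t)"
    by (rule solution_c21[OF opD D(2) \<phi>_deriv \<phi>_deriv2]) blast
  interpret stationary_surface \<phi> \<phi>' \<phi>'' \<delta>\<^sub>1 \<delta>\<^sub>2 f \<Omega> D U Ut Ux Uxx \<Gamma>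
    by unfold_locales (fact \<phi>_deriv \<phi>_deriv2 \<phi>_C2 \<phi>_0 \<delta> \<phi>_bounds f_cont \<Omega> D(1) c D(4) D(3) \<Gamma>)+
  obtain L b where L: "linear L" "\<And>x. f x = L x + b"
    using affine_of_extremal_increments[OF f_cont basis extremum maximal_increment_constant minimal_increment_constant]
    by blast
  \<comment> \<open>The upward normal of the hyperplane: \<open>adjoint L 1\<close> is the gradient
    of L.\<close>
  define \<nu> :: "(real^'n) \<times> real" where "\<nu> = (- adjoint L 1, 1)"
  have "\<nu> \<bullet> (x, s) = s - L x" for x s
    using adjoint_works[OF L(1), of x 1] by (simp add: \<nu>_def inner_commute)
  then have "frontier \<Omega> = {X. \<nu> \<bullet> X = b}"
    unfolding \<Omega> frontier_above_graph[OF f_cont] by (auto simp: L(2))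
  moreover have "\<nu> \<noteq> 0" by (simp add: \<nu>_def zero_prod_def)
  ultimately show ?thesis using L by blast
qed

end
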